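(* Let $d\ge1$ be an integer. (1) The subset $\{ f \in S_d : m_k(f) \leq m\}\subset \mathcal{C}(d)$ is Zariski open and dense in $\mathcal{C}(d)$ for any $k\geq 0$ and any $m \geq 0$. In particular, the two sets $\{ f \in \mathcal{C}(d)_0 : \tau(f) \leq m\} \subset \mathcal{C}(d)_0$ and $\{ f \in A(d) : \tau(f) \leq m\} \subset A(d)$ are Zariski open and dense in $\mathcal{C}(d)_0$ (resp. in $A(d)$) for any $k\geq 0$ and any $m\geq 0$. (2) The subset $\{ f \in S_d : mdr(f) \leq m\} \subset \mathcal{C}(d)$ is Zariski closed in $\mathcal{C}(d)$ for any $m\geq 0$. In particular, the two sets $\{ f \in \mathcal{C}(d)_0 : mdr(f) \leq m\} \subset \mathcal{C}(d)_0$ and $\{ f \in A(d) : mdr(f) \leq m\} \subset A(d)$ are Zariski closed in $\mathcal{C}(d)_0$ (resp. in $A(d)$) for any $m \geq 0$.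
   Context: $S=\mathbb{C}[x,y,z]$ is the graded polynomial ring, and $S_m$ is the vector space of homogeneous polynomials of degree $m$ in $S$. $\mathcal{C}(d)=\mathbb{P}(S_d)$ is the parameter space of degree $d$ curves in the complex projective plane; $\mathcal{C}(d)_0\subset\mathcal{C}(d)$ is the subset of curves having only isolated singularities (reduced curves); $A(d)\subset\mathcal{C}(d)_0$ is the subset of line arrangements consisting of $d$ distinct lines (products of $d$ pairwise non-proportional linear forms). A nonzero polynomial $f\in S_d$ is identified with its class in $\mathbb{P}(S_d)$; the invariants below depend only on this class. For $f\in S_d$, $J_f=(f_x,f_y,f_z)$ is the ideal generated by the partial derivatives of $f$, $M(f)=S/J_f$ is the graded Milnor (or Jacobian) algebra, and $m_k(f)=\dim_{\mathbb{C}} M(f)_k$. For $f\in\mathcal{C}(d)_0$, $\tau(f)$ is the total Tjurina number of the reduced curve $f=0$ (the sum of the Tjurina numbers of its singular points); it equals $m_k(f)$ for every $k>3(d-2)$. $mdr(f)$ is the smallest integer $r\ge 0$ such that there is a nontrivial relation $af_x+bf_y+cf_z=0$ with $a,b,c\in S_r$, not all zero.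
   Formalization: Density of {m_k(f) ≤ m} in C(d) and of {τ(f) ≤ m} in A(d) is asserted only when the set is nonempty; as printed it fails, e.g. for d ≥ 2 no f has m_0(f) ≤ 0 and no line arrangement has τ(f) ≤ 0. *)

theory Defs
  imports
    "HOL-Analysis.Analysis"
    "HOL-Library.Poly_Mapping"
    "HOL-Library.Extended_Nat"
    "HOL-Computational_Algebra.Formal_Power_Series"
begin

text \<open>
  A polynomial with complex coefficients is a finitely supported function from exponent vectors
  to coefficients, with the convolution product of \<^theory>\<open>HOL-Library.Poly_Mapping\<close>. The ring
  \<open>\<complex>[x,y,z]\<close> has variables indexed by the three-element type \<^typ>\<open>3\<close>, whose arithmetic is
  modulo 3.
\<close>

type_synonym 'v mpoly = "('v \<Rightarrow>\<^sub>0 nat) \<Rightarrow>\<^sub>0 complex"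

type_synonym ternary = "3 mpoly"

definition mdeg :: "('v \<Rightarrow>\<^sub>0 nat) \<Rightarrow> nat" where
  "mdeg \<alpha> = (\<Sum>i\<in>Poly_Mapping.keys \<alpha>. Poly_Mapping.lookup \<alpha> i)"

definition homog :: "nat \<Rightarrow> 'v mpoly set" where
  "homog m = {f. \<forall>\<alpha>\<in>Poly_Mapping.keys f. mdeg \<alpha> = m}"

definition smul :: "complex \<Rightarrow> 'v mpoly \<Rightarrow> 'v mpoly" where
  "smul c f = Poly_Mapping.single 0 c * f"

text \<open>Value of \<open>f\<close> at \<open>x\<close> in a ring to which the coefficients are mapped by \<open>\<phi>\<close>.\<close>

definition subst :: "(complex \<Rightarrow> 'b) \<Rightarrow> ('v \<Rightarrow> 'b) \<Rightarrow> 'v mpoly \<Rightarrow> 'b::comm_semiring_1" where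
  "subst \<phi> x f = (\<Sum>\<alpha>\<in>Poly_Mapping.keys f. \<phi> (Poly_Mapping.lookup f \<alpha>) *
      (\<Prod>i\<in>Poly_Mapping.keys \<alpha>. x i ^ Poly_Mapping.lookup \<alpha> i))"

abbreviation eval :: "('v \<Rightarrow> complex) \<Rightarrow> 'v mpoly \<Rightarrow> complex" where
  "eval x f \<equiv> subst (\<lambda>c. c) x f"

text \<open>Subtraction of exponents is truncated, but it truncates only where the coefficient is 0.\<close>

definition pd :: "'v \<Rightarrow> 'v mpoly \<Rightarrow> 'v mpoly" where
  "pd i f = (\<Sum>\<alpha>\<in>Poly_Mapping.keys f.
      Poly_Mapping.single (\<alpha> - Poly_Mapping.single i 1)
        (of_nat (Poly_Mapping.lookup \<alpha> i) * Poly_Mapping.lookup f \<alpha>))"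

text \<open>For a commutative ring as a module over itself, \<open>ideal.span B\<close> is the ideal generated by
  \<open>B\<close>.\<close>

interpretation ideal: module "(*) :: 'a::comm_ring_1 \<Rightarrow> 'a \<Rightarrow> 'a"
  by unfold_locales (simp_all add: algebra_simps)

text \<open>
  The dimension of \<open>V / (V \<inter> W)\<close>, possibly infinite: the supremum of the sizes of finite sets of
  vectors in \<open>V\<close> whose residue classes modulo \<open>W\<close> are linearly independent. (Congruent distinct
  vectors are excluded by the relation with coefficients 1 and -1.)
\<close>

definition quot_dim ::
    "(complex \<Rightarrow> 'a \<Rightarrow> 'a::comm_monoid_add) \<Rightarrow> 'a set \<Rightarrow> 'a set \<Rightarrow> enat" where
  "quot_dim s V W = Sup {enat (card B) | B. finite B \<and> B \<subseteq> V \<and>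
      (\<forall>c. (\<Sum>b\<in>B. s (c b) b) \<in> W \<longrightarrow> (\<forall>b\<in>B. c b = 0))}"

text \<open>Points of a projective space are the classes of nonzero vectors up to nonzero scalars.\<close>

definition pclass :: "(complex \<Rightarrow> 'a \<Rightarrow> 'a) \<Rightarrow> 'a \<Rightarrow> 'a set" where
  "pclass s v = {s c v | c. c \<noteq> 0}"

definition plane :: "(complex^3) set set" where
  "plane = pclass (*s) ` (UNIV - {0})"

definition forms :: "nat \<Rightarrow> ternary set" where
  "forms d = homog d - {0}"

abbreviation curve :: "ternary \<Rightarrow> ternary set" where
  "curve f \<equiv> pclass smul f"

definition curves :: "nat \<Rightarrow> ternary set set" where
  "curves d = curve ` forms d"


text \<open>
  The homogeneous coordinates on \<open>\<P>(S\<^sub>d)\<close> are the coefficients of a form, so polynomials in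
  these coordinates have variables indexed by exponent vectors. Variables indexed by exponent
  vectors of degree other than \<open>d\<close> may occur, but are evaluated to 0.
\<close>

definition zero_locus :: "nat \<Rightarrow> (3 \<Rightarrow>\<^sub>0 nat) mpoly set \<Rightarrow> ternary set set" where
  "zero_locus d F = {curve f | f. f \<in> forms d \<and> (\<forall>G\<in>F. eval (Poly_Mapping.lookup f) G = 0)}"

definition zariski :: "nat \<Rightarrow> ternary set topology" where
  "zariski d = topology (\<lambda>U. U \<subseteq> curves d \<and>
      (\<exists>F \<subseteq> (\<Union>e. homog e). curves d - U = zero_locus d F))"

lemma subst_superset:
  assumes "finite A" "Poly_Mapping.keys f \<subseteq> A"
  shows "eval x f = (\<Sum>\<alpha>\<in>A. Poly_Mapping.lookup f \<alpha> *
      (\<Prod>i\<in>Poly_Mapping.keys \<alpha>. x i ^ Poly_Mapping.lookup \<alpha> i))"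
  unfolding subst_def using assms
  by (intro sum.mono_neutral_left) (auto simp: in_keys_iff)

lemma mpoly_eval_zero [simp]: "eval x 0 = 0"
  by (simp add: subst_def)

lemma mpoly_eval_add: "eval x (f + g) = eval x f + eval x g"
proof -
  let ?A = "Poly_Mapping.keys f \<union> Poly_Mapping.keys g"
  have "Poly_Mapping.keys (f + g) \<subseteq> ?A" by (rule Poly_Mapping.keys_add)
  then show ?thesis
    by (simp add: subst_superset[of ?A] lookup_add distrib_right sum.distrib)
qed

lemma mpoly_eval_sum: "eval x (sum h A) = (\<Sum>a\<in>A. eval x (h a))"
  by (induction A rule: infinite_finite_induct) (simp_all add: mpoly_eval_add)

lemma mpoly_eval_single:
  "eval x (Poly_Mapping.single \<alpha> c) =
    c * (\<Prod>i\<in>Poly_Mapping.keys \<alpha>. x i ^ Poly_Mapping.lookup \<alpha> i)"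
  by (simp add: subst_def)

lemma monomial_add:
  fixes x :: "'v \<Rightarrow> complex"
  shows "(\<Prod>i\<in>Poly_Mapping.keys (\<alpha> + \<beta>). x i ^ Poly_Mapping.lookup (\<alpha> + \<beta>) i) =
    (\<Prod>i\<in>Poly_Mapping.keys \<alpha>. x i ^ Poly_Mapping.lookup \<alpha> i) *
    (\<Prod>i\<in>Poly_Mapping.keys \<beta>. x i ^ Poly_Mapping.lookup \<beta> i)"
proof -
  let ?A = "Poly_Mapping.keys \<alpha> \<union> Poly_Mapping.keys \<beta>"
  have *: "(\<Prod>i\<in>Poly_Mapping.keys \<gamma>. x i ^ Poly_Mapping.lookup \<gamma> i) =
      (\<Prod>i\<in>?A. x i ^ Poly_Mapping.lookup \<gamma> i)" if "Poly_Mapping.keys \<gamma> \<subseteq> ?A" for \<gamma>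
    using that by (intro prod.mono_neutral_left) (auto simp: in_keys_iff)
  have "Poly_Mapping.keys (\<alpha> + \<beta>) \<subseteq> ?A" by (rule Poly_Mapping.keys_add)
  then show ?thesis
    unfolding *[OF \<open>Poly_Mapping.keys (\<alpha> + \<beta>) \<subseteq> ?A\<close>] *[OF Un_upper1] *[OF Un_upper2]
    by (simp add: lookup_add power_add prod.distrib)
qed

lemma sum_singles:
  "(\<Sum>\<alpha>\<in>Poly_Mapping.keys f. Poly_Mapping.single \<alpha> (Poly_Mapping.lookup f \<alpha>)) = f"
  by (rule poly_mapping_eqI)
    (auto simp: lookup_sum lookup_single when_def in_keys_iff)

lemma mpoly_eval_mult: "eval x (f * g) = eval x f * eval x g"
proof -
  have "f * g = (\<Sum>\<alpha>\<in>Poly_Mapping.keys f. \<Sum>\<beta>\<in>Poly_Mapping.keys g.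
      Poly_Mapping.single (\<alpha> + \<beta>) (Poly_Mapping.lookup f \<alpha> * Poly_Mapping.lookup g \<beta>))"
    unfolding mult_single[symmetric] sum_product[symmetric] sum_singles ..
  then have "eval x (f * g) = (\<Sum>\<alpha>\<in>Poly_Mapping.keys f. \<Sum>\<beta>\<in>Poly_Mapping.keys g.
      (Poly_Mapping.lookup f \<alpha> * (\<Prod>i\<in>Poly_Mapping.keys \<alpha>. x i ^ Poly_Mapping.lookup \<alpha> i)) *
      (Poly_Mapping.lookup g \<beta> * (\<Prod>i\<in>Poly_Mapping.keys \<beta>. x i ^ Poly_Mapping.lookup \<beta> i)))"
    by (simp only: mpoly_eval_sum mpoly_eval_single monomial_add mult.assoc mult.left_commute)
  then show ?thesis
    by (simp add: subst_def sum_product)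
qed

lemma mdeg_add: "mdeg (\<alpha> + \<beta>) = mdeg \<alpha> + mdeg \<beta>"
proof -
  let ?A = "Poly_Mapping.keys \<alpha> \<union> Poly_Mapping.keys \<beta>"
  have *: "mdeg \<gamma> = (\<Sum>i\<in>?A. Poly_Mapping.lookup \<gamma> i)" if "Poly_Mapping.keys \<gamma> \<subseteq> ?A" for \<gamma>
    unfolding mdeg_def
    using that by (intro sum.mono_neutral_left) (auto simp: in_keys_iff)
  have "Poly_Mapping.keys (\<alpha> + \<beta>) \<subseteq> ?A" by (rule Poly_Mapping.keys_add)
  then show ?thesis
    by (simp add: * lookup_add sum.distrib)
qed

lemma homog_mult: "f \<in> homog a \<Longrightarrow> g \<in> homog b \<Longrightarrow> f * g \<in> homog (a + b)"
  using keys_mult[of f g] by (fastforce simp: homog_def mdeg_add)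

lemma eval_homog_scale:
  assumes "G \<in> homog e"
  shows "eval (\<lambda>i. c * x i) G = c ^ e * eval x G"
proof -
  have "(\<Prod>i\<in>Poly_Mapping.keys \<alpha>. (c * x i) ^ Poly_Mapping.lookup \<alpha> i) =
      c ^ e * (\<Prod>i\<in>Poly_Mapping.keys \<alpha>. x i ^ Poly_Mapping.lookup \<alpha> i)"
    if "\<alpha> \<in> Poly_Mapping.keys G" for \<alpha>
  proof -
    have "mdeg \<alpha> = e" using assms that by (auto simp: homog_def)
    then show ?thesis
      by (simp add: power_mult_distrib prod.distrib mdeg_def flip: power_sum)
  qed
  then show ?thesis
    unfolding subst_def sum_distrib_left by (intro sum.cong refl) (simp only: mult.left_commute)
qed

lemma lookup_smul: "Poly_Mapping.lookup (smul c f) = (\<lambda>\<alpha>. c * Poly_Mapping.lookup f \<alpha>)"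
proof
  fix \<alpha>
  have "smul c f = (\<Sum>\<beta>\<in>Poly_Mapping.keys f.
      Poly_Mapping.single \<beta> (c * Poly_Mapping.lookup f \<beta>))"
  proof -
    have "smul c f = Poly_Mapping.single 0 c *
        (\<Sum>\<beta>\<in>Poly_Mapping.keys f. Poly_Mapping.single \<beta> (Poly_Mapping.lookup f \<beta>))"
      unfolding smul_def sum_singles ..
    also have "\<dots> = (\<Sum>\<beta>\<in>Poly_Mapping.keys f.
        Poly_Mapping.single \<beta> (c * Poly_Mapping.lookup f \<beta>))"
      by (simp add: sum_distrib_left mult_single)
    finally show ?thesis .
  qed
  then show "Poly_Mapping.lookup (smul c f) \<alpha> = c * Poly_Mapping.lookup f \<alpha>"
    by (auto simp: lookup_sum lookup_single when_def in_keys_iff)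
qed

lemma curve_eqD:
  assumes "curve f = curve g"
  obtains c where "c \<noteq> 0" "g = smul c f"
proof -
  have "g = smul 1 g"
    by (simp add: smul_def flip: single_one)
  then have "g \<in> curve g"
    unfolding pclass_def by (metis (mono_tags, lifting) mem_Collect_eq zero_neq_one)
  then have "g \<in> curve f" using assms by simp
  then show ?thesis using that by (auto simp: pclass_def)
qed

text \<open>Membership in a zero locus does not depend on the representative of the class.\<close>

lemma zero_locus_iff:
  assumes "F \<subseteq> (\<Union>e. homog e)" "f \<in> forms d"
  shows "curve f \<in> zero_locus d F \<longleftrightarrow> (\<forall>G\<in>F. eval (Poly_Mapping.lookup f) G = 0)"
proof
  assume "curve f \<in> zero_locus d F"
  then obtain g where g: "curve g = curve f"
      "\<forall>G\<in>F. eval (Poly_Mapping.lookup g) G = 0"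
    by (auto simp: zero_locus_def)
  then obtain c where c: "f = smul c g" by (metis curve_eqD)
  show "\<forall>G\<in>F. eval (Poly_Mapping.lookup f) G = 0"
  proof
    fix G assume "G \<in> F"
    then obtain e where "G \<in> homog e" using assms by blast
    then show "eval (Poly_Mapping.lookup f) G = 0"
      using g(2) \<open>G \<in> F\<close> by (simp add: c lookup_smul eval_homog_scale)
  qed
next
  assume "\<forall>G\<in>F. eval (Poly_Mapping.lookup f) G = 0"
  then show "curve f \<in> zero_locus d F"
    unfolding zero_locus_def using assms(2) by blast
qed

lemma zero_locus_eqI:
  assumes "\<And>f. f \<in> forms d \<Longrightarrow> curve f \<in> A \<longleftrightarrow> curve f \<in> zero_locus d F"
    and "A \<subseteq> curves d"
  shows "A = zero_locus d F"
proof -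
  have "zero_locus d F \<subseteq> curves d" by (auto simp: zero_locus_def curves_def)
  then show ?thesis using assms unfolding curves_def by blast
qed

lemma istopology_zariski:
  "istopology (\<lambda>U. U \<subseteq> curves d \<and> (\<exists>F \<subseteq> (\<Union>e. homog e). curves d - U = zero_locus d F))"
  (is "istopology ?open")
  unfolding istopology_def
proof (intro conjI allI impI)
  fix U V assume "?open U" "?open V"
  then obtain F F' where F: "F \<subseteq> (\<Union>e. homog e)" "curves d - U = zero_locus d F"
    and F': "F' \<subseteq> (\<Union>e. homog e)" "curves d - V = zero_locus d F'"
    and UV: "U \<subseteq> curves d" "V \<subseteq> curves d" by auto
  let ?H = "{G * G' | G G'. G \<in> F \<and> G' \<in> F'}"
  have H: "?H \<subseteq> (\<Union>e. homog e)"
  proof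
    fix K assume "K \<in> ?H"
    then obtain G G' where K: "K = G * G'" "G \<in> F" "G' \<in> F'" by blast
    then obtain a b where "G \<in> homog a" "G' \<in> homog b" using F(1) F'(1) by blast
    then show "K \<in> (\<Union>e. homog e)" using homog_mult K(1) by blast
  qed
  have "curves d - U \<inter> V = zero_locus d ?H"
  proof -
    have "curve f \<in> curves d - U \<inter> V \<longleftrightarrow> curve f \<in> zero_locus d ?H" if f: "f \<in> forms d" for f
    proof -
      have "curve f \<in> curves d - U \<inter> V \<longleftrightarrow> curve f \<in> zero_locus d F \<or> curve f \<in> zero_locus d F'"
        using f F(2) F'(2) by (auto simp: curves_def)
      also have "\<dots> \<longleftrightarrow> (\<forall>K\<in>?H. eval (Poly_Mapping.lookup f) K = 0)"
        unfolding zero_locus_iff[OF F(1) f] zero_locus_iff[OF F'(1) f]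
        by (auto simp: mpoly_eval_mult) (metis mpoly_eval_mult mult_eq_0_iff)
      finally show ?thesis using zero_locus_iff[OF H f] by simp
    qed
    then show ?thesis by (rule zero_locus_eqI[OF _ Diff_subset])
  qed
  then show "\<exists>F \<subseteq> (\<Union>e. homog e). curves d - U \<inter> V = zero_locus d F"
    using H by blast
  show "U \<inter> V \<subseteq> curves d" using UV by blast
next
  fix \<U> assume U: "\<forall>K\<in>\<U>. ?open K"
  show "\<Union>\<U> \<subseteq> curves d" using U by blast
  obtain F where F: "\<And>K. K \<in> \<U> \<Longrightarrow> F K \<subseteq> (\<Union>e. homog e) \<and> curves d - K = zero_locus d (F K)"
    using U by metis
  let ?H = "\<Union>K\<in>\<U>. F K"
  have H: "?H \<subseteq> (\<Union>e. homog e)" using F by blast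
  have "curve f \<in> curves d - \<Union>\<U> \<longleftrightarrow> curve f \<in> zero_locus d ?H" if f: "f \<in> forms d" for f
  proof -
    have "curve f \<in> curves d - \<Union>\<U> \<longleftrightarrow> (\<forall>K\<in>\<U>. curve f \<in> zero_locus d (F K))"
      using f F by (auto simp: curves_def)
    also have "\<dots> \<longleftrightarrow> (\<forall>K\<in>\<U>. \<forall>G\<in>F K. eval (Poly_Mapping.lookup f) G = 0)"
      using zero_locus_iff[OF _ f] F by (metis (no_types, lifting))
    finally show ?thesis using zero_locus_iff[OF H f] by simp
  qed
  then have "curves d - \<Union>\<U> = zero_locus d ?H"
    by (rule zero_locus_eqI[OF _ Diff_subset])
  then show "\<exists>F \<subseteq> (\<Union>e. homog e). curves d - \<Union>\<U> = zero_locus d F"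
    using H by blast
qed

lemma openin_zariski:
  "openin (zariski d) U \<longleftrightarrow>
    U \<subseteq> curves d \<and> (\<exists>F \<subseteq> (\<Union>e. homog e). curves d - U = zero_locus d F)"
  unfolding zariski_def using topology_inverse'[OF istopology_zariski] by simp

lemma topspace_zariski [simp]: "topspace (zariski d) = curves d"
proof -
  have 1: "{1 :: (3 \<Rightarrow>\<^sub>0 nat) mpoly} \<subseteq> (\<Union>e. homog e)"
    by (auto simp: homog_def mdeg_def)
  have 2: "curves d - curves d = zero_locus d {1}"
    by (auto simp: zero_locus_def subst_def)
  have "openin (zariski d) (curves d)"
    unfolding openin_zariski by (intro conjI subset_refl exI[of _ "{1}"] 1 2)
  moreover have "topspace (zariski d) \<subseteq> curves d"
    using openin_zariski[of d "topspace (zariski d)"] openin_topspace[of "zariski d"] by simp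
  ultimately show ?thesis by (simp add: openin_subset subset_antisym)
qed


definition jacobian_ideal :: "ternary \<Rightarrow> ternary set" where
  "jacobian_ideal f = ideal.span {pd 0 f, pd 1 f, pd 2 f}"

text \<open>The degree \<open>k\<close> part of \<open>S / J\<^sub>f\<close> is \<open>S\<^sub>k / (S\<^sub>k \<inter> J\<^sub>f)\<close>.\<close>

definition milnor_dim :: "nat \<Rightarrow> ternary \<Rightarrow> enat" where
  "milnor_dim k f = quot_dim smul (homog k) (homog k \<inter> jacobian_ideal f)"

definition mdr :: "ternary \<Rightarrow> nat" where
  "mdr f = (LEAST r. \<exists>a\<in>homog r. \<exists>b\<in>homog r. \<exists>c\<in>homog r.
      (a, b, c) \<noteq> (0, 0, 0) \<and> a * pd 0 f + b * pd 1 f + c * pd 2 f = 0)"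

definition sing_points :: "ternary \<Rightarrow> (complex^3) set set" where
  "sing_points f = {P \<in> plane. \<forall>p\<in>P. eval (($) p) f = 0 \<and> (\<forall>i. eval (($) p) (pd i f) = 0)}"

text \<open>
  The local equation in \<open>\<complex>[[u,v]]\<close> of the curve \<open>f = 0\<close> at a point with representative \<open>p\<close>,
  \<open>p\<^sub>i = 1\<close>, in the affine chart where the \<open>i\<close>-th homogeneous coordinate is 1: the power series
  \<open>f(p + u e\<^sub>i\<^sub>+\<^sub>1 + v e\<^sub>i\<^sub>+\<^sub>2)\<close>, with indices modulo 3. Here \<open>\<complex>[[u,v]]\<close> is \<open>\<complex>[[u]][[v]]\<close>.
\<close>

definition fps2_const :: "complex \<Rightarrow> complex fps fps" where
  "fps2_const c = fps_const (fps_const c)"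

definition local_eq :: "ternary \<Rightarrow> 3 \<Rightarrow> complex^3 \<Rightarrow> complex fps fps" where
  "local_eq f i p = subst fps2_const
      (\<lambda>j. fps2_const (p $ j) +
        (if j = i + 1 then fps_const fps_X else if j = i + 2 then fps_X else 0)) f"

definition fps_deriv_u :: "complex fps fps \<Rightarrow> complex fps fps" where
  "fps_deriv_u g = Abs_fps (\<lambda>n. fps_deriv (fps_nth g n))"

definition fps_deriv_v :: "complex fps fps \<Rightarrow> complex fps fps" where
  "fps_deriv_v g = fps_deriv g"

text \<open>
  The dimension of the local Tjurina algebra \<open>\<complex>[[u,v]] / (g, g\<^sub>u, g\<^sub>v)\<close>, which does not depend on
  the chart chosen.
\<close>

definition tjurina :: "ternary \<Rightarrow> (complex^3) set \<Rightarrow> enat" where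
  "tjurina f P =
    (let p = (SOME p. p \<in> P); i = (SOME i. p $ i \<noteq> 0); g = local_eq f i ((1 / p $ i) *s p)
     in quot_dim (\<lambda>c h. fps2_const c * h) UNIV (ideal.span {g, fps_deriv_u g, fps_deriv_v g}))"

text \<open>Meaningful when \<open>f\<close> has only finitely many singular points.\<close>

definition total_tjurina :: "ternary \<Rightarrow> enat" where
  "total_tjurina f = (\<Sum>P\<in>sing_points f. tjurina f P)"


text \<open>
  All singularities of a projective curve are isolated if and only if there are finitely many,
  the singular locus being Zariski closed.
\<close>

definition reduced_forms :: "nat \<Rightarrow> ternary set" where
  "reduced_forms d = {f \<in> forms d. finite (sing_points f)}"

definition arrangement_forms :: "nat \<Rightarrow> ternary set" where
  "arrangement_forms d = {f. \<exists>L. (\<forall>i<d. L i \<in> forms 1) \<and>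
      (\<forall>i<d. \<forall>j<d. i \<noteq> j \<longrightarrow> curve (L i) \<noteq> curve (L j)) \<and> f = (\<Prod>i<d. L i)}"

definition reduced_curves :: "nat \<Rightarrow> ternary set set" where
  "reduced_curves d = curve ` reduced_forms d"

definition arrangements :: "nat \<Rightarrow> ternary set set" where
  "arrangements d = curve ` arrangement_forms d"

end

theory Submission
  imports
    Defs
    "HOL-Computational_Algebra.Fundamental_Theorem_Algebra"
    "HOL-Computational_Algebra.Polynomial_Factorial"
    "HOL-Computational_Algebra.Field_as_Ring"
begin

text \<open>
  A bound \<open>m\<^sub>k(f) \<le> m\<close> says that at most \<open>m\<close> elements of \<open>S\<^sub>k\<close>, together with the multiples of the
  partial derivatives by monomials, span \<open>S\<^sub>k\<close>; a bound \<open>mdr(f) > m\<close> says that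
  \<open>(a, b, c) \<mapsto> a f\<^sub>x + b f\<^sub>y + c f\<^sub>z\<close> is injective on triples of forms of degree \<open>m\<close>. Both are rank
  conditions on matrices whose entries are linear in the coefficients of \<open>f\<close>, so both are open
  (\<open>open_milnor_dim_le\<close>, \<open>open_no_syzygy\<close>). Gaussian elimination without division produces the
  polynomial that defines a principal neighbourhood.

  Nonempty open sets are dense because the families of all forms, of reduced forms and of
  arrangements are irreducible: two members are joined by a family over the affine line, and a
  polynomial in the coefficients that does not vanish identically on it has finitely many zeros
  (\<open>irreducible_all_forms\<close>, \<open>irreducible_arrangement_forms\<close>). For reduced forms the smooth ones are
  used as well; they contain the nonempty open set given by \<open>m\<^sub>3\<^sub>d(f) = 0\<close>, and their total Tjurina
  number is 0.

  Openness of \<open>\<tau>(f) \<le> m\<close> is reduced to that of \<open>m\<^sub>k(f) \<le> m\<close>. Let \<open>l\<close> be a linear form that does not vanish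
  at the singular points of the reduced curve. Restricted to the line \<open>l = 0\<close> the partial derivatives
  have no common zero, hence generate all binary forms of degree at least \<open>2 (d - 1)\<close>. So
  multiplication by \<open>l\<close> from \<open>M(f)\<^sub>k\<close> to \<open>M(f)\<^sub>k\<^sub>+\<^sub>1\<close> is onto for \<open>k \<ge> 2 d\<close>, the numbers \<open>m\<^sub>k(f)\<close> do not
  increase from there on, and for large \<open>k\<close> they are constant and the multiplication is bijective.
  The limit is \<open>\<tau>(f)\<close>: for large \<open>k\<close> the map from \<open>M(f)\<^sub>k\<close> to the product of the local Tjurina
  algebras is onto by interpolation of jets (\<open>total_tjurina_le\<close>), and it is injective because a
  form that lies in all the local ideals is multiplied into the jacobian ideal by a power of \<open>l\<close>
  (\<open>locally_in_ideal\<close>, from a Nullstellensatz). By monotonicity \<open>\<tau>(f) \<le> m\<close> holds if and only if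
  \<open>m\<^sub>k(f) \<le> m\<close> for some \<open>k \<ge> 2 d\<close> (\<open>total_tjurina_le_iff\<close>), which is a union of open conditions.
\<close>

section \<open>Polynomials and their homogeneous parts\<close>

abbreviation "lookup \<equiv> Poly_Mapping.lookup"
abbreviation "keys \<equiv> Poly_Mapping.keys"
abbreviation "single \<equiv> Poly_Mapping.single"

text \<open>For multiplication as scalar multiplication this rule is associativity, from right to left,
  and it makes rewriting with \<open>mult.assoc\<close> loop.\<close>

declare ideal.scale_scale [simp del]

definition var :: "'v \<Rightarrow> 'v mpoly" where
  "var i = single (single i 1) 1"

lemma UNIV_3_from_0: "(UNIV :: 3 set) = {0, 1, 2}"
proof -
  have "(3 :: 3) = 0" by simp
  then show ?thesis using UNIV_3 by (metis insert_commute)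
qed

lemma exhaust_3_from:
  fixes i j :: 3
  shows "j = i \<or> j = i + 1 \<or> j = i + 2"
proof -
  have "j - i \<in> {0, 1, 2}" using UNIV_3_from_0 by blast
  then show ?thesis by (auto simp: algebra_simps)
qed

lemma distinct_3: "(i :: 3) + 1 \<noteq> i" "(i :: 3) + 2 \<noteq> i" "(i :: 3) + 1 \<noteq> i + 2"
  by simp_all

lemma UNIV_3_from: "(UNIV :: 3 set) = {i, i + 1, i + 2}"
  using exhaust_3_from by auto

lemma sum_UNIV_3_from:
  fixes g :: "3 \<Rightarrow> 'a::comm_monoid_add"
  shows "(\<Sum>j\<in>UNIV. g j) = g i + g (i + 1) + g (i + 2)"
  using distinct_3[of i] by (subst UNIV_3_from[of i]) (simp add: ac_simps)

text \<open>The coefficients are indexed by the family and not by the set of its values, among which there may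
  be repetitions.\<close>

lemma (in module) span_imageE:
  assumes "finite I" "x \<in> span (g ` I)"
  obtains h where "x = (\<Sum>i\<in>I. scale (h i) (g i))"
proof -
  have "\<exists>h. x = (\<Sum>i\<in>I. scale (h i) (g i))"
    using assms(2)
  proof (induction rule: span_induct_alt)
    case base
    show ?case by (rule exI[of _ "\<lambda>_. 0"]) simp
  next
    case (step c y z)
    then obtain h i where h: "z = (\<Sum>i\<in>I. scale (h i) (g i))" and i: "i \<in> I" "y = g i" by blast
    have "(\<Sum>j\<in>I. scale (h j + (if j = i then c else 0)) (g j)) =
        z + (\<Sum>j\<in>I. if j = i then scale c (g j) else 0)"
      unfolding h sum.distrib[symmetric] by (intro sum.cong) (auto simp: scale_left_distrib)
    also have "\<dots> = scale c y + z" using i assms(1) by simp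
    finally have "scale c y + z = (\<Sum>j\<in>I. scale (h j + (if j = i then c else 0)) (g j))"
      by (rule sym)
    then show ?case by (rule exI[of _ "\<lambda>j. h j + (if j = i then c else 0)"])
  qed
  then show ?thesis using that by blast
qed

interpretation mp: vector_space "smul :: complex \<Rightarrow> 'v mpoly \<Rightarrow> 'v mpoly"
proof
  fix a b :: complex and x y :: "'v mpoly"
  show "smul a (x + y) = smul a x + smul a y" by (simp add: smul_def distrib_left)
  show "smul (a + b) x = smul a x + smul b x" by (simp add: smul_def single_add distrib_right)
  show "smul a (smul b x) = smul (a * b) x"
    unfolding smul_def mult.assoc[symmetric] mult_single by simp
  show "smul 1 x = x" by (simp add: smul_def)
qed

lemma smul_mult_left: "smul c f * g = smul c (f * g)"
  by (simp add: smul_def mult.assoc)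

lemma smul_mult_right: "f * smul c g = smul c (f * g)"
  by (simp add: smul_def mult.left_commute)

lemma smul_single: "smul c (single \<alpha> b) = single \<alpha> (c * b)"
  by (simp add: smul_def mult_single)

lemma smul_in_ideal: "ideal.subspace K \<Longrightarrow> f \<in> K \<Longrightarrow> smul c f \<in> K"
  unfolding smul_def by (rule ideal.subspace_scale)

lemma ideal_mult_right: "ideal.subspace K \<Longrightarrow> f \<in> K \<Longrightarrow> f * (g :: 'a::comm_ring_1) \<in> K"
  using ideal.subspace_scale[of K f g] by (simp add: mult.commute)

lemma subspace_of_ideal: "ideal.subspace K \<Longrightarrow> mp.subspace K"
  unfolding mp.subspace_def by (auto simp: ideal.subspace_0 ideal.subspace_add smul_in_ideal)

lemma mpoly_induct [case_names single add]:
  fixes f :: "'v mpoly"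
  assumes "\<And>\<alpha> c. P (single \<alpha> c)" "\<And>f g. P f \<Longrightarrow> P g \<Longrightarrow> P (f + g)"
  shows "P f"
proof -
  have "P (\<Sum>\<alpha>\<in>A. single \<alpha> (lookup f \<alpha>))" if "finite A" for A
    using that
  proof induction
    case empty
    show ?case using assms(1)[of 0 0] by simp
  next
    case (insert a A)
    then show ?case using assms by simp
  qed
  from this[of "keys f"] show ?thesis by (simp add: sum_singles)
qed

subsection \<open>Homogeneous polynomials\<close>

lemma mdeg_0 [simp]: "mdeg 0 = 0"
  by (simp add: mdeg_def)

lemma mdeg_single [simp]: "mdeg (single i n) = n"
  by (simp add: mdeg_def)

lemma mdeg_eq_0_iff: "mdeg \<alpha> = 0 \<longleftrightarrow> \<alpha> = 0"
  by (auto simp: mdeg_def in_keys_iff intro!: poly_mapping_eqI)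

lemma homog_zero [simp]: "0 \<in> homog m"
  by (simp add: homog_def)

lemma homog_single: "mdeg \<alpha> = m \<Longrightarrow> single \<alpha> c \<in> homog m"
  by (simp add: homog_def)

lemma homog_iff: "f \<in> homog m \<longleftrightarrow> (\<forall>\<alpha>. lookup f \<alpha> \<noteq> 0 \<longrightarrow> mdeg \<alpha> = m)"
  by (auto simp: homog_def in_keys_iff)

lemma homog_add: "f \<in> homog m \<Longrightarrow> g \<in> homog m \<Longrightarrow> f + g \<in> homog m"
  unfolding homog_iff lookup_add by (metis add_0)

lemma homog_smul: "f \<in> homog m \<Longrightarrow> smul c f \<in> homog m"
  by (auto simp: homog_iff lookup_smul)

lemma subspace_homog: "mp.subspace (homog m)"
  unfolding mp.subspace_def by (simp add: homog_add homog_smul)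

lemma homog_diff: "f \<in> homog m \<Longrightarrow> g \<in> homog m \<Longrightarrow> f - g \<in> homog m"
  by (rule mp.subspace_diff[OF subspace_homog])

lemma homog_sum: "(\<And>i. i \<in> A \<Longrightarrow> h i \<in> homog m) \<Longrightarrow> sum h A \<in> homog m"
  by (rule mp.subspace_sum[OF subspace_homog])

lemma homog_mult_eq: "f \<in> homog a \<Longrightarrow> g \<in> homog b \<Longrightarrow> a + b = n \<Longrightarrow> f * g \<in> homog n"
  using homog_mult by blast

lemma homog_const: "single 0 c \<in> homog 0"
  by (rule homog_single) simp

lemma homog_one: "1 \<in> homog 0"
  using homog_const[of 1] by simp

lemma homog_var: "var i \<in> homog 1"
  unfolding var_def by (rule homog_single) simp

lemma homog_power: "f \<in> homog a \<Longrightarrow> f ^ n \<in> homog (n * a)"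
  by (induction n) (auto simp: homog_one intro: homog_mult)

lemma homog_power1: "f \<in> homog 1 \<Longrightarrow> f ^ n \<in> homog n"
  using homog_power[of f 1 n] by simp

lemma homog_prod: "(\<And>i. i \<in> A \<Longrightarrow> h i \<in> homog (e i)) \<Longrightarrow> prod h A \<in> homog (sum e A)"
  by (induction A rule: infinite_finite_induct) (auto simp: homog_one intro: homog_mult)

lemma homog_0_eq: "f \<in> homog 0 \<Longrightarrow> f = single 0 (lookup f 0)"
  by (rule poly_mapping_eqI) (auto simp: homog_iff mdeg_eq_0_iff lookup_single when_def)

lemma homog_span: "f \<in> homog m \<Longrightarrow> f \<in> mp.span ((\<lambda>\<alpha>. single \<alpha> 1) ` {\<alpha>. mdeg \<alpha> = m})"
proof -
  assume f: "f \<in> homog m"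
  have "(\<Sum>\<alpha>\<in>keys f. smul (lookup f \<alpha>) (single \<alpha> 1)) \<in>
      mp.span ((\<lambda>\<alpha>. single \<alpha> 1) ` {\<alpha>. mdeg \<alpha> = m})"
    using f by (intro mp.span_sum mp.span_scale mp.span_base) (auto simp: homog_def)
  then show ?thesis by (simp add: smul_single sum_singles)
qed

lemma finite_monomials: "finite {\<alpha> :: 3 \<Rightarrow>\<^sub>0 nat. mdeg \<alpha> = m}"
proof -
  have "lookup \<alpha> i \<le> mdeg \<alpha>" for \<alpha> :: "3 \<Rightarrow>\<^sub>0 nat" and i
    unfolding mdeg_def by (cases "i \<in> keys \<alpha>") (auto simp: in_keys_iff intro: member_le_sum)
  then have "lookup ` {\<alpha> :: 3 \<Rightarrow>\<^sub>0 nat. mdeg \<alpha> = m} \<subseteq> PiE UNIV (\<lambda>_. {..m})"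
    by auto
  then have "finite (lookup ` {\<alpha> :: 3 \<Rightarrow>\<^sub>0 nat. mdeg \<alpha> = m})"
    by (rule finite_subset) (intro finite_PiE, auto)
  then show ?thesis
    by (rule finite_imageD) (rule inj_onI, rule poly_mapping_eqI, simp)
qed

lemma monomial_factor:
  assumes "lookup \<alpha> j \<noteq> 0"
  shows "var j * single (\<alpha> - single j 1) c = single \<alpha> c"
proof -
  have "single j 1 + (\<alpha> - single j 1) = \<alpha>"
    using assms by (intro poly_mapping_eqI) (auto simp: lookup_add lookup_minus lookup_single when_def)
  then show ?thesis by (simp add: var_def mult_single)
qed

lemma mdeg_diff_single:
  assumes "lookup \<alpha> j \<noteq> 0"
  shows "mdeg (\<alpha> - single j 1) + 1 = mdeg \<alpha>"
proof -
  have "single j 1 + (\<alpha> - single j 1) = \<alpha>"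
    using assms by (intro poly_mapping_eqI) (auto simp: lookup_add lookup_minus lookup_single when_def)
  then show ?thesis using mdeg_add[of "single j 1" "\<alpha> - single j 1"] by simp
qed

lemma homog_SucE:
  fixes f :: ternary
  assumes "f \<in> homog (Suc m)"
  obtains g where "\<And>j. g j \<in> homog m" "f = (\<Sum>j\<in>UNIV. var j * g j)"
proof -
  define D where "D = {f. \<exists>g. (\<forall>j. g j \<in> homog m) \<and> f = (\<Sum>j\<in>(UNIV :: 3 set). var j * g j)}"
  have DI: "(\<Sum>j\<in>UNIV. var j * g j) \<in> D" if "\<And>j. g j \<in> homog m" for g
    unfolding D_def using that by blast
  have "mp.subspace D"
    unfolding mp.subspace_def
  proof (intro conjI ballI allI)
    show "0 \<in> D" using DI[of "\<lambda>_. 0"] by simp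
  next
    fix x y assume "x \<in> D" "y \<in> D"
    then obtain g h where gh: "\<And>j. g j \<in> homog m" "\<And>j. h j \<in> homog m"
      "x = (\<Sum>j\<in>UNIV. var j * g j)" "y = (\<Sum>j\<in>UNIV. var j * h j)" unfolding D_def by blast
    then show "x + y \<in> D"
      using DI[of "\<lambda>j. g j + h j"] by (simp add: homog_add distrib_left sum.distrib)
  next
    fix x c assume "x \<in> D"
    then obtain g where g: "\<And>j. g j \<in> homog m" "x = (\<Sum>j\<in>UNIV. var j * g j)" unfolding D_def by blast
    then show "smul c x \<in> D"
      using DI[of "\<lambda>j. smul c (g j)"] by (simp add: homog_smul smul_mult_right mp.scale_sum_right)
  qed
  moreover have "single \<alpha> 1 \<in> D" if "mdeg \<alpha> = Suc m" for \<alpha>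
  proof -
    have "\<alpha> \<noteq> 0" using that by auto
    then obtain j where j: "lookup \<alpha> j \<noteq> 0" using poly_mapping_eqI[of \<alpha> 0] by auto
    have "\<forall>i. (if i = j then single (\<alpha> - single j 1) 1 else 0) \<in> homog m"
      using mdeg_diff_single[OF j] that by (auto intro: homog_single)
    moreover have "single \<alpha> 1 =
        (\<Sum>i\<in>UNIV. var i * (if i = j then single (\<alpha> - single j 1) 1 else 0))"
      using monomial_factor[OF j, of 1] by (simp add: if_distrib cong: if_cong)
    ultimately show ?thesis unfolding D_def
      by (intro CollectI exI[of _ "\<lambda>i. if i = j then single (\<alpha> - single j 1) 1 else 0"] conjI)
  qed
  ultimately have "mp.span ((\<lambda>\<alpha>. single \<alpha> 1) ` {\<alpha>. mdeg \<alpha> = Suc m}) \<subseteq> D"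
    by (intro mp.span_minimal) auto
  then have "f \<in> D" using homog_span[OF assms] by blast
  then show ?thesis using that unfolding D_def by blast
qed

text \<open>Forms are built from constants by multiplication with variables. Induction along this avoids
  calculations with exponent vectors.\<close>

lemma homog_induct [consumes 1, case_names const step]:
  fixes f :: ternary
  assumes "f \<in> homog m"
    and const: "\<And>c. P 0 (single 0 c)"
    and step: "\<And>m g. (\<And>j. g j \<in> homog m) \<Longrightarrow> (\<And>j. P m (g j)) \<Longrightarrow>
      P (Suc m) (\<Sum>j\<in>UNIV. var j * g j)"
  shows "P m f"
  using assms(1)
proof (induction m arbitrary: f)
  case 0
  then show ?case using homog_0_eq const by metis
next
  case (Suc m)
  then obtain g where "\<And>j. g j \<in> homog m" "f = (\<Sum>j\<in>UNIV. var j * g j)" using homog_SucE by blast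
  then show ?case using step Suc.IH by blast
qed

definition homog_part :: "nat \<Rightarrow> 'v mpoly \<Rightarrow> 'v mpoly" where
  "homog_part k f = (\<Sum>\<alpha>\<in>{\<alpha> \<in> keys f. mdeg \<alpha> = k}. single \<alpha> (lookup f \<alpha>))"

lemma lookup_homog_part: "lookup (homog_part k f) \<alpha> = (if mdeg \<alpha> = k then lookup f \<alpha> else 0)"
  by (auto simp: homog_part_def lookup_sum lookup_single when_def in_keys_iff)

lemma homog_part_of_homog: "f \<in> homog n \<Longrightarrow> homog_part k f = (if k = n then f else 0)"
  by (auto simp: homog_iff lookup_homog_part intro!: poly_mapping_eqI)

lemma homog_part_add: "homog_part k (f + g) = homog_part k f + homog_part k g"
  by (auto simp: lookup_homog_part lookup_add intro!: poly_mapping_eqI)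

lemma homog_part_sum: "homog_part k (sum h A) = (\<Sum>i\<in>A. homog_part k (h i))"
  by (induction A rule: infinite_finite_induct) (simp_all add: homog_part_add, simp_all add: homog_part_def)

lemma homog_part_mult_homog:
  assumes "g \<in> homog e"
  shows "homog_part k (f * g) = (if e \<le> k then homog_part (k - e) f * g else 0)"
proof (induction f rule: mpoly_induct)
  case (single \<alpha> c)
  have "single \<alpha> c * g \<in> homog (mdeg \<alpha> + e)" by (intro homog_mult homog_single assms refl)
  then show ?case
    by (auto simp: homog_part_of_homog homog_part_of_homog[OF homog_single[OF refl]])
next
  case (add f h)
  then show ?case by (auto simp: homog_part_add distrib_right)
qed

subsection \<open>Partial derivatives\<close>

lemma pd_superset:
  assumes "finite A" "keys f \<subseteq> A"
  shows "pd i f = (\<Sum>\<alpha>\<in>A. single (\<alpha> - single i 1) (of_nat (lookup \<alpha> i) * lookup f \<alpha>))"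
  unfolding pd_def using assms by (intro sum.mono_neutral_left) (auto simp: in_keys_iff)

lemma pd_add: "pd i (f + g) = pd i f + pd i g"
proof -
  let ?A = "keys f \<union> keys g"
  have "keys (f + g) \<subseteq> ?A" by (rule Poly_Mapping.keys_add)
  then show ?thesis
    by (simp add: pd_superset[of ?A] lookup_add distrib_left single_add sum.distrib)
qed

lemma pd_smul: "pd i (smul c f) = smul c (pd i f)"
proof -
  have "keys (smul c f) \<subseteq> keys f" by (auto simp: in_keys_iff lookup_smul)
  then show ?thesis
    by (simp add: pd_superset[of "keys f"] lookup_smul mp.scale_sum_right smul_single mult.assoc mult.left_commute)
qed

lemma pd_zero [simp]: "pd i 0 = 0"
  by (simp add: pd_def)

lemma pd_sum: "pd i (sum h A) = (\<Sum>a\<in>A. pd i (h a))"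
  by (induction A rule: infinite_finite_induct) (simp_all add: pd_add)

lemma pd_single: "pd i (single \<alpha> c) = single (\<alpha> - single i 1) (of_nat (lookup \<alpha> i) * c)"
  by (simp add: pd_def)

lemma pd_const [simp]: "pd i (single 0 c) = 0"
  by (simp add: pd_single)

text \<open>The instance of the product rule that goes with induction along multiplication by variables.\<close>

lemma pd_var_mult: "pd i (var j * f) = (if i = j then f else 0) + var j * pd i f"
proof (induction f rule: mpoly_induct)
  case (single \<alpha> c)
  show ?case
  proof (cases "i = j")
    case True
    have *: "single j 1 + \<alpha> - single j 1 = \<alpha>"
      by (intro poly_mapping_eqI) (auto simp: lookup_add lookup_minus)
    have "pd i (var j * single \<alpha> c) = single \<alpha> c + single \<alpha> (of_nat (lookup \<alpha> i) * c)"
      using True * by (simp add: var_def mult_single pd_single lookup_add algebra_simps single_add)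
    also have "single \<alpha> (of_nat (lookup \<alpha> i) * c) = var j * pd i (single \<alpha> c)"
      using True monomial_factor[of \<alpha> j "of_nat (lookup \<alpha> i) * c"]
      by (cases "lookup \<alpha> i = 0") (simp_all add: pd_single)
    finally show ?thesis using True by simp
  next
    case False
    then have "single j 1 + \<alpha> - single i 1 = single j 1 + (\<alpha> - single i 1)"
      by (intro poly_mapping_eqI) (auto simp: lookup_add lookup_minus lookup_single when_def)
    then show ?thesis using False
      by (simp add: var_def mult_single pd_single lookup_add lookup_single)
  qed
next
  case (add f g)
  then show ?case by (simp add: pd_add algebra_simps)
qed

lemma pd_homog:
  fixes f :: ternary
  assumes "f \<in> homog m"
  shows "pd i f \<in> homog (m - 1)"
  using assms
proof (induction rule: homog_induct)
  case (step m g)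
  have "var j * pd i (g j) \<in> homog m" for j
  proof (cases m)
    case 0
    then obtain c where "g j = single 0 c" using step(1) homog_0_eq by metis
    then show ?thesis by simp
  next
    case (Suc n)
    then show ?thesis by (intro homog_mult_eq[OF homog_var step(2)]) simp
  qed
  then show ?case using step(1)
    by (auto simp: pd_sum pd_var_mult intro!: homog_sum homog_add)
qed simp

lemma euler_formula:
  fixes f :: ternary
  assumes "f \<in> homog m"
  shows "(\<Sum>i\<in>UNIV. var i * pd i f) = smul (of_nat m) f"
  using assms
proof (induction rule: homog_induct)
  case (step m g)
  let ?f = "\<Sum>j\<in>UNIV. var j * g j"
  have "(\<Sum>i\<in>UNIV. var i * pd i ?f) =
      (\<Sum>i\<in>UNIV. var i * (\<Sum>j\<in>UNIV. if i = j then g j else 0)) +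
      (\<Sum>i\<in>UNIV. \<Sum>j\<in>UNIV. var j * (var i * pd i (g j)))"
    by (simp add: pd_sum pd_var_mult sum.distrib distrib_left sum_distrib_left mult_ac)
  also have "(\<Sum>i\<in>UNIV. \<Sum>j\<in>UNIV. var j * (var i * pd i (g j))) =
      (\<Sum>j\<in>UNIV. var j * smul (of_nat m) (g j))"
    by (subst sum.swap) (simp add: sum_distrib_left[symmetric] step(2))
  finally show ?case
    by (simp add: smul_mult_right mp.scale_sum_right[symmetric] mp.scale_left_distrib)
qed (simp add: smul_def)

subsection \<open>Substitution\<close>

lemma prod_monomial_add:
  fixes x :: "'v \<Rightarrow> 'b::comm_ring_1"
  shows "(\<Prod>i\<in>keys (\<alpha> + \<beta>). x i ^ lookup (\<alpha> + \<beta>) i) =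
    (\<Prod>i\<in>keys \<alpha>. x i ^ lookup \<alpha> i) * (\<Prod>i\<in>keys \<beta>. x i ^ lookup \<beta> i)"
proof -
  let ?A = "keys \<alpha> \<union> keys \<beta>"
  have *: "(\<Prod>i\<in>keys \<gamma>. x i ^ lookup \<gamma> i) = (\<Prod>i\<in>?A. x i ^ lookup \<gamma> i)"
    if "keys \<gamma> \<subseteq> ?A" for \<gamma>
    using that by (intro prod.mono_neutral_left) (auto simp: in_keys_iff)
  have "keys (\<alpha> + \<beta>) \<subseteq> ?A" by (rule Poly_Mapping.keys_add)
  then show ?thesis
    unfolding *[OF \<open>keys (\<alpha> + \<beta>) \<subseteq> ?A\<close>] *[OF Un_upper1] *[OF Un_upper2]
    by (simp add: lookup_add power_add prod.distrib)
qed

text \<open>Evaluation at a point, restriction to a line and passage to a local equation are all substitutions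
  along a ring homomorphism on the coefficients.\<close>

locale coeff_hom =
  fixes \<phi> :: "complex \<Rightarrow> 'b::comm_ring_1"
  assumes hom_add: "\<phi> (a + b) = \<phi> a + \<phi> b"
    and hom_mult: "\<phi> (a * b) = \<phi> a * \<phi> b"
    and hom_one: "\<phi> 1 = 1"
begin

lemma hom_zero: "\<phi> 0 = 0"
  using hom_add[of 0 0] by simp

lemma subst_on_superset:
  assumes "finite A" "keys f \<subseteq> A"
  shows "subst \<phi> x f = (\<Sum>\<alpha>\<in>A. \<phi> (lookup f \<alpha>) * (\<Prod>i\<in>keys \<alpha>. x i ^ lookup \<alpha> i))"
  unfolding subst_def using assms
  by (intro sum.mono_neutral_left) (auto simp: in_keys_iff hom_zero)

lemma subst_add: "subst \<phi> x (f + g) = subst \<phi> x f + subst \<phi> x g"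
proof -
  let ?A = "keys f \<union> keys g"
  have "keys (f + g) \<subseteq> ?A" by (rule Poly_Mapping.keys_add)
  then show ?thesis
    by (simp add: subst_on_superset[of ?A] lookup_add hom_add distrib_right sum.distrib)
qed

lemma subst_single: "subst \<phi> x (single \<alpha> c) = \<phi> c * (\<Prod>i\<in>keys \<alpha>. x i ^ lookup \<alpha> i)"
  by (simp add: subst_def hom_zero)

lemma subst_zero [simp]: "subst \<phi> x 0 = 0"
  by (simp add: subst_def)

lemma subst_const [simp]: "subst \<phi> x (single 0 c) = \<phi> c"
  by (simp add: subst_single)

lemma subst_one [simp]: "subst \<phi> x 1 = 1"
  using subst_const[of x 1] by (simp add: hom_one)

lemma subst_var [simp]: "subst \<phi> x (var i) = x i"
  by (simp add: subst_single var_def hom_one)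

lemma subst_mult: "subst \<phi> x (f * g) = subst \<phi> x f * subst \<phi> x g"
proof (induction f rule: mpoly_induct)
  case f: (single \<alpha> c)
  show ?case
  proof (induction g rule: mpoly_induct)
    case (single \<beta> b)
    show ?case
      by (simp only: mult_single subst_single hom_mult prod_monomial_add mult_ac)
  qed (simp add: subst_add algebra_simps)
qed (simp add: subst_add algebra_simps)

lemma subst_smul: "subst \<phi> x (smul c f) = \<phi> c * subst \<phi> x f"
  by (simp add: smul_def subst_mult)

lemma subst_uminus: "subst \<phi> x (- f) = - subst \<phi> x f"
  using subst_add[of x f "- f"] by (simp add: eq_neg_iff_add_eq_0 add.commute)

lemma subst_diff: "subst \<phi> x (f - g) = subst \<phi> x f - subst \<phi> x g"
  using subst_add[of x f "- g"] by (simp add: subst_uminus)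

lemma subst_sum: "subst \<phi> x (sum h A) = (\<Sum>i\<in>A. subst \<phi> x (h i))"
  by (induction A rule: infinite_finite_induct) (simp_all add: subst_add)

lemma subst_prod: "subst \<phi> x (prod h A) = (\<Prod>i\<in>A. subst \<phi> x (h i))"
  by (induction A rule: infinite_finite_induct) (simp_all add: subst_mult)

lemma subst_power: "subst \<phi> x (f ^ n) = subst \<phi> x f ^ n"
  by (induction n) (simp_all add: subst_mult)

lemmas subst_hom = subst_add subst_mult subst_smul subst_diff subst_sum subst_prod subst_power

end

interpretation ev: coeff_hom "\<lambda>c. c"
  by unfold_locales simp_all

interpretation const_poly: coeff_hom "\<lambda>c. [:c:]"
  by unfold_locales (simp_all add: one_pCons)

lemma hom_subst:
  assumes "\<And>a b. \<psi> (a + b) = \<psi> a + \<psi> b" "\<And>a b. \<psi> (a * b) = \<psi> a * \<psi> b"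
    "\<psi> (0 :: 'b::comm_ring_1) = (0 :: 'c::comm_ring_1)" "\<psi> 1 = 1"
  shows "\<psi> (subst \<phi> x f) = subst (\<lambda>c. \<psi> (\<phi> c)) (\<lambda>i. \<psi> (x i)) f"
proof -
  have pow: "\<psi> (a ^ n) = \<psi> a ^ n" for a n by (induction n) (simp_all add: assms)
  have prod: "\<psi> (prod g A) = (\<Prod>i\<in>A. \<psi> (g i))" for g :: "'a \<Rightarrow> 'b" and A
    by (induction A rule: infinite_finite_induct) (simp_all add: assms)
  have sum: "\<psi> (sum g A) = (\<Sum>i\<in>A. \<psi> (g i))" for g :: "('a \<Rightarrow>\<^sub>0 nat) \<Rightarrow> 'b" and A
    by (induction A rule: infinite_finite_induct) (simp_all add: assms)
  show ?thesis by (simp add: subst_def sum prod pow assms)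
qed

lemma poly_subst_const_poly:
  "poly (subst (\<lambda>c. [:c:]) x f) t = eval (\<lambda>i. poly (x i) t) f"
  using hom_subst[of "\<lambda>p. poly p t" "\<lambda>c. [:c:]" x f] by simp

subsection \<open>The jacobian ideal\<close>

text \<open>Indexing the partial derivatives by the variables makes sums over them uniform.\<close>

lemma jacobian_ideal_eq_span: "jacobian_ideal f = ideal.span (range (\<lambda>j. pd j f))"
  unfolding jacobian_ideal_def UNIV_3_from_0 by simp

lemma jacobian_idealE:
  assumes "F \<in> jacobian_ideal f"
  obtains a where "F = (\<Sum>j\<in>UNIV. a j * pd j f)"
  using ideal.span_imageE[of UNIV F "\<lambda>j. pd j f"] assms
  unfolding jacobian_ideal_eq_span by auto

lemma jacobian_ideal_sum: "(\<Sum>j\<in>UNIV. a j * pd j f) \<in> jacobian_ideal f"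
  unfolding jacobian_ideal_eq_span by (intro ideal.span_sum ideal.span_scale ideal.span_base) auto

lemma ideal_jacobian: "ideal.subspace (jacobian_ideal f)"
  unfolding jacobian_ideal_def by (rule ideal.subspace_span)

lemma pd_in_jacobian: "pd j f \<in> jacobian_ideal f"
  unfolding jacobian_ideal_eq_span by (intro ideal.span_base) auto

lemma in_jacobian_ideal_euler:
  assumes "f \<in> homog d" "d \<ge> 1"
  shows "f \<in> jacobian_ideal f"
proof -
  have "smul (1 / of_nat d) (\<Sum>i\<in>UNIV. var i * pd i f) \<in> jacobian_ideal f"
    by (intro smul_in_ideal ideal_jacobian jacobian_ideal_sum)
  then show ?thesis using assms by (simp add: euler_formula)
qed

text \<open>Take homogeneous parts on both sides of a relation \<open>F = a f\<^sub>x + b f\<^sub>y + c f\<^sub>z\<close>. The condition on the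
  exponents makes the coefficients 0 for \<open>k < d - 1\<close>.\<close>

lemma jacobian_homogE:
  assumes "F \<in> homog k" "F \<in> jacobian_ideal f" "f \<in> homog d"
  obtains a where "\<And>j \<alpha>. lookup (a j) \<alpha> \<noteq> 0 \<Longrightarrow> mdeg \<alpha> + (d - 1) = k"
    "F = (\<Sum>j\<in>UNIV. a j * pd j f)"
proof -
  obtain a where a: "F = (\<Sum>j\<in>UNIV. a j * pd j f)" using assms(2) by (rule jacobian_idealE)
  define b where "b j = (if d - 1 \<le> k then homog_part (k - (d - 1)) (a j) else 0)" for j
  have "F = homog_part k F" using homog_part_of_homog[OF assms(1), of k] by simp
  also have "\<dots> = (\<Sum>j\<in>UNIV. b j * pd j f)"
    unfolding a homog_part_sum homog_part_mult_homog[OF pd_homog[OF assms(3)]] b_def by (auto intro: sum.cong)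
  finally have "F = (\<Sum>j\<in>UNIV. b j * pd j f)" .
  moreover have "mdeg \<alpha> + (d - 1) = k" if "lookup (b j) \<alpha> \<noteq> 0" for j \<alpha>
    using that by (auto simp: b_def lookup_homog_part split: if_splits)
  ultimately show ?thesis using that by blast
qed

lemma jacobian_ideal_smul: "c \<noteq> 0 \<Longrightarrow> jacobian_ideal (smul c f) = jacobian_ideal f"
proof -
  have *: "jacobian_ideal (smul c f) \<subseteq> jacobian_ideal f" for c f
    unfolding jacobian_ideal_eq_span[of "smul c f"]
    by (rule ideal.span_minimal)
      (auto simp: pd_smul ideal_jacobian intro!: smul_in_ideal pd_in_jacobian)
  assume "c \<noteq> 0"
  then have "jacobian_ideal f \<subseteq> jacobian_ideal (smul c f)"
    using *[of "1 / c" "smul c f"] by simp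
  then show ?thesis using * by blast
qed

section \<open>Dimensions of quotients\<close>

lemma linear_system_nontrivial:
  fixes a :: "'i \<Rightarrow> 'j \<Rightarrow> 'a::field"
  assumes "finite J" "finite I" "card J < card I"
  shows "\<exists>x. (\<exists>i\<in>I. x i \<noteq> 0) \<and> (\<forall>j\<in>J. (\<Sum>i\<in>I. x i * a i j) = 0)"
  using assms
proof (induction J arbitrary: I a rule: finite_induct)
  case empty
  then have "I \<noteq> {}" by auto
  then show ?case by (auto intro!: exI[of _ "\<lambda>_. 1"])
next
  case (insert j J)
  show ?case
  proof (cases "\<forall>i\<in>I. a i j = 0")
    case True
    have "card J < card I" using insert by simp
    then obtain x where "\<exists>i\<in>I. x i \<noteq> 0" "\<forall>j\<in>J. (\<Sum>i\<in>I. x i * a i j) = 0"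
      using insert.IH[of I a] insert.prems by blast
    then show ?thesis using True by (intro exI[of _ x]) simp
  next
    case False
    then obtain r where r: "r \<in> I" "a r j \<noteq> 0" by blast
    let ?I = "I - {r}"
    define b where "b i k = a i k - a i j / a r j * a r k" for i k
    have "card J < card ?I" using insert r by simp
    then obtain x where x: "\<exists>i\<in>?I. x i \<noteq> 0" "\<forall>k\<in>J. (\<Sum>i\<in>?I. x i * b i k) = 0"
      using insert.IH[of ?I b] insert.prems by blast
    define x' where "x' i = (if i = r then - (\<Sum>i\<in>?I. x i * a i j) / a r j else x i)" for i
    have *: "(\<Sum>i\<in>I. x' i * a i k) = (\<Sum>i\<in>?I. x i * b i k)" for k
    proof -
      have "(\<Sum>i\<in>I. x' i * a i k) = x' r * a r k + (\<Sum>i\<in>?I. x' i * a i k)"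
        using r insert.prems by (simp add: sum.remove)
      also have "(\<Sum>i\<in>?I. x' i * a i k) = (\<Sum>i\<in>?I. x i * a i k)"
        by (intro sum.cong) (auto simp: x'_def)
      also have "x' r * a r k = - (\<Sum>i\<in>?I. x i * (a i j / a r j * a r k))"
        by (simp add: x'_def sum_divide_distrib sum_distrib_right mult.assoc)
      finally show ?thesis by (simp add: b_def algebra_simps sum_subtractf)
    qed
    have "(\<Sum>i\<in>?I. x i * b i j) = 0" using r by (simp add: b_def)
    then have "\<forall>k\<in>insert j J. (\<Sum>i\<in>I. x' i * a i k) = 0" using x(2) * by simp
    moreover have "\<exists>i\<in>I. x' i \<noteq> 0" using x(1) by (auto simp: x'_def)
    ultimately show ?thesis by blast
  qed
qed

locale complex_vector_space = vector_space scale
  for scale :: "complex \<Rightarrow> 'a::ab_group_add \<Rightarrow> 'a" (infixr \<open>\<cdot>\<close> 75)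
begin

text \<open>Steinitz exchange modulo \<open>W\<close>: writing the vectors \<open>v i\<close> as combinations of \<open>B\<close> modulo \<open>W\<close>, the wanted
  coefficients solve a homogeneous linear system with more unknowns than equations.\<close>

lemma relation_mod:
  assumes "subspace W" "finite B" "V \<subseteq> span (B \<union> W)" "finite I" "v ` I \<subseteq> V" "card B < card I"
  obtains x where "\<exists>i\<in>I. x i \<noteq> 0" "(\<Sum>i\<in>I. x i \<cdot> v i) \<in> W"
proof -
  have "\<exists>c w. w \<in> W \<and> v i = (\<Sum>b\<in>B. c b \<cdot> b) + w" if "i \<in> I" for i
  proof -
    have "v i \<in> span (B \<union> W)" using assms that by blast
    then obtain y w where "v i = y + w" "y \<in> span B" "w \<in> span W" unfolding span_Un by blast
    moreover have "w \<in> W" using \<open>w \<in> span W\<close> assms(1) span_subspace[of W W] span_superset by blast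
    moreover obtain c where "y = (\<Sum>b\<in>B. c b \<cdot> b)"
      using \<open>y \<in> span B\<close> span_finite[OF assms(2)] by auto
    ultimately show ?thesis by blast
  qed
  then obtain c w where cw: "\<And>i. i \<in> I \<Longrightarrow> w i \<in> W \<and> v i = (\<Sum>b\<in>B. c i b \<cdot> b) + w i" by metis
  obtain x where x: "\<exists>i\<in>I. x i \<noteq> 0" "\<forall>b\<in>B. (\<Sum>i\<in>I. x i * c i b) = 0"
    using linear_system_nontrivial[OF assms(2,4,6), of c] by blast
  have "(\<Sum>i\<in>I. x i \<cdot> v i) = (\<Sum>i\<in>I. \<Sum>b\<in>B. (x i * c i b) \<cdot> b) + (\<Sum>i\<in>I. x i \<cdot> w i)"
    using cw by (simp add: scale_right_distrib sum.distrib scale_sum_right)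
  also have "(\<Sum>i\<in>I. \<Sum>b\<in>B. (x i * c i b) \<cdot> b) = (\<Sum>b\<in>B. (\<Sum>i\<in>I. x i * c i b) \<cdot> b)"
    by (subst sum.swap) (simp add: scale_sum_left)
  also have "\<dots> = 0" using x(2) by simp
  finally have "(\<Sum>i\<in>I. x i \<cdot> v i) = (\<Sum>i\<in>I. x i \<cdot> w i)" by simp
  also have "\<dots> \<in> W" using cw assms(1) by (intro subspace_sum subspace_scale) auto
  finally show ?thesis using that x(1) by blast
qed

lemma card_le_quot_dim:
  assumes "finite B" "B \<subseteq> V" "\<And>c. (\<Sum>b\<in>B. c b \<cdot> b) \<in> W \<Longrightarrow> \<forall>b\<in>B. c b = 0"
  shows "enat (card B) \<le> quot_dim scale V W"
  unfolding quot_dim_def using assms by (intro Sup_upper) blast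

lemma quot_dim_attained:
  assumes "quot_dim scale V W \<le> enat m"
  obtains B where "finite B" "B \<subseteq> V" "\<And>c. (\<Sum>b\<in>B. c b \<cdot> b) \<in> W \<Longrightarrow> \<forall>b\<in>B. c b = 0"
    "quot_dim scale V W = enat (card B)"
proof -
  define A where "A = {enat (card B) | B. finite B \<and> B \<subseteq> V \<and>
      (\<forall>c. (\<Sum>b\<in>B. c b \<cdot> b) \<in> W \<longrightarrow> (\<forall>b\<in>B. c b = 0))}"
  have Sup: "quot_dim scale V W = Sup A" by (simp add: quot_dim_def A_def)
  have "enat (card {}) \<in> A" unfolding A_def by (intro CollectI exI[of _ "{}"]) simp
  then have "A \<noteq> {}" by blast
  have "A \<subseteq> {..enat m}" using assms unfolding Sup by (meson Sup_le_iff atMost_iff subsetI)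
  then have "finite A" by (rule finite_subset) (rule finite_enat_bounded[of _ m], simp)
  then have "Sup A \<in> A" using \<open>A \<noteq> {}\<close> by (simp add: Sup_enat_def)
  then show ?thesis using that unfolding Sup A_def by blast
qed

text \<open>Bounding dimensions by spanning sets rather than independent sets makes them easy to compare
  along linear maps.\<close>

lemma quot_dim_le_iff:
  assumes "subspace W"
  shows "quot_dim scale V W \<le> enat m \<longleftrightarrow>
    (\<exists>B. finite B \<and> B \<subseteq> V \<and> card B \<le> m \<and> V \<subseteq> span (B \<union> W))"
proof
  assume le: "quot_dim scale V W \<le> enat m"
  obtain B where B: "finite B" "B \<subseteq> V" "\<And>c. (\<Sum>b\<in>B. c b \<cdot> b) \<in> W \<Longrightarrow> \<forall>b\<in>B. c b = 0"
    "quot_dim scale V W = enat (card B)"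
    using quot_dim_attained[OF le] by blast
  have "v \<in> span (B \<union> W)" if "v \<in> V" for v
  proof (cases "v \<in> B")
    case False
    have "\<not> enat (card (insert v B)) \<le> quot_dim scale V W" using B(1,4) False by simp
    then have "\<not> (\<forall>c. (\<Sum>b\<in>insert v B. c b \<cdot> b) \<in> W \<longrightarrow> (\<forall>b\<in>insert v B. c b = 0))"
      using card_le_quot_dim[of "insert v B" V W] B(1,2) that by (meson finite.insertI insert_subset)
    then obtain c where c: "(\<Sum>b\<in>insert v B. c b \<cdot> b) \<in> W" "\<not> (\<forall>b\<in>insert v B. c b = 0)"
      by blast
    have "c v \<noteq> 0"
    proof
      assume "c v = 0"
      then have "(\<Sum>b\<in>B. c b \<cdot> b) \<in> W" using c(1) B(1) False by simp
      then show False using B(3) c(2) \<open>c v = 0\<close> by blast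
    qed
    let ?w = "\<Sum>b\<in>insert v B. c b \<cdot> b"
    have "c v \<cdot> v = ?w - (\<Sum>b\<in>B. c b \<cdot> b)" using B(1) False by simp
    moreover have "?w - (\<Sum>b\<in>B. c b \<cdot> b) \<in> span (B \<union> W)"
      by (intro span_diff span_sum span_scale span_base) (use c(1) in auto)
    ultimately have "(1 / c v) \<cdot> (c v \<cdot> v) \<in> span (B \<union> W)" by (simp only: span_scale)
    then show ?thesis using \<open>c v \<noteq> 0\<close> by simp
  qed (simp add: span_base)
  then show "\<exists>B. finite B \<and> B \<subseteq> V \<and> card B \<le> m \<and> V \<subseteq> span (B \<union> W)"
    using B le by (intro exI[of _ B]) auto
next
  assume "\<exists>B. finite B \<and> B \<subseteq> V \<and> card B \<le> m \<and> V \<subseteq> span (B \<union> W)"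
  then obtain B where B: "finite B" "card B \<le> m" "V \<subseteq> span (B \<union> W)" by blast
  have bound: "card C \<le> m" if C: "finite C" "C \<subseteq> V" "\<forall>c. (\<Sum>b\<in>C. c b \<cdot> b) \<in> W \<longrightarrow> (\<forall>b\<in>C. c b = 0)" for C
  proof (rule ccontr)
    assume "\<not> card C \<le> m"
    then have "card B < card C" using B(2) by simp
    then obtain x where "\<exists>i\<in>C. x i \<noteq> 0" "(\<Sum>i\<in>C. x i \<cdot> i) \<in> W"
      using relation_mod[OF assms B(1,3) C(1), of "\<lambda>i. i"] C(2) by auto
    then show False using C(3) by blast
  qed
  show "quot_dim scale V W \<le> enat m" unfolding quot_dim_def
  proof (rule Sup_least, elim CollectE exE conjE)
    fix x C assume x: "x = enat (card C)"
      and C: "finite C" "C \<subseteq> V" "\<forall>c. (\<Sum>b\<in>C. c b \<cdot> b) \<in> W \<longrightarrow> (\<forall>b\<in>C. c b = 0)"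
    show "x \<le> enat m" unfolding x using bound[OF C] by simp
  qed
qed

lemma quot_dim_relation:
  assumes "subspace W" "quot_dim scale V W \<le> enat m" "finite I" "v ` I \<subseteq> V" "m < card I"
  obtains x where "\<exists>i\<in>I. x i \<noteq> 0" "(\<Sum>i\<in>I. x i \<cdot> v i) \<in> W"
proof -
  obtain B where B: "finite B" "card B \<le> m" "V \<subseteq> span (B \<union> W)"
    using assms(2) unfolding quot_dim_le_iff[OF assms(1)] by blast
  have "card B < card I" using B assms by simp
  from relation_mod[OF assms(1) B(1,3) assms(3,4) this] that show ?thesis by blast
qed

text \<open>Extend a basis of \<open>W\<close> by \<open>v\<close>.\<close>

lemma separating_functional:
  assumes "subspace W" "v \<notin> W"
  obtains g :: "'a \<Rightarrow> complex" where "\<And>x y. g (x + y) = g x + g y" "\<And>c x. g (c \<cdot> x) = c * g x"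
    "\<And>w. w \<in> W \<Longrightarrow> g w = 0" "g v = 1"
proof -
  interpret c: vector_space "(*) :: complex \<Rightarrow> complex \<Rightarrow> complex"
    by unfold_locales (simp_all add: algebra_simps)
  interpret vector_space_pair scale "(*) :: complex \<Rightarrow> complex \<Rightarrow> complex" ..
  obtain B where B: "B \<subseteq> W" "independent B" "W \<subseteq> span B"
    using maximal_independent_subset[of W] by blast
  have span: "span B = W" using B assms(1) by (simp add: span_minimal subset_antisym)
  then have "independent (insert v B)" using B(2) assms(2) by (simp add: independent_insert)
  then obtain g where g: "Vector_Spaces.linear scale (*) g"
      "\<forall>x\<in>insert v B. g x = (if x = v then 1 else 0)"
    using linear_independent_extend[of "insert v B" "\<lambda>x. if x = v then 1 else 0"] by blast
  interpret g: Vector_Spaces.linear scale "(*)" g by (rule g(1))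
  have "v \<notin> B" using B(1) assms(2) by blast
  have "g w = 0" if "w \<in> W" for w
  proof -
    have "w \<in> span B" using that span by simp
    then show ?thesis
      by (induction rule: span_induct_alt) (use g(2) \<open>v \<notin> B\<close> in \<open>auto simp: g.add g.scale g.zero\<close>)
  qed
  then show ?thesis using that[of g] g(2) by (simp add: g.add g.scale)
qed

end

interpretation mp: complex_vector_space "smul :: complex \<Rightarrow> 'v mpoly \<Rightarrow> 'v mpoly" ..

lemma subspace_jacobian_degree: "mp.subspace (homog k \<inter> jacobian_ideal f)"
  by (intro mp.subspace_inter subspace_homog subspace_of_ideal ideal_jacobian)

lemma milnor_dim_le_iff:
  "milnor_dim k f \<le> enat m \<longleftrightarrow> (\<exists>B. finite B \<and> B \<subseteq> homog k \<and> card B \<le> m \<and>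
    homog k \<subseteq> mp.span (B \<union> (homog k \<inter> jacobian_ideal f)))"
  unfolding milnor_dim_def by (rule mp.quot_dim_le_iff[OF subspace_jacobian_degree])

lemma milnor_dim_finite: "\<exists>m. milnor_dim k f \<le> enat m"
proof -
  let ?B = "(\<lambda>\<alpha>. single \<alpha> 1) ` {\<alpha> :: 3 \<Rightarrow>\<^sub>0 nat. mdeg \<alpha> = k}"
  have "homog k \<subseteq> mp.span (?B \<union> (homog k \<inter> jacobian_ideal f))"
    using homog_span mp.span_mono[of ?B "?B \<union> (homog k \<inter> jacobian_ideal f)"] by blast
  moreover have "finite ?B" using finite_monomials by simp
  moreover have "?B \<subseteq> homog k" by (auto intro: homog_single)
  ultimately show ?thesis unfolding milnor_dim_le_iff by blast
qed

lemma milnor_dim_smul: "c \<noteq> 0 \<Longrightarrow> milnor_dim k (smul c f) = milnor_dim k f"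
  by (simp add: milnor_dim_def jacobian_ideal_smul)

section \<open>Open and closed conditions on forms\<close>

text \<open>A condition on forms of degree \<open>d\<close> gives an open set as soon as each form that satisfies it has
  a principal neighbourhood in which it holds.\<close>

definition open_condition :: "nat \<Rightarrow> (ternary \<Rightarrow> bool) \<Rightarrow> bool" where
  "open_condition d P \<longleftrightarrow> (\<forall>f\<^sub>0\<in>forms d. P f\<^sub>0 \<longrightarrow>
    (\<exists>e. \<exists>G\<in>homog e. eval (lookup f\<^sub>0) G \<noteq> 0 \<and> (\<forall>f\<in>forms d. eval (lookup f) G \<noteq> 0 \<longrightarrow> P f)))"

lemma open_conditionE:
  assumes "open_condition d P" "f\<^sub>0 \<in> forms d" "P f\<^sub>0"
  obtains e G where "G \<in> homog e" "eval (lookup f\<^sub>0) G \<noteq> 0"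
    "\<And>f. f \<in> forms d \<Longrightarrow> eval (lookup f) G \<noteq> 0 \<Longrightarrow> P f"
  using assms unfolding open_condition_def by metis

lemma openin_open_condition:
  assumes "open_condition d P"
  shows "openin (zariski d) (curve ` {f \<in> forms d. P f})" (is "openin _ ?U")
proof -
  define F where "F = {G \<in> (\<Union>e. homog e). \<forall>f\<in>forms d. curve f \<notin> ?U \<longrightarrow> eval (lookup f) G = 0}"
  have F: "F \<subseteq> (\<Union>e. homog e)" by (auto simp: F_def)
  have "curve f \<in> curves d - ?U \<longleftrightarrow> curve f \<in> zero_locus d F" if f: "f \<in> forms d" for f
  proof
    assume "curve f \<in> curves d - ?U"
    then show "curve f \<in> zero_locus d F" unfolding zero_locus_iff[OF F f] using f by (auto simp: F_def)
  next
    assume locus: "curve f \<in> zero_locus d F"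
    have "curve f \<notin> ?U"
    proof
      assume "curve f \<in> ?U"
      then obtain f\<^sub>0 where f\<^sub>0: "f\<^sub>0 \<in> forms d" "P f\<^sub>0" "curve f = curve f\<^sub>0" by blast
      obtain e G where G: "G \<in> homog e" "eval (lookup f\<^sub>0) G \<noteq> 0"
          "\<And>f. f \<in> forms d \<Longrightarrow> eval (lookup f) G \<noteq> 0 \<Longrightarrow> P f"
        using open_conditionE[OF assms f\<^sub>0(1,2)] by blast
      have "G \<in> F" unfolding F_def using G(1,3) by blast
      then show False using locus G(2) unfolding f\<^sub>0(3) zero_locus_iff[OF F f\<^sub>0(1)] by blast
    qed
    then show "curve f \<in> curves d - ?U" using f by (auto simp: curves_def)
  qed
  then have "curves d - ?U = zero_locus d F" by (rule zero_locus_eqI) auto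
  moreover have "?U \<subseteq> curves d" by (auto simp: curves_def)
  ultimately show ?thesis unfolding openin_zariski using F by blast
qed

lemma closedin_open_condition:
  assumes "open_condition d (\<lambda>f. \<not> P f)"
  shows "closedin (zariski d) (curve ` {f \<in> forms d. P f})" (is "closedin _ ?C")
proof -
  define F where "F = {G \<in> (\<Union>e. homog e). \<forall>f\<in>forms d. P f \<longrightarrow> eval (lookup f) G = 0}"
  have F: "F \<subseteq> (\<Union>e. homog e)" by (auto simp: F_def)
  have "curve f \<in> ?C \<longleftrightarrow> curve f \<in> zero_locus d F" if f: "f \<in> forms d" for f
  proof
    assume "curve f \<in> ?C"
    then obtain f\<^sub>0 where f\<^sub>0: "f\<^sub>0 \<in> forms d" "P f\<^sub>0" "curve f = curve f\<^sub>0" by blast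
    show "curve f \<in> zero_locus d F"
      unfolding f\<^sub>0(3) zero_locus_iff[OF F f\<^sub>0(1)] using f\<^sub>0 by (auto simp: F_def)
  next
    assume locus: "curve f \<in> zero_locus d F"
    have "P f"
    proof (rule ccontr)
      assume "\<not> P f"
      then obtain e G where G: "G \<in> homog e" "eval (lookup f) G \<noteq> 0"
          "\<And>f. f \<in> forms d \<Longrightarrow> eval (lookup f) G \<noteq> 0 \<Longrightarrow> \<not> P f"
        using open_conditionE[OF assms f] by blast
      have "G \<in> F" unfolding F_def using G(1,3) by blast
      then show False using locus G(2) unfolding zero_locus_iff[OF F f] by blast
    qed
    then show "curve f \<in> ?C" using f by blast
  qed
  then have "?C = zero_locus d F" by (rule zero_locus_eqI) (auto simp: curves_def)
  moreover have "?C \<subseteq> curves d" by (auto simp: curves_def)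
  ultimately show ?thesis unfolding closedin_def openin_zariski
    using F by (auto simp: double_diff)
qed

lemma open_condition_of_openin:
  assumes "openin (zariski d) U"
  shows "open_condition d (\<lambda>f. curve f \<in> U)"
proof -
  obtain F where F: "F \<subseteq> (\<Union>e. homog e)" "curves d - U = zero_locus d F"
    using assms unfolding openin_zariski by blast
  have U: "curve f \<in> U \<longleftrightarrow> (\<exists>G\<in>F. eval (lookup f) G \<noteq> 0)" if "f \<in> forms d" for f
    using zero_locus_iff[OF F(1) that] F(2) that by (auto simp: curves_def)
  show ?thesis unfolding open_condition_def
  proof (intro ballI impI)
    fix f\<^sub>0 assume f\<^sub>0: "f\<^sub>0 \<in> forms d" "curve f\<^sub>0 \<in> U"
    then obtain G where "G \<in> F" "eval (lookup f\<^sub>0) G \<noteq> 0" using U by blast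
    moreover from \<open>G \<in> F\<close> obtain e where "G \<in> homog e" using F(1) by blast
    ultimately show "\<exists>e. \<exists>G\<in>homog e. eval (lookup f\<^sub>0) G \<noteq> 0 \<and>
        (\<forall>f\<in>forms d. eval (lookup f) G \<noteq> 0 \<longrightarrow> curve f \<in> U)" using U by blast
  qed
qed

subsection \<open>Semicontinuity of rank\<close>

definition coefficient_form :: "nat \<Rightarrow> nat \<Rightarrow> (ternary \<Rightarrow> complex) \<Rightarrow> bool" where
  "coefficient_form d e \<phi> \<longleftrightarrow> (\<exists>G\<in>homog e. \<forall>f\<in>homog d. \<phi> f = eval (lookup f) G)"

lemma coefficient_form_const: "coefficient_form d 0 (\<lambda>_. c)"
  unfolding coefficient_form_def by (intro bexI[of _ "single 0 c"] homog_const) simp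

lemma coefficient_form_mult:
  "coefficient_form d a \<phi> \<Longrightarrow> coefficient_form d b \<psi> \<Longrightarrow> coefficient_form d (a + b) (\<lambda>f. \<phi> f * \<psi> f)"
  unfolding coefficient_form_def by (metis homog_mult ev.subst_mult)

lemma coefficient_form_diff:
  "coefficient_form d e \<phi> \<Longrightarrow> coefficient_form d e \<psi> \<Longrightarrow> coefficient_form d e (\<lambda>f. \<phi> f - \<psi> f)"
  unfolding coefficient_form_def by (metis homog_diff ev.subst_diff)

lemma coefficient_form_linear:
  assumes "\<And>f g. \<phi> (f + g) = \<phi> f + \<phi> g" "\<And>c f. \<phi> (smul c f) = c * \<phi> f"
  shows "coefficient_form d 1 \<phi>"
proof -
  let ?A = "{\<alpha> :: 3 \<Rightarrow>\<^sub>0 nat. mdeg \<alpha> = d}"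
  have zero: "\<phi> 0 = 0" using assms(2)[of 0 0] by simp
  have sum: "\<phi> (sum h A) = (\<Sum>i\<in>A. \<phi> (h i))" for h :: "'b \<Rightarrow> ternary" and A
    by (induction A rule: infinite_finite_induct) (simp_all add: zero assms(1))
  define G where "G = (\<Sum>\<alpha>\<in>?A. smul (\<phi> (single \<alpha> 1)) (var \<alpha>))"
  have "\<phi> f = eval (lookup f) G" if "f \<in> homog d" for f
  proof -
    have "\<phi> f = \<phi> (\<Sum>\<alpha>\<in>keys f. smul (lookup f \<alpha>) (single \<alpha> 1))"
      by (simp add: smul_single sum_singles)
    also have "\<dots> = (\<Sum>\<alpha>\<in>keys f. lookup f \<alpha> * \<phi> (single \<alpha> 1))" by (simp add: sum assms(2))
    also have "\<dots> = (\<Sum>\<alpha>\<in>?A. lookup f \<alpha> * \<phi> (single \<alpha> 1))"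
      using that by (intro sum.mono_neutral_left finite_monomials) (auto simp: homog_def in_keys_iff)
    finally show ?thesis by (simp add: G_def ev.subst_hom mult.commute)
  qed
  moreover have "G \<in> homog 1" unfolding G_def by (intro homog_sum homog_smul homog_var)
  ultimately show ?thesis unfolding coefficient_form_def by blast
qed

definition trivial_kernel :: "'r set \<Rightarrow> 'c set \<Rightarrow> ('r \<Rightarrow> 'c \<Rightarrow> complex) \<Rightarrow> bool" where
  "trivial_kernel R A a \<longleftrightarrow>
    (\<forall>y. (\<forall>i\<in>R. (\<Sum>\<alpha>\<in>A. y \<alpha> * a i \<alpha>) = 0) \<longrightarrow> (\<forall>\<alpha>\<in>A. y \<alpha> = 0))"

text \<open>Elimination of the column \<open>\<alpha>\<close> with the pivot in row \<open>r\<close>. Without division the entries remain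
  polynomials in the coefficients of \<open>f\<close>.\<close>

lemma trivial_kernel_eliminate:
  assumes "finite A" "\<alpha> \<notin> A" "r \<in> R" "a r \<alpha> \<noteq> 0"
  shows "trivial_kernel R (insert \<alpha> A) a \<longleftrightarrow>
    trivial_kernel R A (\<lambda>i \<beta>. a r \<alpha> * a i \<beta> - a i \<alpha> * a r \<beta>)" (is "_ \<longleftrightarrow> trivial_kernel R A ?b")
proof
  have b: "(\<Sum>\<beta>\<in>A. y \<beta> * ?b i \<beta>) =
      a r \<alpha> * (\<Sum>\<beta>\<in>A. y \<beta> * a i \<beta>) - a i \<alpha> * (\<Sum>\<beta>\<in>A. y \<beta> * a r \<beta>)" for y i
    by (simp add: sum_distrib_left sum_subtractf algebra_simps)
  {
    assume triv: "trivial_kernel R (insert \<alpha> A) a"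
    show "trivial_kernel R A ?b" unfolding trivial_kernel_def
    proof (intro allI impI)
      fix y assume y: "\<forall>i\<in>R. (\<Sum>\<beta>\<in>A. y \<beta> * ?b i \<beta>) = 0"
      define z where "z \<beta> = (if \<beta> = \<alpha> then - (\<Sum>\<beta>\<in>A. y \<beta> * a r \<beta>) / a r \<alpha> else y \<beta>)" for \<beta>
      have z: "(\<Sum>\<beta>\<in>insert \<alpha> A. z \<beta> * a i \<beta>) =
          - (\<Sum>\<beta>\<in>A. y \<beta> * a r \<beta>) / a r \<alpha> * a i \<alpha> + (\<Sum>\<beta>\<in>A. y \<beta> * a i \<beta>)" for i
      proof -
        have "(\<Sum>\<beta>\<in>A. z \<beta> * a i \<beta>) = (\<Sum>\<beta>\<in>A. y \<beta> * a i \<beta>)"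
          using assms(2) by (intro sum.cong) (auto simp: z_def)
        then show ?thesis using assms(1,2) by (simp add: z_def)
      qed
      have "(\<Sum>\<beta>\<in>insert \<alpha> A. z \<beta> * a i \<beta>) = 0" if "i \<in> R" for i
      proof -
        have "a r \<alpha> * (\<Sum>\<beta>\<in>A. y \<beta> * a i \<beta>) = a i \<alpha> * (\<Sum>\<beta>\<in>A. y \<beta> * a r \<beta>)"
          using b[of y i] y that by auto
        then show ?thesis unfolding z using assms(4) by (simp add: field_simps)
      qed
      then have "\<forall>\<beta>\<in>insert \<alpha> A. z \<beta> = 0" using triv unfolding trivial_kernel_def by blast
      then show "\<forall>\<beta>\<in>A. y \<beta> = 0" using assms(2) by (auto simp: z_def split: if_splits)
    qed
  }
  assume triv: "trivial_kernel R A ?b"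
  show "trivial_kernel R (insert \<alpha> A) a" unfolding trivial_kernel_def
  proof (intro allI impI)
    fix y assume y: "\<forall>i\<in>R. (\<Sum>\<beta>\<in>insert \<alpha> A. y \<beta> * a i \<beta>) = 0"
    have A: "(\<Sum>\<beta>\<in>A. y \<beta> * a i \<beta>) = - y \<alpha> * a i \<alpha>" if "i \<in> R" for i
      using y that assms(1,2) by (simp add: add_eq_0_iff)
    have "(\<Sum>\<beta>\<in>A. y \<beta> * ?b i \<beta>) = 0" if "i \<in> R" for i
      unfolding b using A[OF that] A[OF assms(3)] by simp
    then have "\<forall>\<beta>\<in>A. y \<beta> = 0" using triv unfolding trivial_kernel_def by blast
    moreover from this have "y \<alpha> = 0" using A[OF assms(3)] assms(4) by simp
    ultimately show "\<forall>\<beta>\<in>insert \<alpha> A. y \<beta> = 0" by blast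
  qed
qed

text \<open>Columns are eliminated one after the other. A pivot that is nonzero at \<open>f\<^sub>0\<close> is a form in the
  coefficients of \<open>f\<close>, and the product of the pivots defines the neighbourhood. The degrees \<open>e i\<close> depend
  on the row because some rows will be constant and others linear in \<open>f\<close>.\<close>

lemma open_trivial_kernel:
  assumes "finite A" "\<And>i \<alpha>. coefficient_form d (e i) (\<lambda>f. a f i \<alpha>)"
  shows "open_condition d (\<lambda>f. trivial_kernel R A (a f))"
  unfolding open_condition_def
proof (intro ballI impI)
  fix f\<^sub>0 assume f\<^sub>0: "f\<^sub>0 \<in> forms d" and triv: "trivial_kernel R A (a f\<^sub>0)"
  from assms(1) f\<^sub>0 triv assms(2) show "\<exists>e. \<exists>G\<in>homog e. eval (lookup f\<^sub>0) G \<noteq> 0 \<and>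
      (\<forall>f\<in>forms d. eval (lookup f) G \<noteq> 0 \<longrightarrow> trivial_kernel R A (a f))"
  proof (induction A arbitrary: a e rule: finite_induct)
    case empty
    show ?case
      by (rule exI[of _ 0], rule bexI[of _ 1]) (auto simp: trivial_kernel_def homog_one)
  next
    case (insert \<alpha> A)
    have "\<exists>r\<in>R. a f\<^sub>0 r \<alpha> \<noteq> 0"
    proof (rule ccontr)
      assume "\<not> ?thesis"
      then have "\<forall>i\<in>R. (\<Sum>\<beta>\<in>insert \<alpha> A. (if \<beta> = \<alpha> then 1 else 0) * a f\<^sub>0 i \<beta>) = 0"
        using insert.hyps by (auto simp: sum.neutral)
      from insert.prems(2)[unfolded trivial_kernel_def, THEN spec, THEN mp, OF this]
      show False by simp
    qed
    then obtain r where r: "r \<in> R" "a f\<^sub>0 r \<alpha> \<noteq> 0" by blast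
    let ?b = "\<lambda>f i \<beta>. a f r \<alpha> * a f i \<beta> - a f i \<alpha> * a f r \<beta>"
    have "trivial_kernel R A (?b f\<^sub>0)"
      using insert.prems(2) trivial_kernel_eliminate[where a = "a f\<^sub>0", OF insert.hyps r] by blast
    moreover have "coefficient_form d (e r + e i) (\<lambda>f. ?b f i \<beta>)" for i \<beta>
      using coefficient_form_mult[OF insert.prems(3)[of r \<alpha>] insert.prems(3)[of i \<beta>]]
        coefficient_form_mult[OF insert.prems(3)[of i \<alpha>] insert.prems(3)[of r \<beta>]]
      by (intro coefficient_form_diff) (simp_all add: add.commute)
    ultimately obtain e' G where G: "G \<in> homog e'" "eval (lookup f\<^sub>0) G \<noteq> 0"
      "\<forall>f\<in>forms d. eval (lookup f) G \<noteq> 0 \<longrightarrow> trivial_kernel R A (?b f)"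
      using insert.IH[OF insert.prems(1), of ?b "\<lambda>i. e r + e i"] by blast
    obtain H where H: "H \<in> homog (e r)" "\<And>f. f \<in> homog d \<Longrightarrow> a f r \<alpha> = eval (lookup f) H"
      using insert.prems(3)[of r \<alpha>] unfolding coefficient_form_def by blast
    have "\<forall>f\<in>forms d. eval (lookup f) (H * G) \<noteq> 0 \<longrightarrow> trivial_kernel R (insert \<alpha> A) (a f)"
    proof (intro ballI impI)
      fix f assume f: "f \<in> forms d" "eval (lookup f) (H * G) \<noteq> 0"
      then have "trivial_kernel R A (?b f)" using G(3) by (simp add: ev.subst_mult)
      moreover have "a f r \<alpha> \<noteq> 0" using f H(2)[of f] by (simp add: ev.subst_mult forms_def)
      ultimately show "trivial_kernel R (insert \<alpha> A) (a f)"
        using trivial_kernel_eliminate[where a = "a f", OF insert.hyps r(1)] by blast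
    qed
    moreover have "eval (lookup f\<^sub>0) (H * G) \<noteq> 0"
      using G(2) r(2) H(2)[of f\<^sub>0] insert.prems(1) by (simp add: ev.subst_mult forms_def)
    ultimately show ?case using homog_mult[OF H(1) G(1)] by blast
  qed
qed

lemma lookup_mult_pd_linear: "coefficient_form d 1 (\<lambda>f. lookup (g * pd j f) \<beta>)"
  by (rule coefficient_form_linear)
    (simp_all add: pd_add distrib_left lookup_add pd_smul smul_mult_right lookup_smul)

subsection \<open>Minimal degree of a syzygy\<close>

definition has_syzygy :: "nat \<Rightarrow> ternary \<Rightarrow> bool" where
  "has_syzygy r f \<longleftrightarrow>
    (\<exists>a. (\<forall>j. a j \<in> homog r) \<and> (\<exists>j. a j \<noteq> 0) \<and> (\<Sum>j\<in>UNIV. a j * pd j f) = 0)"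

lemma mdr_eq: "mdr f = (LEAST r. has_syzygy r f)"
proof -
  have "(\<exists>a\<in>homog r. \<exists>b\<in>homog r. \<exists>c\<in>homog r. (a, b, c) \<noteq> (0, 0, 0) \<and>
      a * pd 0 f + b * pd 1 f + c * pd 2 f = 0) \<longleftrightarrow> has_syzygy r f" for r
  proof
    assume "\<exists>a\<in>homog r. \<exists>b\<in>homog r. \<exists>c\<in>homog r. (a, b, c) \<noteq> (0, 0, 0) \<and>
      a * pd 0 f + b * pd 1 f + c * pd 2 f = 0"
    then obtain a b c where abc: "a \<in> homog r" "b \<in> homog r" "c \<in> homog r" "(a, b, c) \<noteq> (0, 0, 0)"
      "a * pd 0 f + b * pd 1 f + c * pd 2 f = 0" by blast
    define h :: "3 \<Rightarrow> ternary" where "h j = (if j = 0 then a else if j = 1 then b else c)" for j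
    have h: "h 0 = a" "h 1 = b" "h 2 = c" by (simp_all add: h_def)
    have "\<forall>j. h j \<in> homog r" using abc by (simp add: h_def)
    moreover have "\<exists>j. h j \<noteq> 0" using abc(4) h by (metis (full_types))
    moreover have "(\<Sum>j\<in>UNIV. h j * pd j f) = 0"
      using abc(5) by (simp add: sum_UNIV_3_from[of _ 0] h)
    ultimately show "has_syzygy r f" unfolding has_syzygy_def by blast
  next
    assume "has_syzygy r f"
    then obtain a j where a: "\<And>j. a j \<in> homog r" "a j \<noteq> 0" "(\<Sum>j\<in>UNIV. a j * pd j f) = 0"
      unfolding has_syzygy_def by blast
    then have "(a 0, a 1, a 2) \<noteq> (0, 0, 0)" using exhaust_3_from[of j 0] by auto
    moreover have "a 0 * pd 0 f + a 1 * pd 1 f + a 2 * pd 2 f = 0"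
      using a(3) by (simp add: sum_UNIV_3_from[of _ 0])
    ultimately show "\<exists>a\<in>homog r. \<exists>b\<in>homog r. \<exists>c\<in>homog r. (a, b, c) \<noteq> (0, 0, 0) \<and>
      a * pd 0 f + b * pd 1 f + c * pd 2 f = 0" using a(1) by blast
  qed
  then show ?thesis by (simp add: mdr_def)
qed

lemma has_syzygy_smul:
  assumes "has_syzygy r f"
  shows "has_syzygy r (smul c f)"
proof -
  obtain a j where a: "\<forall>j. a j \<in> homog r" "a j \<noteq> 0" "(\<Sum>j\<in>UNIV. a j * pd j f) = 0"
    using assms unfolding has_syzygy_def by blast
  have "(\<Sum>j\<in>UNIV. a j * pd j (smul c f)) = smul c (\<Sum>j\<in>UNIV. a j * pd j f)"
    by (simp add: pd_smul smul_mult_right mp.scale_sum_right)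
  then show ?thesis unfolding has_syzygy_def using a by auto
qed

lemma mdr_smul: "c \<noteq> 0 \<Longrightarrow> mdr (smul c f) = mdr f"
proof -
  assume "c \<noteq> 0"
  then have "has_syzygy r (smul c f) \<longleftrightarrow> has_syzygy r f" for r
    using has_syzygy_smul[of r "smul c f" "1 / c"] has_syzygy_smul[of r f c] by auto
  then show ?thesis by (simp add: mdr_eq)
qed

lemma has_syzygy_mono:
  assumes "has_syzygy r f" "r \<le> m"
  shows "has_syzygy m f"
proof -
  obtain a i where a: "\<And>j. a j \<in> homog r" "a i \<noteq> 0" "(\<Sum>j\<in>UNIV. a j * pd j f) = 0"
    using assms(1) unfolding has_syzygy_def by blast
  let ?x = "var 0 ^ (m - r) :: ternary"
  have "var 0 \<noteq> (0 :: ternary)" by (simp add: var_def) (metis lookup_single_eq lookup_zero zero_neq_one)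
  then have "?x * a i \<noteq> 0" using a(2) by simp
  moreover have "\<forall>j. ?x * a j \<in> homog m"
    using assms(2) by (intro allI homog_mult_eq[OF homog_power1[OF homog_var] a(1)]) simp
  moreover have "(\<Sum>j\<in>UNIV. ?x * a j * pd j f) = ?x * (\<Sum>j\<in>UNIV. a j * pd j f)"
    by (simp add: sum_distrib_left mult.assoc)
  ultimately show ?thesis unfolding has_syzygy_def using a(3)
    by (intro exI[of _ "\<lambda>j. ?x * a j"]) auto
qed

lemma has_syzygy_ex:
  assumes "f \<in> homog d"
  shows "\<exists>r. has_syzygy r f"
proof (cases "pd 0 f = 0")
  case True
  have "has_syzygy 0 f" unfolding has_syzygy_def
    by (rule exI[of _ "\<lambda>j. if j = 0 then 1 else 0"])
      (auto simp: homog_one True if_distrib[of "\<lambda>x. x * _"] cong: if_cong)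
  then show ?thesis ..
next
  case False
  let ?a = "\<lambda>j :: 3. if j = 0 then pd 1 f else if j = 1 then - pd 0 f else 0"
  have "\<forall>j. ?a j \<in> homog (d - 1)"
    using pd_homog[OF assms] homog_diff[OF homog_zero, of "pd 0 f" "d - 1"] by simp
  moreover have "?a 1 \<noteq> 0" using False by simp
  moreover have "(\<Sum>j\<in>UNIV. ?a j * pd j f) = 0" by (simp add: sum_UNIV_3_from[of _ 0] mult.commute)
  ultimately have "has_syzygy (d - 1) f" unfolding has_syzygy_def by (intro exI[of _ ?a]) blast
  then show ?thesis ..
qed

text \<open>A syzygy can be multiplied by a variable, so a bound on \<open>mdr\<close> is a condition in a single degree.\<close>

lemma mdr_le_iff: "f \<in> homog d \<Longrightarrow> mdr f \<le> m \<longleftrightarrow> has_syzygy m f"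
  unfolding mdr_eq using has_syzygy_ex[of f d] has_syzygy_mono LeastI_ex[of "\<lambda>r. has_syzygy r f"]
  by (metis Least_le)

text \<open>The columns are indexed by the coefficients of the triple, the rows by the monomials of the result.\<close>

lemma open_no_syzygy: "open_condition d (\<lambda>f. \<not> mdr f \<le> m)"
proof -
  let ?A = "(UNIV :: 3 set) \<times> {\<alpha> :: 3 \<Rightarrow>\<^sub>0 nat. mdeg \<alpha> = m}"
  let ?c = "\<lambda>f \<beta> (j, \<alpha>). lookup (single \<alpha> 1 * pd j f) \<beta>"
  have fin: "finite ?A" by (simp add: finite_monomials)
  have "coefficient_form d 1 (\<lambda>f. ?c f \<beta> p)" for \<beta> p
    by (cases p) (simp add: lookup_mult_pd_linear[simplified])
  from open_trivial_kernel[OF fin this]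
  have "open_condition d (\<lambda>f. trivial_kernel UNIV ?A (?c f))" .
  moreover have "trivial_kernel UNIV ?A (?c f) \<longleftrightarrow> \<not> mdr f \<le> m" if "f \<in> forms d" for f
  proof -
    have f: "f \<in> homog d" using that by (simp add: forms_def)
    let ?a = "\<lambda>y j. \<Sum>\<alpha> :: 3 \<Rightarrow>\<^sub>0 nat | mdeg \<alpha> = m. smul (y (j :: 3, \<alpha>)) (single \<alpha> 1)"
    have syz: "(\<Sum>p\<in>?A. y p * ?c f \<beta> p) = lookup (\<Sum>j\<in>UNIV. ?a y j * pd j f) \<beta>" for y \<beta>
      by (simp add: sum.cartesian_product' sum_distrib_right lookup_sum smul_mult_left lookup_smul)
    have a: "lookup (?a y j) \<alpha> = (if mdeg \<alpha> = m then y (j, \<alpha>) else 0)" for y j \<alpha>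
      by (simp add: lookup_sum smul_single lookup_single when_def finite_monomials)
    show ?thesis
    proof
      assume triv: "trivial_kernel UNIV ?A (?c f)"
      show "\<not> mdr f \<le> m"
      proof
        assume "mdr f \<le> m"
        then obtain b i where b: "\<forall>j. b j \<in> homog m" "b i \<noteq> 0" "(\<Sum>j\<in>UNIV. b j * pd j f) = 0"
          using f unfolding mdr_le_iff[OF f] has_syzygy_def by blast
        have "?a (\<lambda>(j, \<alpha>). lookup (b j) \<alpha>) j = b j" for j
          by (rule poly_mapping_eqI, subst a) (use b(1) in \<open>auto simp: homog_iff\<close>)
        then have "\<forall>\<beta>. (\<Sum>p\<in>?A. (case p of (j, \<alpha>) \<Rightarrow> lookup (b j) \<alpha>) * ?c f \<beta> p) = 0"
          unfolding syz using b(3) by simp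
        then have "\<forall>p\<in>?A. (case p of (j, \<alpha>) \<Rightarrow> lookup (b j) \<alpha>) = 0"
          using triv unfolding trivial_kernel_def by blast
        then have "lookup (b i) \<alpha> = 0" for \<alpha> using b(1) by (auto simp: homog_iff)
        then show False using b(2) poly_mapping_eqI[of "b i" 0] by simp
      qed
    next
      assume not_le: "\<not> mdr f \<le> m"
      show "trivial_kernel UNIV ?A (?c f)" unfolding trivial_kernel_def
      proof (rule allI, rule impI, rule ccontr)
        fix y assume y: "\<forall>\<beta>\<in>UNIV. (\<Sum>p\<in>?A. y p * ?c f \<beta> p) = 0" and "\<not> (\<forall>p\<in>?A. y p = 0)"
        then obtain j \<alpha> where "mdeg \<alpha> = m" "y (j, \<alpha>) \<noteq> 0" by auto
        then have "lookup (?a y j) \<alpha> \<noteq> 0" by (simp add: a)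
        then have "?a y j \<noteq> 0" by (metis lookup_zero)
        moreover have "\<forall>j. ?a y j \<in> homog m" by (auto intro!: homog_sum homog_smul homog_single)
        moreover have "(\<Sum>j\<in>UNIV. ?a y j * pd j f) = 0"
          using y unfolding syz by (intro poly_mapping_eqI) simp
        ultimately have "has_syzygy m f" unfolding has_syzygy_def
          by (intro exI[of _ "?a y"] conjI) auto
        then show False using not_le mdr_le_iff[OF f] by simp
      qed
    qed
  qed
  ultimately show ?thesis unfolding open_condition_def by simp
qed

subsection \<open>Dimensions of the graded pieces of the Milnor algebra\<close>

text \<open>The conditions on a functional on \<open>S\<^sub>k\<close>, given by its values on monomials, to vanish on chosen
  vectors (\<open>Inl\<close>) and on multiples of the partial derivatives by monomials (\<open>Inr\<close>).\<close>

definition pairing_rows ::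
    "ternary \<Rightarrow> ternary + ((3 \<Rightarrow>\<^sub>0 nat) \<times> 3) \<Rightarrow> (3 \<Rightarrow>\<^sub>0 nat) \<Rightarrow> complex" where
  "pairing_rows f i = (case i of Inl b \<Rightarrow> lookup b | Inr (\<mu>, j) \<Rightarrow> lookup (single \<mu> 1 * pd j f))"

text \<open>Duality turns spanning into injectivity: a proper subspace is annihilated by a nonzero functional.\<close>

lemma spans_iff_trivial_kernel:
  assumes f: "f \<in> homog d" and B: "B \<subseteq> homog k"
  shows "homog k \<subseteq> mp.span (B \<union> (homog k \<inter> jacobian_ideal f)) \<longleftrightarrow>
    trivial_kernel (Inl ` B \<union> Inr ` ({\<mu>. mdeg \<mu> + (d - 1) = k} \<times> UNIV)) {\<alpha>. mdeg \<alpha> = k}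
      (pairing_rows f)" (is "?L \<subseteq> mp.span (B \<union> ?J) \<longleftrightarrow> trivial_kernel ?R ?A _")
proof
  have gen: "single \<mu> 1 * pd j f \<in> ?J" if "mdeg \<mu> + (d - 1) = k" for \<mu> j
    using that homog_mult_eq[OF homog_single[OF refl] pd_homog[OF f]]
    by (auto intro: ideal.subspace_scale[OF ideal_jacobian pd_in_jacobian])
  {
    assume span: "homog k \<subseteq> mp.span (B \<union> ?J)"
    show "trivial_kernel ?R ?A (pairing_rows f)" unfolding trivial_kernel_def
    proof (intro allI impI)
      fix y assume y: "\<forall>i\<in>?R. (\<Sum>\<alpha>\<in>?A. y \<alpha> * pairing_rows f i \<alpha>) = 0"
      define g where "g F = (\<Sum>\<alpha>\<in>?A. y \<alpha> * lookup F \<alpha>)" for F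
      have g_add: "g (F + G) = g F + g G" for F G
        by (simp add: g_def lookup_add algebra_simps sum.distrib)
      have g_smul: "g (smul c F) = c * g F" for c F
        by (simp add: g_def lookup_smul sum_distrib_left mult.left_commute)
      have g_zero: "g 0 = 0" by (simp add: g_def)
      have g_sum: "g (sum h I) = (\<Sum>i\<in>I. g (h i))" for h :: "'b \<Rightarrow> ternary" and I
        by (induction I rule: infinite_finite_induct) (simp_all add: g_add g_zero)
      have gB: "g b = 0" if "b \<in> B" for b
        using y that by (force simp: g_def pairing_rows_def)
      have gM: "g (single \<mu> 1 * pd j f) = 0" if "mdeg \<mu> + (d - 1) = k" for \<mu> j
        using y that by (force simp: g_def pairing_rows_def)
      have gJ: "g F = 0" if "F \<in> ?J" for F
      proof -
        have "F \<in> homog k" "F \<in> jacobian_ideal f" using that by auto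
        then obtain a where a: "\<And>j \<alpha>. lookup (a j) \<alpha> \<noteq> 0 \<Longrightarrow> mdeg \<alpha> + (d - 1) = k"
            "F = (\<Sum>j\<in>UNIV. a j * pd j f)" by (rule jacobian_homogE[OF _ _ f]) blast
        have "a j * pd j f = (\<Sum>\<mu>\<in>keys (a j). smul (lookup (a j) \<mu>) (single \<mu> 1 * pd j f))" for j
        proof -
          have "a j = (\<Sum>\<mu>\<in>keys (a j). smul (lookup (a j) \<mu>) (single \<mu> 1))"
            by (simp add: smul_single sum_singles)
          then have "a j * pd j f = (\<Sum>\<mu>\<in>keys (a j). smul (lookup (a j) \<mu>) (single \<mu> 1)) * pd j f"
            by simp
          then show ?thesis by (simp add: sum_distrib_right smul_mult_left)
        qed
        then have "g F = (\<Sum>j\<in>UNIV. \<Sum>\<mu>\<in>keys (a j). lookup (a j) \<mu> * g (single \<mu> 1 * pd j f))"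
          by (simp add: a(2) g_sum g_smul)
        also have "\<dots> = 0" using a(1) by (intro sum.neutral ballI) (auto simp: in_keys_iff gM)
        finally show ?thesis .
      qed
      have g0: "g F = 0" if "F \<in> mp.span (B \<union> ?J)" for F
        using that
        by (induction rule: mp.span_induct_alt) (use gB gJ in \<open>auto simp: g_zero g_add g_smul\<close>)
      show "\<forall>\<alpha>\<in>?A. y \<alpha> = 0"
      proof
        fix \<alpha> :: "3 \<Rightarrow>\<^sub>0 nat" assume "\<alpha> \<in> ?A"
        then have "g (single \<alpha> 1) = y \<alpha>"
          by (simp add: g_def lookup_single when_def finite_monomials if_distrib cong: if_cong)
        moreover have "single \<alpha> 1 \<in> homog k" using \<open>\<alpha> \<in> ?A\<close> by (auto intro: homog_single)
        ultimately show "y \<alpha> = 0" using g0 span by auto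
      qed
    qed
  }
  assume triv: "trivial_kernel ?R ?A (pairing_rows f)"
  show "homog k \<subseteq> mp.span (B \<union> ?J)"
  proof (rule ccontr)
    assume "\<not> ?thesis"
    then obtain F where F: "F \<in> homog k" "F \<notin> mp.span (B \<union> ?J)" by blast
    obtain g :: "ternary \<Rightarrow> complex" where g: "\<And>x y. g (x + y) = g x + g y"
        "\<And>c x. g (smul c x) = c * g x" "\<And>w. w \<in> mp.span (B \<union> ?J) \<Longrightarrow> g w = 0" "g F = 1"
      using mp.separating_functional[OF mp.subspace_span F(2)] by blast
    have g_zero: "g 0 = 0" using g(2)[of 0 0] by simp
    have g_sum: "g (sum h I) = (\<Sum>i\<in>I. g (h i))" for h :: "'b \<Rightarrow> ternary" and I
      by (induction I rule: infinite_finite_induct) (simp_all add: g(1) g_zero)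
    have gF: "g H = (\<Sum>\<alpha>\<in>?A. g (single \<alpha> 1) * lookup H \<alpha>)" if "H \<in> homog k" for H
    proof -
      have "g H = g (\<Sum>\<alpha>\<in>keys H. smul (lookup H \<alpha>) (single \<alpha> 1))"
        by (simp add: smul_single sum_singles)
      also have "\<dots> = (\<Sum>\<alpha>\<in>keys H. g (single \<alpha> 1) * lookup H \<alpha>)" by (simp add: g_sum g(2) mult.commute)
      also have "\<dots> = (\<Sum>\<alpha>\<in>?A. g (single \<alpha> 1) * lookup H \<alpha>)"
        using that by (intro sum.mono_neutral_left finite_monomials) (auto simp: homog_def in_keys_iff)
      finally show ?thesis .
    qed
    have "(\<Sum>\<alpha>\<in>?A. g (single \<alpha> 1) * pairing_rows f i \<alpha>) = 0" if i: "i \<in> ?R" for i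
    proof (cases i)
      case (Inl b)
      then have "b \<in> B" using i by auto
      then show ?thesis using Inl gF[of b] g(3)[of b] B by (auto simp: pairing_rows_def mp.span_base)
    next
      case (Inr p)
      then obtain \<mu> j where p: "p = (\<mu>, j)" "mdeg \<mu> + (d - 1) = k" using i by auto
      then show ?thesis using Inr gF[of "single \<mu> 1 * pd j f"] g(3)[of "single \<mu> 1 * pd j f"] gen[OF p(2)]
        by (simp add: pairing_rows_def mp.span_base)
    qed
    then have "\<forall>\<alpha>\<in>?A. g (single \<alpha> 1) = 0"
      using triv[unfolded trivial_kernel_def, THEN spec, of "\<lambda>\<alpha>. g (single \<alpha> 1)"] by blast
    then show False using gF[OF F(1)] g(4) by simp
  qed
qed

text \<open>A set \<open>B\<close> that spans \<open>S\<^sub>k\<close> modulo the jacobian ideal of \<open>f\<^sub>0\<close> does so for all \<open>f\<close> near \<open>f\<^sub>0\<close>.\<close>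

lemma open_milnor_dim_le: "open_condition d (\<lambda>f. milnor_dim k f \<le> enat m)"
  unfolding open_condition_def
proof (intro ballI impI)
  fix f\<^sub>0 assume f\<^sub>0: "f\<^sub>0 \<in> forms d" "milnor_dim k f\<^sub>0 \<le> enat m"
  then obtain B where B: "finite B" "B \<subseteq> homog k" "card B \<le> m"
    "homog k \<subseteq> mp.span (B \<union> (homog k \<inter> jacobian_ideal f\<^sub>0))" unfolding milnor_dim_le_iff by blast
  let ?R = "Inl ` B \<union> Inr ` ({\<mu> :: 3 \<Rightarrow>\<^sub>0 nat. mdeg \<mu> + (d - 1) = k} \<times> (UNIV :: 3 set))"
  let ?A = "{\<alpha> :: 3 \<Rightarrow>\<^sub>0 nat. mdeg \<alpha> = k}"
  have "coefficient_form d (case i of Inl b \<Rightarrow> 0 | Inr p \<Rightarrow> 1) (\<lambda>f. pairing_rows f i \<alpha>)" for i \<alpha>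
    by (cases i) (auto simp: pairing_rows_def coefficient_form_const lookup_mult_pd_linear[simplified]
        split: prod.splits)
  from open_trivial_kernel[OF finite_monomials this]
  have op: "open_condition d (\<lambda>f. trivial_kernel ?R ?A (pairing_rows f))" .
  have "trivial_kernel ?R ?A (pairing_rows f\<^sub>0)"
    using spans_iff_trivial_kernel[OF _ B(2), of f\<^sub>0 d] B(4) f\<^sub>0(1) unfolding forms_def by blast
  then obtain e G where G: "G \<in> homog e" "eval (lookup f\<^sub>0) G \<noteq> 0"
      "\<And>f. f \<in> forms d \<Longrightarrow> eval (lookup f) G \<noteq> 0 \<Longrightarrow> trivial_kernel ?R ?A (pairing_rows f)"
    using open_conditionE[OF op f\<^sub>0(1)] by blast
  have "milnor_dim k f \<le> enat m" if "f \<in> forms d" "eval (lookup f) G \<noteq> 0" for f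
    unfolding milnor_dim_le_iff
    using B(1-3) G(3)[OF that] spans_iff_trivial_kernel[OF _ B(2), of f d] that(1)
    unfolding forms_def by blast
  then show "\<exists>e. \<exists>G\<in>homog e. eval (lookup f\<^sub>0) G \<noteq> 0 \<and>
      (\<forall>f\<in>forms d. eval (lookup f) G \<noteq> 0 \<longrightarrow> milnor_dim k f \<le> enat m)" using G by blast
qed

section \<open>Irreducibility and density\<close>

lemma common_nonroot:
  fixes A :: "'a::{idom, ring_char_0} poly set"
  assumes "finite A" "0 \<notin> A"
  shows "\<exists>t. \<forall>p\<in>A. poly p t \<noteq> 0"
proof -
  have "(\<Prod>p\<in>A. p) \<noteq> 0" using assms by (simp add: prod_zero_iff)
  then have "finite {t. poly (\<Prod>p\<in>A. p) t = 0}" by (rule poly_roots_finite)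
  then obtain t where "poly (\<Prod>p\<in>A. p) t \<noteq> 0"
    using ex_new_if_finite[OF infinite_UNIV_char_0] by blast
  then show ?thesis using assms(1) by (auto simp: poly_prod prod_zero_iff)
qed

text \<open>The moment curve meets a plane through the origin in finitely many points.\<close>

lemma avoid_vectors:
  fixes V :: "(3 \<Rightarrow> complex) set"
  assumes "finite V" "\<And>v. v \<in> V \<Longrightarrow> \<exists>j. v j \<noteq> 0"
  shows "\<exists>t. \<forall>v\<in>V. v 0 + t * v 1 + t\<^sup>2 * v 2 \<noteq> 0"
proof -
  have "[:v 0, v 1, v 2:] \<noteq> 0" if v: "v \<in> V" for v
  proof -
    obtain j where "v j \<noteq> 0" using assms(2)[OF v] by blast
    then show ?thesis using exhaust_3_from[of j 0] by auto
  qed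
  then have "0 \<notin> (\<lambda>v. [:v 0, v 1, v 2:]) ` V" by fastforce
  then obtain t where "\<forall>p\<in>(\<lambda>v. [:v 0, v 1, v 2:]) ` V. poly p t \<noteq> 0"
    using common_nonroot assms(1) by blast
  then show ?thesis by (auto simp: algebra_simps power2_eq_square)
qed

text \<open>Any two nonempty open subsets of the family meet; by homogeneity it is enough to look at
  complements of hypersurfaces.\<close>

definition irreducible_forms :: "nat \<Rightarrow> ternary set \<Rightarrow> bool" where
  "irreducible_forms d X \<longleftrightarrow> X \<subseteq> forms d \<and>
    (\<forall>f\<^sub>0\<in>X. \<forall>f\<^sub>1\<in>X. \<forall>e\<^sub>0 e\<^sub>1. \<forall>G\<^sub>0\<in>homog e\<^sub>0. \<forall>G\<^sub>1\<in>homog e\<^sub>1.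
      eval (lookup f\<^sub>0) G\<^sub>0 \<noteq> 0 \<longrightarrow> eval (lookup f\<^sub>1) G\<^sub>1 \<noteq> 0 \<longrightarrow>
      (\<exists>f\<in>X. eval (lookup f) G\<^sub>0 \<noteq> 0 \<and> eval (lookup f) G\<^sub>1 \<noteq> 0))"

lemma irreducible_formsE:
  assumes "irreducible_forms d X" "f\<^sub>0 \<in> X" "f\<^sub>1 \<in> X" "G\<^sub>0 \<in> homog e\<^sub>0" "G\<^sub>1 \<in> homog e\<^sub>1"
    "eval (lookup f\<^sub>0) G\<^sub>0 \<noteq> 0" "eval (lookup f\<^sub>1) G\<^sub>1 \<noteq> 0"
  obtains f where "f \<in> X" "eval (lookup f) G\<^sub>0 \<noteq> 0" "eval (lookup f) G\<^sub>1 \<noteq> 0"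
  using assms unfolding irreducible_forms_def by metis

lemma dense_of_irreducible:
  assumes X: "irreducible_forms d X" and P: "open_condition d P" and g: "g \<in> X" "P g"
  shows "subtopology (zariski d) (curve ` X) closure_of (curve ` {f \<in> X. P f}) = curve ` X"
proof -
  have "X \<subseteq> forms d" using X unfolding irreducible_forms_def by blast
  then have top: "topspace (subtopology (zariski d) (curve ` X)) = curve ` X"
    by (auto simp: curves_def)
  have "curve ` {f \<in> X. P f} \<inter> T \<noteq> {}"
    if "openin (subtopology (zariski d) (curve ` X)) T" "T \<noteq> {}" for T
  proof -
    obtain U where U: "openin (zariski d) U" "T = U \<inter> curve ` X"
      using \<open>openin _ T\<close> unfolding openin_subtopology by blast
    then obtain f\<^sub>0 where f\<^sub>0: "f\<^sub>0 \<in> X" "curve f\<^sub>0 \<in> U" using \<open>T \<noteq> {}\<close> by blast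
    obtain e\<^sub>0 G\<^sub>0 where G\<^sub>0: "G\<^sub>0 \<in> homog e\<^sub>0" "eval (lookup f\<^sub>0) G\<^sub>0 \<noteq> 0"
        "\<And>f. f \<in> forms d \<Longrightarrow> eval (lookup f) G\<^sub>0 \<noteq> 0 \<Longrightarrow> curve f \<in> U"
      by (rule open_conditionE[OF open_condition_of_openin[OF U(1)], of f\<^sub>0])
        (use f\<^sub>0 \<open>X \<subseteq> forms d\<close> in blast)+
    obtain e\<^sub>1 G\<^sub>1 where G\<^sub>1: "G\<^sub>1 \<in> homog e\<^sub>1" "eval (lookup g) G\<^sub>1 \<noteq> 0"
        "\<And>f. f \<in> forms d \<Longrightarrow> eval (lookup f) G\<^sub>1 \<noteq> 0 \<Longrightarrow> P f"
      by (rule open_conditionE[OF P, of g]) (use g \<open>X \<subseteq> forms d\<close> in blast)+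
    obtain f where f: "f \<in> X" "eval (lookup f) G\<^sub>0 \<noteq> 0" "eval (lookup f) G\<^sub>1 \<noteq> 0"
      using irreducible_formsE[OF X f\<^sub>0(1) g(1) G\<^sub>0(1) G\<^sub>1(1) G\<^sub>0(2) G\<^sub>1(2)] by blast
    then have "curve f \<in> U" "P f" using G\<^sub>0(3) G\<^sub>1(3) \<open>X \<subseteq> forms d\<close> by auto
    then show ?thesis using f(1) U(2) by blast
  qed
  then have "subtopology (zariski d) (curve ` X) closure_of (curve ` {f \<in> X. P f}) =
      topspace (subtopology (zariski d) (curve ` X))"
    unfolding dense_intersects_open by blast
  then show ?thesis unfolding top .
qed

text \<open>Two forms are joined by a line, on which a nonzero polynomial has finitely many zeros. The third
  polynomial \<open>q \<alpha>\<close> keeps the chosen form different from 0.\<close>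

lemma irreducible_all_forms: "irreducible_forms d (forms d)"
  unfolding irreducible_forms_def
proof (intro conjI ballI allI impI subset_refl)
  fix f\<^sub>0 f\<^sub>1 e\<^sub>0 e\<^sub>1 and G\<^sub>0 G\<^sub>1 :: "(3 \<Rightarrow>\<^sub>0 nat) mpoly"
  assume f: "f\<^sub>0 \<in> forms d" "f\<^sub>1 \<in> forms d"
    and G: "eval (lookup f\<^sub>0) G\<^sub>0 \<noteq> 0" "eval (lookup f\<^sub>1) G\<^sub>1 \<noteq> 0"
  define q where "q \<alpha> = [:lookup f\<^sub>0 \<alpha>, lookup f\<^sub>1 \<alpha> - lookup f\<^sub>0 \<alpha>:]" for \<alpha>
  define F where "F t = f\<^sub>0 + smul t (f\<^sub>1 - f\<^sub>0)" for t
  have F: "lookup (F t) = (\<lambda>\<alpha>. poly (q \<alpha>) t)" for t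
    by (auto simp: F_def q_def lookup_add lookup_smul lookup_minus)
  have evalF: "eval (lookup (F t)) G = poly (subst (\<lambda>c. [:c:]) q G) t" for t G
    by (simp add: F poly_subst_const_poly)
  obtain \<alpha> where \<alpha>: "lookup f\<^sub>0 \<alpha> \<noteq> 0" using f(1) poly_mapping_eqI[of f\<^sub>0 0] by (auto simp: forms_def)
  have "F 0 = f\<^sub>0" "F 1 = f\<^sub>1" by (simp_all add: F_def)
  then have "poly (subst (\<lambda>c. [:c:]) q G\<^sub>0) 0 \<noteq> 0" "poly (subst (\<lambda>c. [:c:]) q G\<^sub>1) 1 \<noteq> 0" "poly (q \<alpha>) 0 \<noteq> 0"
    using G evalF[of 0] evalF[of 1] \<alpha> F[of 0] by auto
  then have "0 \<notin> {subst (\<lambda>c. [:c:]) q G\<^sub>0, subst (\<lambda>c. [:c:]) q G\<^sub>1, q \<alpha>}" by auto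
  then obtain t where t: "poly (subst (\<lambda>c. [:c:]) q G\<^sub>0) t \<noteq> 0" "poly (subst (\<lambda>c. [:c:]) q G\<^sub>1) t \<noteq> 0"
      "poly (q \<alpha>) t \<noteq> 0"
    using common_nonroot[of "{subst (\<lambda>c. [:c:]) q G\<^sub>0, subst (\<lambda>c. [:c:]) q G\<^sub>1, q \<alpha>}"] by auto
  have "F t \<in> homog d" using f unfolding F_def forms_def
    by (auto intro: homog_add homog_smul homog_diff)
  moreover have "F t \<noteq> 0" using t(3) F[of t] by (metis lookup_zero)
  ultimately have "F t \<in> forms d" by (simp add: forms_def)
  then show "\<exists>f\<in>forms d. eval (lookup f) G\<^sub>0 \<noteq> 0 \<and> eval (lookup f) G\<^sub>1 \<noteq> 0"
    using t(1,2) by (intro bexI[of _ "F t"]) (simp_all add: evalF)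
qed

subsection \<open>Singular points\<close>

lemma pclass_scale:
  assumes "\<And>a b v. s a (s b v) = s (a * b) v" "c \<noteq> 0"
  shows "pclass s (s c v) = pclass s v"
proof (intro equalityI subsetI)
  fix x assume "x \<in> pclass s (s c v)"
  then obtain a where "a \<noteq> 0" "x = s a (s c v)" by (auto simp: pclass_def)
  then have "a * c \<noteq> 0" "x = s (a * c) v" using assms by simp_all
  then show "x \<in> pclass s v" unfolding pclass_def by blast
next
  fix x assume "x \<in> pclass s v"
  then obtain a where "a \<noteq> 0" "x = s a v" by (auto simp: pclass_def)
  then have "a / c \<noteq> 0" "x = s (a / c) (s c v)" using assms by simp_all
  then show "x \<in> pclass s (s c v)" unfolding pclass_def by blast
qed

lemma pclass_vector_scale: "c \<noteq> 0 \<Longrightarrow> pclass (*s) (c *s p) = pclass (*s) (p :: complex^3)"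
  by (rule pclass_scale) (simp_all add: vector_smult_assoc)

lemma planeE:
  assumes "P \<in> plane"
  obtains p where "p \<noteq> 0" "P = pclass (*s) p" "p \<in> P"
proof -
  obtain p where p: "p \<noteq> 0" "P = pclass (*s) p" using assms by (auto simp: plane_def)
  then have "p \<in> P" unfolding pclass_def by (auto intro!: exI[of _ 1])
  then show ?thesis using that p by blast
qed

lemma pclass_memE:
  assumes "q \<in> pclass (*s) p"
  obtains c where "c \<noteq> 0" "q = c *s p"
  using assms unfolding pclass_def by blast

lemma eval_scale_point:
  "F \<in> homog e \<Longrightarrow> eval (($) (c *s p)) F = c ^ e * eval (($) p) F"
proof -
  have "($) (c *s p) = (\<lambda>i. c * p $ i)" by (simp add: fun_eq_iff)
  then show "F \<in> homog e \<Longrightarrow> eval (($) (c *s p)) F = c ^ e * eval (($) p) F"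
    by (simp only: eval_homog_scale)
qed

lemma eval_jacobian_zero:
  assumes "\<And>j. eval x (pd j f) = 0" "F \<in> jacobian_ideal f"
  shows "eval x F = 0"
proof -
  obtain a where "F = (\<Sum>j\<in>UNIV. a j * pd j f)" using assms(2) by (rule jacobian_idealE)
  then show ?thesis using assms(1) by (simp add: ev.subst_hom)
qed

lemma sing_pointsI:
  assumes "f \<in> homog d" "d \<ge> 1" "p \<noteq> 0" "\<And>i. eval (($) p) (pd i f) = 0"
  shows "pclass (*s) p \<in> sing_points f"
proof -
  have "eval (($) p) f = 0"
    using eval_jacobian_zero[OF assms(4) in_jacobian_ideal_euler[OF assms(1,2)]] .
  then have "eval (($) q) f = 0 \<and> (\<forall>i. eval (($) q) (pd i f) = 0)" if "q \<in> pclass (*s) p" for q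
    using that assms(4) eval_scale_point[OF assms(1)] eval_scale_point[OF pd_homog[OF assms(1)]]
    by (auto elim!: pclass_memE)
  then show ?thesis using assms(3) by (auto simp: sing_points_def plane_def)
qed

text \<open>The jacobian ideal contains a power of each variable.\<close>

lemma sing_points_empty:
  assumes "milnor_dim k f \<le> enat 0" "k \<ge> 1"
  shows "sing_points f = {}"
proof (rule ccontr)
  assume "sing_points f \<noteq> {}"
  then obtain P where P: "P \<in> sing_points f" by blast
  then have "P \<in> plane" by (simp add: sing_points_def)
  then obtain p where p: "p \<noteq> 0" "p \<in> P" by (rule planeE)
  then have sing: "eval (($) p) (pd i f) = 0" for i using P by (auto simp: sing_points_def)
  obtain B where "finite B" "card B \<le> 0" "homog k \<subseteq> mp.span (B \<union> (homog k \<inter> jacobian_ideal f))"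
    using assms(1) unfolding milnor_dim_le_iff by blast
  then have "homog k \<subseteq> mp.span (homog k \<inter> jacobian_ideal f)" by auto
  also have "\<dots> \<subseteq> homog k \<inter> jacobian_ideal f"
    by (rule mp.span_minimal[OF subset_refl subspace_jacobian_degree])
  finally have "var j ^ k \<in> jacobian_ideal f" for j
    using homog_power1[OF homog_var, of j k] by blast
  from eval_jacobian_zero[OF sing this] have "p $ j = 0" for j
    using assms(2) by (simp add: ev.subst_power)
  then show False using p(1) by (simp add: vec_eq_iff)
qed

subsection \<open>Smooth curves\<close>

lemma pd_var_power: "pd i (var j ^ n) = (if i = j then smul (of_nat n) (var j ^ (n - 1)) else 0)"
proof (induction n)
  case 0
  show ?case using pd_const[of i 1] by simp
next
  case (Suc n)
  have "pd i (var j ^ Suc n) = (if i = j then var j ^ n else 0) +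
      var j * (if i = j then smul (of_nat n) (var j ^ (n - 1)) else 0)"
    by (simp add: pd_var_mult Suc)
  moreover have "smul (of_nat (Suc n)) x = x + smul (of_nat n) x" for x :: "'a mpoly"
    by (simp add: mp.scale_left_distrib)
  ultimately show ?case by (cases n) (auto simp: smul_mult_right simp del: of_nat_Suc simp flip: power_Suc)
qed

lemma var_power: "var j ^ n = single (single j n) 1"
  by (induction n) (simp_all add: var_def mult_single flip: single_add)

lemma mdeg_eq_sum: "mdeg (\<alpha> :: 3 \<Rightarrow>\<^sub>0 nat) = (\<Sum>j\<in>UNIV. lookup \<alpha> j)"
  unfolding mdeg_def by (intro sum.mono_neutral_left) (auto simp: in_keys_iff)

text \<open>The Fermat curve: each monomial of degree \<open>3 d\<close> is divisible by some \<open>x\<^sub>j ^ (d - 1)\<close>.\<close>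

lemma ex_smooth_form:
  assumes "d \<ge> 1"
  shows "\<exists>f\<in>forms d. milnor_dim (3 * d) f \<le> enat 0"
proof -
  let ?f = "\<Sum>j\<in>(UNIV :: 3 set). var j ^ d"
  have "eval (\<lambda>i. if i = 0 then 1 else 0) ?f = 1"
    using assms by (simp add: ev.subst_hom sum_UNIV_3_from[of _ 0])
  then have "?f \<noteq> 0" by fastforce
  then have f: "?f \<in> forms d" unfolding forms_def
    by (auto intro!: homog_sum homog_power1 homog_var)
  have pd: "pd i ?f = smul (of_nat d) (var i ^ (d - 1))" for i
    by (simp add: pd_sum pd_var_power)
  have "single \<alpha> 1 \<in> jacobian_ideal ?f" if "mdeg \<alpha> = 3 * d" for \<alpha>
  proof -
    have "\<exists>j. d - 1 \<le> lookup \<alpha> j"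
    proof (rule ccontr)
      assume "\<not> ?thesis"
      then have "lookup \<alpha> j < d - 1" for j by (simp add: not_le)
      from this[of 0] this[of 1] this[of 2] show False
        using that by (simp add: mdeg_eq_sum sum_UNIV_3_from[of _ 0])
    qed
    then obtain j where j: "d - 1 \<le> lookup \<alpha> j" by blast
    have "single j (d - 1) + (\<alpha> - single j (d - 1)) = \<alpha>"
      using j by (intro poly_mapping_eqI) (auto simp: lookup_add lookup_minus lookup_single when_def)
    then have "single \<alpha> 1 = single (\<alpha> - single j (d - 1)) 1 * var j ^ (d - 1)"
      by (simp add: var_power mult_single add.commute)
    also have "var j ^ (d - 1) = smul (1 / of_nat d) (pd j ?f)" using assms by (simp add: pd)
    finally show ?thesis
      by (simp only: ideal.subspace_scale ideal_jacobian smul_in_ideal pd_in_jacobian)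
  qed
  then have "(\<lambda>\<alpha>. single \<alpha> 1) ` {\<alpha>. mdeg \<alpha> = 3 * d} \<subseteq> homog (3 * d) \<inter> jacobian_ideal ?f"
    by (auto intro: homog_single)
  from mp.span_mono[OF this] have "homog (3 * d) \<subseteq> mp.span ({} \<union> (homog (3 * d) \<inter> jacobian_ideal ?f))"
    using homog_span[of _ "3 * d"] unfolding Un_empty_left by blast
  then have "milnor_dim (3 * d) ?f \<le> enat 0" unfolding milnor_dim_le_iff
    by (intro exI[of _ "{}"]) simp
  then show ?thesis using f by blast
qed

text \<open>The smooth forms among the reduced ones contain a nonempty open subset of all forms.\<close>

lemma irreducible_reduced_forms:
  assumes "d \<ge> 1"
  shows "irreducible_forms d (reduced_forms d)"
  unfolding irreducible_forms_def
proof (intro conjI ballI allI impI)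
  show "reduced_forms d \<subseteq> forms d" by (auto simp: reduced_forms_def)
  fix f\<^sub>0 f\<^sub>1 e\<^sub>0 e\<^sub>1 and G\<^sub>0 G\<^sub>1 :: "(3 \<Rightarrow>\<^sub>0 nat) mpoly"
  assume f: "f\<^sub>0 \<in> reduced_forms d" "f\<^sub>1 \<in> reduced_forms d"
    and G: "G\<^sub>0 \<in> homog e\<^sub>0" "G\<^sub>1 \<in> homog e\<^sub>1" "eval (lookup f\<^sub>0) G\<^sub>0 \<noteq> 0" "eval (lookup f\<^sub>1) G\<^sub>1 \<noteq> 0"
  have "f\<^sub>0 \<in> forms d" "f\<^sub>1 \<in> forms d" using f by (auto simp: reduced_forms_def)
  then obtain g where g: "g \<in> forms d" "eval (lookup g) G\<^sub>0 \<noteq> 0" "eval (lookup g) G\<^sub>1 \<noteq> 0"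
    using irreducible_formsE[OF irreducible_all_forms _ _ G] by blast
  obtain h where h: "h \<in> forms d" "milnor_dim (3 * d) h \<le> enat 0" using ex_smooth_form assms by blast
  obtain e G where G': "G \<in> homog e" "eval (lookup h) G \<noteq> 0"
    "\<And>f. f \<in> forms d \<Longrightarrow> eval (lookup f) G \<noteq> 0 \<Longrightarrow> milnor_dim (3 * d) f \<le> enat 0"
    using open_conditionE[OF open_milnor_dim_le h] by blast
  obtain f where f: "f \<in> forms d" "eval (lookup f) (G\<^sub>0 * G\<^sub>1) \<noteq> 0" "eval (lookup f) G \<noteq> 0"
    by (rule irreducible_formsE[OF irreducible_all_forms g(1) h(1) homog_mult[OF G(1,2)] G'(1) _ G'(2)])
      (use g in \<open>auto simp: ev.subst_mult\<close>)
  then have "sing_points f = {}" using sing_points_empty[OF G'(3)] assms by simp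
  then have "f \<in> reduced_forms d" using f(1) by (simp add: reduced_forms_def)
  then show "\<exists>f\<in>reduced_forms d. eval (lookup f) G\<^sub>0 \<noteq> 0 \<and> eval (lookup f) G\<^sub>1 \<noteq> 0"
    using f(2) by (auto simp: ev.subst_mult)
qed

subsection \<open>Line arrangements\<close>

lemma curve_neq_iff_minor:
  assumes "L \<in> forms e" "M \<in> forms e"
  shows "curve L \<noteq> curve M \<longleftrightarrow> (\<exists>\<alpha> \<beta>. lookup L \<alpha> * lookup M \<beta> - lookup L \<beta> * lookup M \<alpha> \<noteq> 0)"
proof
  assume neq: "curve L \<noteq> curve M"
  obtain \<alpha> where \<alpha>: "lookup L \<alpha> \<noteq> 0"
    using assms(1) poly_mapping_eqI[of L 0] by (auto simp: forms_def)
  show "\<exists>\<alpha> \<beta>. lookup L \<alpha> * lookup M \<beta> - lookup L \<beta> * lookup M \<alpha> \<noteq> 0"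
  proof (rule ccontr)
    assume "\<not> ?thesis"
    then have minors: "lookup L \<alpha> * lookup M \<beta> = lookup L \<beta> * lookup M \<alpha>" for \<beta> by auto
    let ?c = "lookup M \<alpha> / lookup L \<alpha>"
    have M: "M = smul ?c L"
      using minors \<alpha> by (intro poly_mapping_eqI) (simp add: lookup_smul field_simps)
    then have "?c \<noteq> 0" using assms(2) by (auto simp: forms_def)
    from pclass_scale[OF mp.scale_scale this, of L] have "curve M = curve L" unfolding M[symmetric] .
    then show False using neq by simp
  qed
next
  assume "\<exists>\<alpha> \<beta>. lookup L \<alpha> * lookup M \<beta> - lookup L \<beta> * lookup M \<alpha> \<noteq> 0"
  then obtain \<alpha> \<beta> where "lookup L \<alpha> * lookup M \<beta> - lookup L \<beta> * lookup M \<alpha> \<noteq> 0" by blast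
  then show "curve L \<noteq> curve M" by (auto elim!: curve_eqD simp: lookup_smul)
qed

lemma linear_formE:
  assumes "L \<in> homog 1"
  obtains c :: "3 \<Rightarrow> complex" where "L = (\<Sum>j\<in>UNIV. smul (c j) (var j))"
proof -
  obtain g where g: "\<And>j. g j \<in> homog 0" "L = (\<Sum>j\<in>UNIV. var j * g j)"
    using homog_SucE[of L 0] assms by (metis One_nat_def)
  have "var j * g j = smul (lookup (g j) 0) (var j)" for j
    by (subst homog_0_eq[OF g(1)]) (simp add: smul_def mult.commute)
  then show ?thesis using that g(2) by simp
qed

lemma eval_linear_form: "eval x (\<Sum>j\<in>UNIV. smul (c j) (var j)) = (\<Sum>j\<in>UNIV. c j * x j)"
  by (simp add: ev.subst_hom)

lemma lookup_linear_form:
  "lookup (\<Sum>j\<in>(UNIV :: 3 set). smul (c j) (var j)) \<alpha> = (\<Sum>j\<in>UNIV. if \<alpha> = single j 1 then c j else 0)"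
  by (auto simp: lookup_sum lookup_smul var_def lookup_single when_def intro!: sum.cong)

lemma pd_linear_form_mult:
  fixes c :: "3 \<Rightarrow> complex"
  shows "pd i ((\<Sum>j\<in>UNIV. smul (c j) (var j)) * h) =
    smul (c i) h + (\<Sum>j\<in>UNIV. smul (c j) (var j)) * pd i h"
proof -
  have "pd i ((\<Sum>j\<in>UNIV. smul (c j) (var j)) * h) = (\<Sum>j\<in>UNIV. smul (c j) (pd i (var j * h)))"
    by (simp add: sum_distrib_right pd_sum smul_mult_left pd_smul)
  also have "\<dots> = (\<Sum>j\<in>UNIV. if i = j then smul (c j) h else 0) +
      (\<Sum>j\<in>UNIV. smul (c j) (var j * pd i h))"
    by (simp add: pd_var_mult mp.scale_right_distrib sum.distrib if_distrib[of "smul _"] cong: if_cong)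
  finally show ?thesis by (simp add: sum_distrib_right smul_mult_left)
qed

lemma plus_3 [simp]: "(i :: 3) + 1 + 1 = i + 2" "i + 1 + 2 = i" "i + 2 + 1 = i" "i + 2 + 2 = i + 1"
  by (simp_all add: add.assoc)

text \<open>The common point is the cross product \<open>n\<close> of the two equations.\<close>

lemma lines_meet_in_point:
  assumes "L \<in> forms 1" "M \<in> forms 1" "curve L \<noteq> curve M"
  shows "\<exists>Q. \<forall>p. p \<noteq> 0 \<longrightarrow> eval (($) p) L = 0 \<longrightarrow> eval (($) p) M = 0 \<longrightarrow> pclass (*s) p = Q"
proof -
  obtain a where a: "L = (\<Sum>j\<in>UNIV. smul (a j) (var j))"
    using linear_formE[of L] assms(1) unfolding forms_def by blast
  obtain b where b: "M = (\<Sum>j\<in>UNIV. smul (b j) (var j))"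
    using linear_formE[of M] assms(2) unfolding forms_def by blast
  define n where "n k = a (k + 1) * b (k + 2) - a (k + 2) * b (k + 1)" for k
  have "\<exists>k. n k \<noteq> 0"
  proof (rule ccontr)
    assume "\<not> ?thesis"
    then have "n i = 0" "n (i + 1) = 0" "n (i + 2) = 0" for i by auto
    then have minor: "a i * b j = a j * b i" for i j
      using exhaust_3_from[of j i] by (auto simp: n_def)
    obtain \<alpha> \<beta> where "lookup L \<alpha> * lookup M \<beta> - lookup L \<beta> * lookup M \<alpha> \<noteq> 0"
      using curve_neq_iff_minor[OF assms(1,2)] assms(3) by blast
    moreover have "lookup L \<alpha> * lookup M \<beta> = lookup L \<beta> * lookup M \<alpha>"
      unfolding a b lookup_linear_form sum_product
      by (subst sum.swap) (intro sum.cong refl, simp add: minor mult.commute)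
    ultimately show False by simp
  qed
  then obtain k where k: "n k \<noteq> 0" by blast
  have "pclass (*s) p = pclass (*s) (\<chi> i. n i)"
    if p: "p \<noteq> 0" "eval (($) p) L = 0" "eval (($) p) M = 0" for p
  proof -
    have La: "a k * p $ k + a (k + 1) * p $ (k + 1) + a (k + 2) * p $ (k + 2) = 0"
    proof -
      have "(\<Sum>j\<in>UNIV. a j * p $ j) = 0" using p(2) unfolding a eval_linear_form .
      then show ?thesis by (simp add: sum_UNIV_3_from[of _ k])
    qed
    have Mb: "b k * p $ k + b (k + 1) * p $ (k + 1) + b (k + 2) * p $ (k + 2) = 0"
    proof -
      have "(\<Sum>j\<in>UNIV. b j * p $ j) = 0" using p(3) unfolding b eval_linear_form .
      then show ?thesis by (simp add: sum_UNIV_3_from[of _ k])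
    qed
    have "n k * p $ (k + 1) = p $ k * n (k + 1)" "n k * p $ (k + 2) = p $ k * n (k + 2)"
      using La Mb unfolding n_def by (simp_all, algebra+)
    then have np: "n k * p $ j = p $ k * n j" for j using exhaust_3_from[of j k] by auto
    let ?c = "p $ k / n k"
    have pc: "p = ?c *s (\<chi> i. n i)" using np k by (simp add: vec_eq_iff field_simps)
    then have "?c \<noteq> 0" using p(1) by auto
    from pclass_vector_scale[OF this, of "\<chi> i. n i"] show ?thesis unfolding pc[symmetric] .
  qed
  then show ?thesis by blast
qed

text \<open>By the product rule a singular point on one of the lines lies on a second one.\<close>

lemma arrangement_forms_reduced: "arrangement_forms d \<subseteq> reduced_forms d"
proof
  fix f assume "f \<in> arrangement_forms d"
  then obtain L where L: "\<And>i. i < d \<Longrightarrow> L i \<in> forms 1"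
    and neq: "\<And>i j. i < d \<Longrightarrow> j < d \<Longrightarrow> i \<noteq> j \<Longrightarrow> curve (L i) \<noteq> curve (L j)"
    and f: "f = (\<Prod>i<d. L i)" unfolding arrangement_forms_def by blast
  have "f \<noteq> 0" using L unfolding f by (auto simp: prod_zero_iff forms_def)
  moreover have "f \<in> homog d"
    using homog_prod[of "{..<d}" L "\<lambda>_. 1"] L unfolding f by (auto simp: forms_def)
  ultimately have forms: "f \<in> forms d" by (simp add: forms_def)
  have "\<forall>i j. i < d \<longrightarrow> j < d \<longrightarrow> i \<noteq> j \<longrightarrow> (\<exists>Q. \<forall>p. p \<noteq> 0 \<longrightarrow> eval (($) p) (L i) = 0 \<longrightarrow>
      eval (($) p) (L j) = 0 \<longrightarrow> pclass (*s) p = Q)"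
    using lines_meet_in_point[OF L L neq] by blast
  then obtain Q where Q: "\<And>i j p. i < d \<Longrightarrow> j < d \<Longrightarrow> i \<noteq> j \<Longrightarrow> p \<noteq> 0 \<Longrightarrow>
      eval (($) p) (L i) = 0 \<Longrightarrow> eval (($) p) (L j) = 0 \<Longrightarrow> pclass (*s) p = Q i j" by metis
  have "sing_points f \<subseteq> (\<lambda>(i, j). Q i j) ` ({..<d} \<times> {..<d})"
  proof
    fix P assume P: "P \<in> sing_points f"
    then have "P \<in> plane" by (simp add: sing_points_def)
    then obtain p where p: "p \<noteq> 0" "P = pclass (*s) p" "p \<in> P" by (rule planeE)
    have "eval (($) p) f = 0" using P p(3) by (auto simp: sing_points_def)
    then obtain i where i: "i < d" "eval (($) p) (L i) = 0"
      by (auto simp: f ev.subst_prod prod_zero_iff)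
    define h where "h = (\<Prod>j\<in>{..<d} - {i}. L j)"
    have fh: "f = L i * h" using i(1) unfolding f h_def by (simp add: prod.remove)
    obtain c where c: "L i = (\<Sum>j\<in>UNIV. smul (c j) (var j))"
      using linear_formE[of "L i"] L[OF i(1)] unfolding forms_def by blast
    have "\<exists>k. c k \<noteq> 0"
    proof (rule ccontr)
      assume "\<not> ?thesis"
      then have "L i = 0" unfolding c by simp
      then show False using L[OF i(1)] by (simp add: forms_def)
    qed
    then obtain k where k: "c k \<noteq> 0" by blast
    have "eval (($) p) (pd k f) = c k * eval (($) p) h + eval (($) p) (L i) * eval (($) p) (pd k h)"
      unfolding fh c pd_linear_form_mult by (simp add: ev.subst_add ev.subst_smul ev.subst_mult)
    moreover have "eval (($) p) (pd k f) = 0" using P p(3) by (auto simp: sing_points_def)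
    ultimately have "eval (($) p) h = 0" using k i(2) by simp
    then obtain j where j: "j < d" "j \<noteq> i" "eval (($) p) (L j) = 0"
      by (auto simp: h_def ev.subst_prod prod_zero_iff)
    then have "P = Q i j" using Q[OF i(1) j(1) _ p(1) i(2) j(3)] p(2) by simp
    then show "P \<in> (\<lambda>(i, j). Q i j) ` ({..<d} \<times> {..<d})" using i(1) j(1) by auto
  qed
  then have "finite (sing_points f)" by (rule finite_subset) simp
  then show "f \<in> reduced_forms d" using forms by (simp add: reduced_forms_def)
qed

lemma lookup_poly_const:
  fixes P :: "'v mpoly poly"
  shows "lookup (poly P (single 0 t)) \<alpha> = poly (map_poly (\<lambda>g. lookup g \<alpha>) P) t"
proof (induction P)
  case (pCons a P)
  have "single 0 t * poly P (single 0 t) = smul t (poly P (single 0 t))" by (simp add: smul_def)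
  then show ?case using pCons by (simp add: map_poly_pCons lookup_add lookup_smul)
qed simp

text \<open>Two arrangements are joined by moving each line along a pencil; all but finitely many members
  of this family are arrangements.\<close>

lemma irreducible_arrangement_forms: "irreducible_forms d (arrangement_forms d)"
  unfolding irreducible_forms_def
proof (intro conjI ballI allI impI)
  show "arrangement_forms d \<subseteq> forms d" using arrangement_forms_reduced by (auto simp: reduced_forms_def)
  fix f\<^sub>0 f\<^sub>1 e\<^sub>0 e\<^sub>1 and G\<^sub>0 G\<^sub>1 :: "(3 \<Rightarrow>\<^sub>0 nat) mpoly"
  assume f: "f\<^sub>0 \<in> arrangement_forms d" "f\<^sub>1 \<in> arrangement_forms d"
    and G: "eval (lookup f\<^sub>0) G\<^sub>0 \<noteq> 0" "eval (lookup f\<^sub>1) G\<^sub>1 \<noteq> 0"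
  obtain L where L: "\<And>i. i < d \<Longrightarrow> L i \<in> forms 1"
    "\<And>i j. i < d \<Longrightarrow> j < d \<Longrightarrow> i \<noteq> j \<Longrightarrow> curve (L i) \<noteq> curve (L j)" "f\<^sub>0 = (\<Prod>i<d. L i)"
    using f(1) unfolding arrangement_forms_def by blast
  obtain M where M: "\<And>i. i < d \<Longrightarrow> M i \<in> forms 1" "f\<^sub>1 = (\<Prod>i<d. M i)"
    using f(2) unfolding arrangement_forms_def by blast
  define N where "N i t = L i + smul t (M i - L i)" for i t
  define F where "F t = (\<Prod>i<d. N i t)" for t
  define P where "P = (\<Prod>i<d. [:L i, M i - L i:])"
  define q where "q \<alpha> = map_poly (\<lambda>g. lookup g \<alpha>) P" for \<alpha>
  have "F t = poly P (single 0 t)" for t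
    by (simp add: F_def N_def P_def poly_prod smul_def)
  then have F: "lookup (F t) = (\<lambda>\<alpha>. poly (q \<alpha>) t)" for t
    by (simp add: q_def lookup_poly_const fun_eq_iff)
  have evalF: "eval (lookup (F t)) G = poly (subst (\<lambda>c. [:c:]) q G) t" for t G
    by (simp add: F poly_subst_const_poly)
  define l where "l i \<alpha> = [:lookup (L i) \<alpha>, lookup (M i) \<alpha> - lookup (L i) \<alpha>:]" for i \<alpha>
  have l: "lookup (N i t) \<alpha> = poly (l i \<alpha>) t" for i t \<alpha>
    by (simp add: N_def l_def lookup_add lookup_smul lookup_minus)
  have "\<exists>\<alpha>. lookup (L i) \<alpha> \<noteq> 0" if "i < d" for i
    using L(1)[OF that] poly_mapping_eqI[of "L i" 0] by (auto simp: forms_def)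
  then obtain a where a: "\<And>i. i < d \<Longrightarrow> lookup (L i) (a i) \<noteq> 0" by metis
  have "\<forall>i j. i < d \<longrightarrow> j < d \<longrightarrow> i \<noteq> j \<longrightarrow>
      (\<exists>u v. lookup (L i) u * lookup (L j) v - lookup (L i) v * lookup (L j) u \<noteq> 0)"
    using curve_neq_iff_minor[OF L(1) L(1)] L(2) by blast
  then obtain u v where uv: "\<And>i j. i < d \<Longrightarrow> j < d \<Longrightarrow> i \<noteq> j \<Longrightarrow> lookup (L i) (u i j) *
      lookup (L j) (v i j) - lookup (L i) (v i j) * lookup (L j) (u i j) \<noteq> 0" by metis
  define minor where "minor = (\<lambda>(i, j). l i (u i j) * l j (v i j) - l i (v i j) * l j (u i j))"
  let ?I = "{(i, j). i < d \<and> j < d \<and> i \<noteq> j}"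
  let ?A = "{subst (\<lambda>c. [:c:]) q G\<^sub>0, subst (\<lambda>c. [:c:]) q G\<^sub>1} \<union> (\<lambda>i. l i (a i)) ` {..<d} \<union> minor ` ?I"
  have "F 0 = f\<^sub>0" "F 1 = f\<^sub>1" by (simp_all add: F_def N_def L(3) M(2))
  then have "poly (subst (\<lambda>c. [:c:]) q G\<^sub>0) 0 \<noteq> 0" "poly (subst (\<lambda>c. [:c:]) q G\<^sub>1) 1 \<noteq> 0"
    using G evalF[of 0] evalF[of 1] by auto
  moreover have "poly (l i (a i)) 0 \<noteq> 0" if "i < d" for i using a[OF that] by (simp add: l_def)
  moreover have "poly (minor p) 0 \<noteq> 0" if "p \<in> ?I" for p
  proof -
    from that obtain i j where "p = (i, j)" "i < d" "j < d" "i \<noteq> j" by auto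
    then show ?thesis using uv[of i j] by (simp add: minor_def l_def mult.commute)
  qed
  ultimately have "p \<noteq> 0" if "p \<in> ?A" for p using that by fastforce
  moreover have "finite ?A"
    using finite_subset[of ?I "{..<d} \<times> {..<d}"] by (intro finite_UnI finite_imageI) auto
  ultimately obtain t where t: "\<And>p. p \<in> ?A \<Longrightarrow> poly p t \<noteq> 0" using common_nonroot[of ?A] by blast
  have N: "N i t \<in> forms 1" if "i < d" for i
  proof -
    have "N i t \<in> homog 1" using L(1)[OF that] M(1)[OF that] unfolding N_def forms_def
      by (auto intro: homog_add homog_smul homog_diff)
    moreover have "N i t \<noteq> 0" using t[of "l i (a i)"] that l[of i t "a i"] by auto
    ultimately show ?thesis by (simp add: forms_def)
  qed
  have "curve (N i t) \<noteq> curve (N j t)" if "i < d" "j < d" "i \<noteq> j" for i j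
  proof -
    have "poly (minor (i, j)) t \<noteq> 0" using t that by blast
    then have "lookup (N i t) (u i j) * lookup (N j t) (v i j) -
        lookup (N i t) (v i j) * lookup (N j t) (u i j) \<noteq> 0" by (simp add: minor_def l)
    then show ?thesis using curve_neq_iff_minor[OF N N] that by blast
  qed
  then have "F t \<in> arrangement_forms d" unfolding arrangement_forms_def F_def using N
    by (intro CollectI exI[of _ "\<lambda>i. N i t"]) auto
  moreover have "eval (lookup (F t)) G\<^sub>0 \<noteq> 0" "eval (lookup (F t)) G\<^sub>1 \<noteq> 0"
    using t unfolding evalF by auto
  ultimately show "\<exists>f\<in>arrangement_forms d. eval (lookup f) G\<^sub>0 \<noteq> 0 \<and> eval (lookup f) G\<^sub>1 \<noteq> 0" by blast
qed

section \<open>Multiplication by a general linear form on the Milnor algebra\<close>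

lemma homog_in_span_products:
  fixes F :: ternary
  assumes lin: "\<kappa> \<in> homog 1" "\<mu> \<in> homog 1" "\<nu> \<in> homog 1"
    and span: "\<And>j. var j \<in> mp.span {\<kappa>, \<mu>, \<nu>}"
    and "F \<in> homog n"
  shows "F \<in> mp.span ((\<lambda>(a, b). \<kappa> ^ a * \<mu> ^ b * \<nu> ^ (n - a - b)) ` {(a, b). a + b \<le> n})"
  using assms(5)
proof (induction rule: homog_induct)
  case (const c)
  have "smul c (1 :: ternary) \<in> mp.span ((\<lambda>(a, b). \<kappa> ^ a * \<mu> ^ b * \<nu> ^ (0 - a - b)) ` {(a, b). a + b \<le> (0 :: nat)})"
    by (intro mp.span_scale mp.span_base) force
  moreover have "smul c 1 = (single 0 c :: ternary)" by (simp add: smul_def)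
  ultimately show ?case by simp
next
  case (step m g)
  let ?g = "\<lambda>n (a, b). \<kappa> ^ a * \<mu> ^ b * \<nu> ^ (n - a - b)"
  let ?S = "\<lambda>n. mp.span (?g n ` {(a, b). a + b \<le> n})"
  have gen: "x * ?g m p \<in> ?S (Suc m)" if p: "p \<in> {(a, b). a + b \<le> m}" and x: "x \<in> {\<kappa>, \<mu>, \<nu>}" for x p
  proof -
    from p obtain a b where ab: "p = (a, b)" "a + b \<le> m" by auto
    have eq: "\<kappa> * ?g m p = ?g (Suc m) (Suc a, b)" "\<mu> * ?g m p = ?g (Suc m) (a, Suc b)"
      "\<nu> * ?g m p = ?g (Suc m) (a, b)"
      using ab by (simp_all add: Suc_diff_le mult_ac)
    consider "x = \<kappa>" | "x = \<mu>" | "x = \<nu>" using x by blast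
    then have "x * ?g m p \<in> ?g (Suc m) ` {(a, b). a + b \<le> Suc m}"
      by cases (simp_all only: eq, (rule imageI, use ab in simp)+)
    then show ?thesis by (rule mp.span_base)
  qed
  have one: "x * G \<in> ?S (Suc m)" if "G \<in> ?S m" and x: "x \<in> {\<kappa>, \<mu>, \<nu>}" for x G
    using that(1)
  proof (induction rule: mp.span_induct_alt)
    case base
    then show ?case by (simp add: mp.span_zero)
  next
    case (step c y z)
    then have "smul c (x * y) + x * z \<in> ?S (Suc m)"
      using gen[OF _ x] by (intro mp.span_add mp.span_scale) auto
    then show ?case by (simp add: distrib_left smul_mult_right)
  qed
  have "y * G \<in> ?S (Suc m)" if "y \<in> mp.span {\<kappa>, \<mu>, \<nu>}" and G: "G \<in> ?S m" for y G
    using that(1)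
  proof (induction rule: mp.span_induct_alt)
    case base
    then show ?case by (simp add: mp.span_zero)
  next
    case (step c x z)
    then have "smul c (x * G) + z * G \<in> ?S (Suc m)"
      using one[OF G] by (intro mp.span_add mp.span_scale) auto
    then show ?case by (simp add: distrib_right smul_mult_left)
  qed
  then show ?case using step(2) span by (intro mp.span_sum) auto
qed

lemma finite_exponents: "finite {(a, b). a + b \<le> (n :: nat)}"
  by (rule finite_subset[of _ "{..n} \<times> {..n}"]) auto

lemma homog_expand:
  fixes F :: ternary
  assumes "\<kappa> \<in> homog 1" "\<mu> \<in> homog 1" "\<nu> \<in> homog 1" "\<And>j. var j \<in> mp.span {\<kappa>, \<mu>, \<nu>}" "F \<in> homog n"
  obtains h where "F = (\<Sum>(a, b)\<in>{(a, b). a + b \<le> n}. smul (h a b) (\<kappa> ^ a * \<mu> ^ b * \<nu> ^ (n - a - b)))"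
proof -
  obtain h where "F = (\<Sum>p\<in>{(a, b). a + b \<le> n}.
      smul (h p) ((\<lambda>(a, b). \<kappa> ^ a * \<mu> ^ b * \<nu> ^ (n - a - b)) p))"
    using mp.span_imageE[OF finite_exponents homog_in_span_products[OF assms]] by blast
  then have "F = (\<Sum>(a, b)\<in>{(a, b). a + b \<le> n}. smul (h (a, b)) (\<kappa> ^ a * \<mu> ^ b * \<nu> ^ (n - a - b)))"
    by (simp add: case_prod_unfold)
  then show ?thesis by (rule that)
qed

subsection \<open>Restriction to a line\<close>

definition line_form :: "complex \<Rightarrow> ternary" where
  "line_form t = var 0 + smul t (var 1) + smul (t\<^sup>2) (var 2)"

lemma line_form_homog: "line_form t \<in> homog 1"
  unfolding line_form_def by (intro homog_add homog_smul homog_var)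

lemma eval_line_form: "eval x (line_form t) = x 0 + t * x 1 + t\<^sup>2 * x 2"
  by (simp add: line_form_def ev.subst_hom)

text \<open>Restriction to the line \<open>line_form t = 0\<close>, dehomogenised; \<open>lift_from_line\<close> is a section of it.\<close>

definition restrict_line :: "complex \<Rightarrow> ternary \<Rightarrow> complex poly" where
  "restrict_line t = subst (\<lambda>c. [:c:])
    (\<lambda>j. if j = 0 then [:- t, - (t\<^sup>2):] else if j = 1 then 1 else [:0, 1:])"

definition lift_from_line :: "nat \<Rightarrow> complex poly \<Rightarrow> ternary" where
  "lift_from_line n q = (\<Sum>b\<le>n. smul (coeff q b) (var 1 ^ (n - b) * var 2 ^ b))"

definition line_point :: "complex \<Rightarrow> complex \<Rightarrow> complex^3" where
  "line_point t s = (\<chi> j. if j = 0 then - t - t\<^sup>2 * s else if j = 1 then 1 else s)"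

definition line_infinity :: "complex \<Rightarrow> complex^3" where
  "line_infinity t = (\<chi> j. if j = 0 then - (t\<^sup>2) else if j = 1 then 0 else 1)"

lemmas restrict_line_hom = const_poly.subst_hom[of "\<lambda>j :: 3. if j = 0 then [:- t, - (t\<^sup>2):]
    else if j = 1 then 1 else [:0, 1:]" for t, folded restrict_line_def]

lemma restrict_line_var [simp]:
  "restrict_line t (var 1) = 1" "restrict_line t (var 2) = [:0, 1:]"
  by (simp_all add: restrict_line_def)

lemma restrict_line_form [simp]: "restrict_line t (line_form t) = 0"
  by (simp add: restrict_line_def line_form_def const_poly.subst_hom)

lemma poly_restrict_line: "poly (restrict_line t F) s = eval (($) (line_point t s)) F"
  unfolding restrict_line_def poly_subst_const_poly
  by (rule arg_cong[of _ _ "\<lambda>x. eval x F"]) (auto simp: line_point_def algebra_simps)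

lemma line_form_points [simp]:
  "eval (($) (line_point t s)) (line_form t) = 0" "eval (($) (line_infinity t)) (line_form t) = 0"
  by (simp_all add: eval_line_form line_point_def line_infinity_def algebra_simps)

lemma lift_from_line_homog: "lift_from_line n q \<in> homog n"
  unfolding lift_from_line_def
  by (intro homog_sum homog_smul homog_mult_eq[OF homog_power1 homog_power1] homog_var) auto

lemma restrict_lift:
  assumes "degree q \<le> n"
  shows "restrict_line t (lift_from_line n q) = q"
proof -
  have "restrict_line t (lift_from_line n q) = (\<Sum>b\<le>n. monom (coeff q b) b)"
    by (simp add: lift_from_line_def restrict_line_hom monom_altdef)
  then show ?thesis using poly_as_sum_of_monoms'[OF assms] by simp
qed

text \<open>Expand \<open>F\<close> in powers of \<open>x\<^sub>1\<close>, \<open>x\<^sub>2\<close> and the equation of the line; the terms without the latter are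
  the coefficients of the restriction.\<close>

lemma homog_mod_line:
  assumes "F \<in> homog n"
  shows "degree (restrict_line t F) \<le> n"
    and "\<exists>G\<in>homog (n - 1). F = lift_from_line n (restrict_line t F) + line_form t * G"
proof -
  have "var 0 = line_form t - (smul t (var 1) + smul (t\<^sup>2) (var 2))"
    by (simp add: line_form_def)
  also have "\<dots> \<in> mp.span {var 1, var 2, line_form t}"
    by (intro mp.span_diff mp.span_add mp.span_scale mp.span_base) auto
  finally have "var j \<in> mp.span {var 1, var 2, line_form t}" for j
    using exhaust_3_from[of j 0] by (auto intro: mp.span_base)
  then obtain h where h: "F = (\<Sum>(a, b)\<in>{(a, b). a + b \<le> n}.
      smul (h a b) (var 1 ^ a * var 2 ^ b * line_form t ^ (n - a - b)))"
    using homog_expand[OF homog_var[of 1] homog_var[of 2] line_form_homog[of t] _ assms] by blast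
  define A :: ternary where "A = (\<Sum>b\<le>n. smul (h (n - b) b) (var 1 ^ (n - b) * var 2 ^ b))"
  define G :: ternary where "G = (\<Sum>(a, b)\<in>{(a, b). a + b < n}.
      smul (h a b) (var 1 ^ a * var 2 ^ b * line_form t ^ (n - 1 - a - b)))"
  have "{(a, b). a + b \<le> n} = {(a, b). a + b < n} \<union> (\<lambda>b. (n - b, b)) ` {..n}"
  proof (intro equalityI subsetI)
    fix p assume "p \<in> {(a, b). a + b \<le> n}"
    then obtain a b where p: "p = (a, b)" "a + b \<le> n" by auto
    then have "a + b < n \<or> p = (n - b, b)" by auto
    then show "p \<in> {(a, b). a + b < n} \<union> (\<lambda>b. (n - b, b)) ` {..n}" using p by auto
  qed auto
  moreover have "{(a, b). a + b < n} \<inter> (\<lambda>b. (n - b, b)) ` {..n} = {}" by auto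
  moreover have fin: "finite {(a, b). a + b < n}"
    by (rule finite_subset[OF _ finite_exponents[of n]]) auto
  ultimately have "F = (\<Sum>(a, b)\<in>{(a, b). a + b < n}.
      smul (h a b) (var 1 ^ a * var 2 ^ b * line_form t ^ (n - a - b))) +
      (\<Sum>(a, b)\<in>(\<lambda>b. (n - b, b)) ` {..n}.
      smul (h a b) (var 1 ^ a * var 2 ^ b * line_form t ^ (n - a - b)))"
    unfolding h by (simp add: sum.union_disjoint)
  also have "(\<Sum>(a, b)\<in>(\<lambda>b. (n - b, b)) ` {..n}.
      smul (h a b) (var 1 ^ a * var 2 ^ b * line_form t ^ (n - a - b))) = A"
    unfolding A_def by (subst sum.reindex) (auto simp: inj_on_def)
  also have "(\<Sum>(a, b)\<in>{(a, b). a + b < n}.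
      smul (h a b) (var 1 ^ a * var 2 ^ b * line_form t ^ (n - a - b))) = line_form t * G"
  proof -
    have "line_form t ^ (n - a - b) = line_form t * line_form t ^ (n - 1 - a - b)" if "a + b < n" for a b
    proof -
      have "n - a - b = Suc (n - 1 - a - b)" using that by simp
      then show ?thesis by simp
    qed
    then show ?thesis unfolding G_def sum_distrib_left
      by (intro sum.cong refl) (auto simp: smul_mult_right mult_ac)
  qed
  finally have F: "F = A + line_form t * G" by (simp add: add.commute)
  have restr: "restrict_line t F = (\<Sum>b\<le>n. monom (h (n - b) b) b)"
    unfolding F by (simp add: A_def restrict_line_hom monom_altdef)
  show "degree (restrict_line t F) \<le> n" unfolding restr
    by (intro degree_sum_le) (auto intro: order_trans[OF degree_monom_le])
  have "lift_from_line n (restrict_line t F) = A" unfolding A_def lift_from_line_def restr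
    by (intro sum.cong refl) (simp add: coeff_sum)
  moreover have "G \<in> homog (n - 1)" unfolding G_def
  proof (intro homog_sum, clarify)
    fix a b assume "a + b < n"
    then have "a + b + (n - 1 - a - b) = n - 1" by simp
    then show "smul (h a b) (var 1 ^ a * var 2 ^ b * line_form t ^ (n - 1 - a - b)) \<in> homog (n - 1)"
      by (intro homog_smul homog_mult_eq[OF homog_mult[OF homog_power1[OF homog_var]
            homog_power1[OF homog_var]] homog_power1[OF line_form_homog]])
  qed
  ultimately show "\<exists>G\<in>homog (n - 1). F = lift_from_line n (restrict_line t F) + line_form t * G"
    using F by auto
qed

lemma coeff_restrict_line:
  assumes "F \<in> homog n"
  shows "coeff (restrict_line t F) n = eval (($) (line_infinity t)) F"
proof -
  obtain G where F: "F = lift_from_line n (restrict_line t F) + line_form t * G"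
    using homog_mod_line(2)[OF assms] by blast
  have "eval (($) (line_infinity t)) (lift_from_line n q) = coeff q n" for q
  proof -
    have "eval (($) (line_infinity t)) (lift_from_line n q) = (\<Sum>b\<le>n. if b = n then coeff q b else 0)"
      unfolding lift_from_line_def ev.subst_hom
      by (intro sum.cong refl) (auto simp: line_infinity_def power_0_left)
    then show ?thesis by simp
  qed
  then show ?thesis by (subst F) (simp add: ev.subst_hom)
qed

text \<open>A nonconstant greatest common divisor would have a root.\<close>

lemma bezout_no_common_root:
  fixes g h :: "complex poly"
  assumes "g \<noteq> 0" "\<And>z. poly g z = 0 \<Longrightarrow> poly h z \<noteq> 0"
  shows "\<exists>a b. a * g + b * h = 1"
proof -
  have "degree (gcd g h) = 0"
  proof (rule ccontr)
    assume "degree (gcd g h) \<noteq> 0"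
    then obtain z where "poly (gcd g h) z = 0"
      using fundamental_theorem_of_algebra[of "gcd g h"] by (auto simp: constant_degree)
    then have "poly g z = 0" "poly h z = 0" by (metis dvd_trans gcd_dvd1 gcd_dvd2 poly_eq_0_iff_dvd)+
    then show False using assms(2) by blast
  qed
  moreover have "gcd g h \<noteq> 0" using assms(1) by simp
  ultimately have "is_unit (gcd g h)" using is_unit_iff_degree by blast
  then have "gcd g h = 1" by (simp add: is_unit_gcd)
  then show ?thesis using bezout_coefficients_fst_snd[of g h] by metis
qed

text \<open>Restricted to a line without singular points, the partial derivatives have no common zero. Two
  general linear combinations of them are then coprime binary forms of degree \<open>d - 1\<close>, and these
  generate all binary forms of degree at least \<open>2 (d - 1)\<close>.\<close>

lemma partials_generate_mod_line:
  assumes f: "f \<in> homog d" "d \<ge> 1" and K: "2 * (d - 1) \<le> K" and F: "F \<in> homog K"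
    and line: "\<And>P p. P \<in> sing_points f \<Longrightarrow> p \<in> P \<Longrightarrow> eval (($) p) (line_form t) \<noteq> 0"
  shows "\<exists>G\<in>homog (K - 1). F - line_form t * G \<in> jacobian_ideal f"
proof -
  define e where "e = d - 1"
  define r where "r j = restrict_line t (pd j f)" for j
  define c :: "complex \<Rightarrow> 3 \<Rightarrow> complex" where "c s j = (if j = 0 then 1 else if j = 1 then s else s\<^sup>2)" for s j
  define D where "D s = (\<Sum>j\<in>UNIV. smul (c s j) (pd j f))" for s
  have D_homog: "D s \<in> homog e" for s
    unfolding D_def e_def by (intro homog_sum homog_smul pd_homog f)
  have D_jac: "D s \<in> jacobian_ideal f" for s
    unfolding D_def
    by (intro mp.subspace_sum subspace_of_ideal ideal_jacobian mp.subspace_scale pd_in_jacobian)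
  have c_sum: "(\<Sum>j\<in>UNIV. c s j * v j) = v 0 + s * v 1 + s\<^sup>2 * v 2" for s v
    by (simp add: sum_UNIV_3_from[of _ 0] c_def)
  have nonsing: "\<exists>j. eval (($) p) (pd j f) \<noteq> 0" if p: "p \<noteq> 0" "eval (($) p) (line_form t) = 0" for p
  proof (rule ccontr)
    assume "\<not> ?thesis"
    then have "pclass (*s) p \<in> sing_points f" by (intro sing_pointsI[OF f p(1)]) simp
    moreover have "p \<in> pclass (*s) p" unfolding pclass_def by (auto intro!: exI[of _ 1])
    ultimately show False using line p(2) by blast
  qed
  have "line_infinity t \<noteq> 0" by (auto simp: line_infinity_def vec_eq_iff intro!: exI[of _ 2])
  then have "\<exists>j. eval (($) (line_infinity t)) (pd j f) \<noteq> 0" by (rule nonsing) simp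
  then obtain s where s: "(\<Sum>j\<in>UNIV. c s j * eval (($) (line_infinity t)) (pd j f)) \<noteq> 0"
    using avoid_vectors[of "{\<lambda>j. eval (($) (line_infinity t)) (pd j f)}"] unfolding c_sum by auto
  define g where "g = restrict_line t (D s)"
  have "coeff g e \<noteq> 0" using s coeff_restrict_line[OF D_homog] by (simp add: g_def D_def ev.subst_hom)
  then have g: "g \<noteq> 0" "degree g = e"
    using homog_mod_line(1)[OF D_homog, of t s] le_degree[of g e] by (auto simp: g_def)
  have "line_point t z \<noteq> 0" for z by (auto simp: line_point_def vec_eq_iff intro!: exI[of _ 1])
  then have "\<exists>j. poly (r j) z \<noteq> 0" for z unfolding r_def poly_restrict_line by (rule nonsing) simp
  then obtain s' where s': "\<forall>v\<in>(\<lambda>z j. poly (r j) z) ` {z. poly g z = 0}. (\<Sum>j\<in>UNIV. c s' j * v j) \<noteq> 0"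
    using avoid_vectors[of "(\<lambda>z j. poly (r j) z) ` {z. poly g z = 0}"] poly_roots_finite[OF g(1)]
    unfolding c_sum by auto
  define h where "h = restrict_line t (D s')"
  have "poly h z = (\<Sum>j\<in>UNIV. c s' j * poly (r j) z)" for z
    by (simp add: h_def D_def r_def restrict_line_hom poly_sum)
  then have "poly h z \<noteq> 0" if "poly g z = 0" for z using s' that by simp
  then obtain u v where uv: "u * g + v * h = 1" using bezout_no_common_root[OF g(1)] by blast
  have h: "degree h \<le> e" unfolding h_def by (rule homog_mod_line(1)[OF D_homog])
  define q where "q = restrict_line t F"
  define w where "w = (q * v) mod g"
  define y where "y = q * u + (q * v) div g * h"
  have qyw: "q = y * g + w * h"
  proof -
    have "y * g + w * h = q * u * g + ((q * v) div g * g + (q * v) mod g) * h"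
      by (simp only: y_def w_def distrib_right distrib_left mult_ac add_ac)
    also have "\<dots> = q * u * g + q * v * h" by (simp only: div_mult_mod_eq)
    also have "\<dots> = q * (u * g + v * h)" by (simp add: algebra_simps)
    finally show ?thesis by (simp add: uv)
  qed
  \<comment> \<open>Reducing the cofactor of \<open>h\<close> modulo \<open>g\<close> bounds the degrees of both cofactors by \<open>K - e\<close>.\<close>
  have w: "w = 0 \<or> degree w < e" unfolding w_def using degree_mod_less[OF g(1)] g(2) by blast
  have q: "degree q \<le> K" unfolding q_def by (rule homog_mod_line(1)[OF F])
  have "degree (w * h) \<le> K"
    using w h K degree_mult_le[of w h] by (auto simp: e_def)
  then have "degree (y * g) \<le> K" using degree_diff_le[OF q, of "w * h"] qyw by simp
  then have y_deg: "degree y \<le> K - e"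
    using g by (cases "y = 0") (simp_all add: degree_mult_eq)
  have w_deg: "degree w \<le> K - e" using w K by (auto simp: e_def)
  define F' where "F' = lift_from_line (K - e) y * D s + lift_from_line (K - e) w * D s'"
  have "F' \<in> jacobian_ideal f" unfolding F'_def
    by (intro ideal.subspace_add ideal.subspace_scale ideal_jacobian D_jac)
  have "K - e + e = K" using K by (simp add: e_def)
  then have "F' \<in> homog K" unfolding F'_def
    by (intro homog_add homog_mult_eq[OF lift_from_line_homog D_homog])
  have "restrict_line t F' = q"
    unfolding F'_def qyw by (simp add: restrict_line_hom restrict_lift y_deg w_deg g_def h_def)
  then have "restrict_line t (F - F') = 0" by (simp add: restrict_line_hom q_def)
  then obtain G where "G \<in> homog (K - 1)" "F - F' = line_form t * G"
    using homog_mod_line(2)[OF homog_diff[OF F \<open>F' \<in> homog K\<close>], of t] by (auto simp: lift_from_line_def)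
  then have "F - line_form t * G = F'" by (simp add: algebra_simps)
  then show ?thesis using \<open>G \<in> homog (K - 1)\<close> \<open>F' \<in> jacobian_ideal f\<close> by auto
qed

lemma ex_line_avoiding:
  assumes "finite (sing_points f)"
  shows "\<exists>t. \<forall>P\<in>sing_points f. \<forall>p\<in>P. eval (($) p) (line_form t) \<noteq> 0"
proof -
  have "\<exists>p. p \<noteq> 0 \<and> P = pclass (*s) p" if "P \<in> sing_points f" for P
    using that by (auto simp: sing_points_def plane_def)
  then obtain r where r: "\<And>P. P \<in> sing_points f \<Longrightarrow> r P \<noteq> 0 \<and> P = pclass (*s) (r P)" by metis
  have "\<exists>j. v j \<noteq> 0" if "v \<in> (\<lambda>P. ($) (r P)) ` sing_points f" for v
    using that r by (auto simp: vec_eq_iff)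
  then obtain t where t: "\<forall>v\<in>(\<lambda>P. ($) (r P)) ` sing_points f. v 0 + t * v 1 + t\<^sup>2 * v 2 \<noteq> 0"
    using avoid_vectors[of "(\<lambda>P. ($) (r P)) ` sing_points f"] assms by blast
  have "eval (($) p) (line_form t) \<noteq> 0" if P: "P \<in> sing_points f" "p \<in> P" for P p
  proof -
    obtain c where c: "c \<noteq> 0" "p = c *s r P" using P r pclass_memE by metis
    have "eval (($) (r P)) (line_form t) \<noteq> 0" using t P(1) by (simp add: eval_line_form)
    then show ?thesis using c eval_scale_point[OF line_form_homog] by simp
  qed
  then show ?thesis by blast
qed

locale avoiding_line =
  fixes d :: nat and f :: ternary and t :: complex
  assumes f: "f \<in> homog d" and d: "d \<ge> 1"
    and avoids: "\<And>P p. P \<in> sing_points f \<Longrightarrow> p \<in> P \<Longrightarrow> eval (($) p) (line_form t) \<noteq> 0"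
begin

abbreviation "J \<equiv> jacobian_ideal f"
abbreviation "l \<equiv> line_form t"

lemma mult_line_form_onto: "2 * (d - 1) \<le> K \<Longrightarrow> F \<in> homog K \<Longrightarrow> \<exists>G\<in>homog (K - 1). F - l * G \<in> J"
  by (rule partials_generate_mod_line[OF f d]) (use avoids in auto)

text \<open>Multiplication by \<open>l\<close> maps a spanning set modulo the jacobian ideal to another one.\<close>

lemma milnor_dim_Suc_le:
  assumes "2 * (d - 1) \<le> Suc k" "milnor_dim k f \<le> enat m"
  shows "milnor_dim (Suc k) f \<le> enat m"
proof -
  obtain B where B: "finite B" "B \<subseteq> homog k" "card B \<le> m" "homog k \<subseteq> mp.span (B \<union> (homog k \<inter> J))"
    using assms(2) unfolding milnor_dim_le_iff by blast
  let ?S = "mp.span ((*) l ` B \<union> (homog (Suc k) \<inter> J))"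
  have lh: "l * G \<in> homog (Suc k)" if "G \<in> homog k" for G
    using homog_mult_eq[OF line_form_homog that] by simp
  have mult: "l * G \<in> ?S" if "G \<in> mp.span (B \<union> (homog k \<inter> J))" for G
    using that
  proof (induction rule: mp.span_induct_alt)
    case base
    then show ?case by (simp add: mp.span_zero)
  next
    case (step c x y)
    have "l * x \<in> (*) l ` B \<union> (homog (Suc k) \<inter> J)"
      using step(1) lh ideal.subspace_scale[OF ideal_jacobian, of x f l] by auto
    then have "smul c (l * x) + l * y \<in> ?S"
      using step(2) by (intro mp.span_add mp.span_scale) (auto intro: mp.span_base)
    then show ?case by (simp add: distrib_left smul_mult_right)
  qed
  have "F \<in> ?S" if F: "F \<in> homog (Suc k)" for F
  proof -
    obtain G where G: "G \<in> homog k" "F - l * G \<in> J"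
      using mult_line_form_onto[OF assms(1) F] by auto
    have "F - l * G \<in> homog (Suc k) \<inter> J" using G F lh homog_diff by blast
    then have "l * G + (F - l * G) \<in> ?S"
      using mult G(1) B(4) by (intro mp.span_add) (auto intro: mp.span_base)
    then show ?thesis by simp
  qed
  moreover have "card ((*) l ` B) \<le> m" using card_image_le[OF B(1)] B(3) order_trans by blast
  moreover have "(*) l ` B \<subseteq> homog (Suc k)" using lh B(2) by blast
  ultimately show ?thesis unfolding milnor_dim_le_iff using B(1) by (intro exI[of _ "(*) l ` B"]) blast
qed

lemma milnor_dim_antimono:
  assumes "2 * d \<le> k" "k \<le> k'" "milnor_dim k f \<le> enat m"
  shows "milnor_dim k' f \<le> enat m"
  using assms(2)
proof (induction k' rule: dec_induct)
  case base
  then show ?case by (rule assms(3))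
next
  case (step n)
  then show ?case using milnor_dim_Suc_le[of n m] assms(1) by simp
qed

text \<open>A nonincreasing sequence of natural numbers.\<close>

lemma milnor_dim_eventually_const:
  "\<exists>k\<^sub>1\<ge>2 * d. \<exists>n. \<forall>k\<ge>k\<^sub>1. milnor_dim k f = enat n"
proof -
  let ?P = "\<lambda>n. \<exists>k\<ge>2 * d. milnor_dim k f \<le> enat n"
  have "\<exists>n. ?P n" using milnor_dim_finite by blast
  then have "?P (LEAST n. ?P n)" by (rule LeastI_ex)
  then obtain k\<^sub>1 where k\<^sub>1: "k\<^sub>1 \<ge> 2 * d" "milnor_dim k\<^sub>1 f \<le> enat (LEAST n. ?P n)" by blast
  have "milnor_dim k f = enat (LEAST n. ?P n)" if "k \<ge> k\<^sub>1" for k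
  proof -
    have le: "milnor_dim k f \<le> enat (LEAST n. ?P n)"
      by (rule milnor_dim_antimono[OF k\<^sub>1(1) that k\<^sub>1(2)])
    then obtain m where m: "milnor_dim k f = enat m" using enat_ile by blast
    then have "?P m" using k\<^sub>1(1) \<open>k \<ge> k\<^sub>1\<close> by (intro exI[of _ k]) simp
    then have "(LEAST n. ?P n) \<le> m" by (rule Least_le)
    then show ?thesis using le m by simp
  qed
  then show ?thesis using k\<^sub>1(1) by blast
qed

text \<open>A linear map onto a space of the same finite dimension is injective: otherwise \<open>F\<close> and preimages of
  a maximal independent set would be too many independent elements.\<close>

lemma mult_line_form_inj:
  assumes "2 * d \<le> k" "milnor_dim k f = enat n" "milnor_dim (Suc k) f = enat n"
    and F: "F \<in> homog k" "l * F \<in> J"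
  shows "F \<in> J"
proof -
  have dim: "quot_dim smul (homog (Suc k)) (homog (Suc k) \<inter> J) = enat n"
    using assms(3) by (simp add: milnor_dim_def)
  obtain C where C: "finite C" "C \<subseteq> homog (Suc k)"
    "\<And>c. (\<Sum>b\<in>C. smul (c b) b) \<in> homog (Suc k) \<inter> J \<Longrightarrow> \<forall>b\<in>C. c b = 0"
    "enat n = enat (card C)"
    using mp.quot_dim_attained[of "homog (Suc k)" "homog (Suc k) \<inter> J" n] unfolding dim by blast
  have "2 * (d - 1) \<le> Suc k" using assms(1) by simp
  then have "\<exists>G\<in>homog k. b - l * G \<in> J" if "b \<in> C" for b
    using mult_line_form_onto[of "Suc k" b] C(2) that by auto
  then obtain G where G: "\<And>b. b \<in> C \<Longrightarrow> G b \<in> homog k \<and> b - l * G b \<in> J" by metis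
  let ?I = "insert None (Some ` C)"
  define v where "v i = (case i of None \<Rightarrow> F | Some b \<Rightarrow> G b)" for i
  have card: "n < card ?I" using C(1,4) by (simp add: card_image)
  have im: "v ` ?I \<subseteq> homog k" using F(1) G by (auto simp: v_def)
  have le: "quot_dim smul (homog k) (homog k \<inter> J) \<le> enat n"
    using assms(2) by (simp add: milnor_dim_def)
  have fin: "finite ?I" using C(1) by simp
  obtain x where x: "\<exists>i\<in>?I. x i \<noteq> 0" "(\<Sum>i\<in>?I. smul (x i) (v i)) \<in> homog k \<inter> J"
    by (rule mp.quot_dim_relation[OF subspace_jacobian_degree le fin im card])
  have sum: "(\<Sum>i\<in>?I. smul (x i) (v i)) = smul (x None) F + (\<Sum>b\<in>C. smul (x (Some b)) (G b))"
    using C(1) by (simp add: v_def sum.reindex)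
  have sub: "mp.subspace J" by (rule subspace_of_ideal[OF ideal_jacobian])
  have "l * (\<Sum>i\<in>?I. smul (x i) (v i)) \<in> J"
    using x(2) by (intro ideal.subspace_scale[OF ideal_jacobian]) simp
  moreover have "smul (x None) (l * F) \<in> J" using F(2) by (rule mp.subspace_scale[OF sub])
  moreover have "(\<Sum>b\<in>C. smul (x (Some b)) (b - l * G b)) \<in> J"
    using G by (intro mp.subspace_sum[OF sub] mp.subspace_scale[OF sub]) simp
  ultimately have "(l * (\<Sum>i\<in>?I. smul (x i) (v i)) - smul (x None) (l * F)) +
      (\<Sum>b\<in>C. smul (x (Some b)) (b - l * G b)) \<in> J"
    by (intro mp.subspace_add[OF sub] mp.subspace_diff[OF sub])
  also have "(l * (\<Sum>i\<in>?I. smul (x i) (v i)) - smul (x None) (l * F)) +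
      (\<Sum>b\<in>C. smul (x (Some b)) (b - l * G b)) = (\<Sum>b\<in>C. smul (x (Some b)) b)"
    unfolding sum by (simp add: distrib_left smul_mult_right sum_distrib_left
        mp.scale_right_diff_distrib sum_subtractf)
  finally have "(\<Sum>b\<in>C. smul (x (Some b)) b) \<in> homog (Suc k) \<inter> J"
    using C(2) by (auto intro!: homog_sum homog_smul)
  then have "\<forall>b\<in>C. x (Some b) = 0" using C(3)[of "\<lambda>b. x (Some b)"] by blast
  then have "x None \<noteq> 0" "smul (x None) F \<in> J" using x sum by auto
  from mp.subspace_scale[OF sub this(2), of "1 / x None"]
  have "smul (1 / x None) (smul (x None) F) \<in> J" .
  then show ?thesis using \<open>x None \<noteq> 0\<close> by simp
qed

lemma mult_line_form_power_inj:
  assumes "2 * d \<le> k\<^sub>1" "\<And>k. k \<ge> k\<^sub>1 \<Longrightarrow> milnor_dim k f = enat n" "k \<ge> k\<^sub>1"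
    and "F \<in> homog k" "l ^ m * F \<in> J"
  shows "F \<in> J"
  using assms(3-)
proof (induction m arbitrary: F k)
  case (Suc m)
  have "l * F \<in> homog (Suc k)" using homog_mult_eq[OF line_form_homog Suc.prems(2)] by simp
  moreover have "l ^ m * (l * F) \<in> J" using Suc.prems(3) by (simp add: mult_ac)
  ultimately have "l * F \<in> J" using Suc.IH[of "Suc k"] Suc.prems(1) by simp
  then show ?case using mult_line_form_inj[of k n F] assms(1,2) Suc.prems by simp
qed simp

end

section \<open>A Nullstellensatz\<close>

text \<open>The homogeneous polynomial \<open>l\<^sup>n p(x / l)\<close>.\<close>

definition homogenize :: "ternary \<Rightarrow> ternary \<Rightarrow> nat \<Rightarrow> complex poly \<Rightarrow> ternary" where
  "homogenize x l n p = (\<Sum>a\<le>n. smul (coeff p a) (x ^ a * l ^ (n - a)))"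

lemma homogenize_times_l:
  assumes "degree q \<le> n"
  shows "homogenize x l (Suc n) q = l * homogenize x l n q"
proof -
  have "homogenize x l (Suc n) q = (\<Sum>a\<le>n. smul (coeff q a) (x ^ a * l ^ (Suc n - a)))"
    using assms by (simp add: homogenize_def coeff_eq_0)
  also have "\<dots> = l * homogenize x l n q"
    unfolding homogenize_def sum_distrib_left
    by (intro sum.cong refl) (simp add: Suc_diff_le smul_mult_right mult_ac)
  finally show ?thesis .
qed

lemma homogenize_times_l_power:
  assumes "degree q \<le> n"
  shows "homogenize x l (n + m) q = l ^ m * homogenize x l n q"
  using assms by (induction m) (simp_all add: homogenize_times_l mult_ac)

lemma homogenize_linear_factor:
  assumes "degree q \<le> n"
  shows "homogenize x l (Suc n) ([:- \<alpha>, 1:] * q) = (x - smul \<alpha> l) * homogenize x l n q"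
proof -
  have shift: "homogenize x l (Suc n) (pCons 0 q) = x * homogenize x l n q"
    unfolding homogenize_def sum.atMost_Suc_shift sum_distrib_left
    by (simp add: smul_mult_right mult_ac)
  have "homogenize x l (Suc n) ([:- \<alpha>, 1:] * q) =
      homogenize x l (Suc n) (pCons 0 q) - smul \<alpha> (homogenize x l (Suc n) q)"
    by (simp add: homogenize_def mp.scale_sum_right mp.scale_left_diff_distrib sum_subtractf
        del: sum.atMost_Suc)
  then show ?thesis
    by (simp add: shift homogenize_times_l[OF assms] left_diff_distrib smul_mult_left)
qed

text \<open>Split off a root, \<open>p = (X - \<alpha>) q\<close>. If a power of \<open>l\<close> lies in the ideal extended by \<open>x - \<alpha> l\<close>, then
  multiplying this membership by the homogenization of \<open>q\<close> shows that the homogenization of \<open>q\<close>, in a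
  higher degree, lies in \<open>K\<close>; the degree of the polynomial has dropped.\<close>

lemma proper_extension:
  assumes K: "ideal.subspace K" "\<And>n. l ^ n \<notin> K" and "p \<noteq> 0" "degree p \<le> n" "homogenize x l n p \<in> K"
  shows "\<exists>\<alpha>. \<forall>m. l ^ m \<notin> ideal.span (insert (x - smul \<alpha> l) K)"
  using assms(3-)
proof (induction "degree p" arbitrary: p n)
  case 0
  then obtain c where c: "p = [:c:]" "c \<noteq> 0" by (metis degree_0_id pCons_0_0)
  have "homogenize x l (0 + n) p = l ^ n * homogenize x l 0 p"
    using 0 by (intro homogenize_times_l_power) simp
  then have "smul c (l ^ n) \<in> K" using 0 c by (simp add: homogenize_def smul_mult_right)
  from smul_in_ideal[OF K(1) this, of "1 / c"] have "l ^ n \<in> K" using c by simp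
  then show ?case using K(2) by blast
next
  case (Suc k)
  then obtain \<alpha> where "poly p \<alpha> = 0"
    using fundamental_theorem_of_algebra[of p] by (auto simp: constant_degree)
  then obtain q where q: "p = [:- \<alpha>, 1:] * q" unfolding poly_eq_0_iff_dvd by blast
  then have "q \<noteq> 0" using Suc.prems(1) by auto
  then have deg: "degree p = Suc (degree q)" unfolding q by (subst degree_mult_eq) auto
  then obtain n' where n': "n = Suc n'" "degree q \<le> n'" using Suc.prems(2) by (cases n) auto
  let ?y = "x - smul \<alpha> l"
  have yq: "?y * homogenize x l n' q \<in> K"
    using Suc.prems(3) unfolding q n'(1) homogenize_linear_factor[OF n'(2)] .
  show ?case
  proof (rule ccontr)
    assume not: "\<not> ?case"
    then obtain m where "l ^ m \<in> ideal.span (insert ?y K)" by blast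
    then obtain b where b: "l ^ m - b * ?y \<in> K"
      unfolding ideal.span_insert using K(1) by (auto simp: ideal.span_eq_iff[THEN iffD2])
    have "homogenize x l n' q * (l ^ m - b * ?y) + b * (?y * homogenize x l n' q) \<in> K"
      by (intro ideal.subspace_add ideal.subspace_scale K(1) b yq)
    also have "homogenize x l n' q * (l ^ m - b * ?y) + b * (?y * homogenize x l n' q) =
        homogenize x l (n' + m) q"
      unfolding homogenize_times_l_power[OF n'(2)] by (simp add: algebra_simps)
    finally have "\<exists>\<alpha>. \<forall>m. l ^ m \<notin> ideal.span (insert (x - smul \<alpha> l) K)"
      using Suc.hyps(1)[of q "n' + m"] Suc.hyps(2) deg \<open>q \<noteq> 0\<close> n'(2) by simp
    then show False using not by blast
  qed
qed

text \<open>An ideal that contains no power of \<open>l\<close> is enlarged by the equations \<open>x\<^sub>j = q\<^sub>j l\<close> of a point, one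
  after the other; then it contains \<open>G - G(q) l\<^sup>m\<close> for each form \<open>G\<close> of degree \<open>m\<close>.\<close>

lemma nullstellensatz:
  assumes K: "ideal.subspace K" "\<And>n. l ^ n \<notin> K" and l: "l \<in> homog 1"
    and rel: "\<And>j. \<exists>p n. p \<noteq> 0 \<and> degree p \<le> n \<and> homogenize (var j) l n p \<in> K"
  shows "\<exists>q :: complex^3. eval (($) q) l = 1 \<and> (\<forall>m. \<forall>G\<in>homog m \<inter> K. eval (($) q) G = 0)"
proof -
  have step: "\<exists>\<alpha>. \<forall>m. l ^ m \<notin> ideal.span (insert (var j - smul \<alpha> l) K')"
    if "ideal.subspace K'" "\<And>n. l ^ n \<notin> K'" "K \<subseteq> K'" for K' j
    using proper_extension[OF that(1,2)] rel[of j] that(3) by blast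
  obtain \<alpha> where \<alpha>: "\<And>m. l ^ m \<notin> ideal.span (insert (var 0 - smul \<alpha> l) K)"
    using step[OF K] by blast
  let ?K1 = "ideal.span (insert (var 0 - smul \<alpha> l) K)"
  have K1: "insert (var 0 - smul \<alpha> l) K \<subseteq> ?K1" by (rule ideal.span_superset)
  then obtain \<beta> where \<beta>: "\<And>m. l ^ m \<notin> ideal.span (insert (var 1 - smul \<beta> l) ?K1)"
    using step[OF ideal.subspace_span \<alpha>, of 1] by blast
  let ?K2 = "ideal.span (insert (var 1 - smul \<beta> l) ?K1)"
  have K2: "insert (var 1 - smul \<beta> l) ?K1 \<subseteq> ?K2" by (rule ideal.span_superset)
  then obtain \<gamma> where \<gamma>: "\<And>m. l ^ m \<notin> ideal.span (insert (var 2 - smul \<gamma> l) ?K2)"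
    using step[OF ideal.subspace_span \<beta>, of 2] K1 by blast
  define K3 where "K3 = ideal.span (insert (var 2 - smul \<gamma> l) ?K2)"
  have K3: "insert (var 2 - smul \<gamma> l) ?K2 \<subseteq> K3" unfolding K3_def by (rule ideal.span_superset)
  have sub: "ideal.subspace K3" by (simp add: K3_def ideal.subspace_span)
  have proper: "l ^ m \<notin> K3" for m using \<gamma> by (simp add: K3_def)
  define q :: "complex^3" where "q = (\<chi> j. if j = 0 then \<alpha> else if j = 1 then \<beta> else \<gamma>)"
  have var: "var j - smul (q $ j) l \<in> K3" for j
    using K1 K2 K3 exhaust_3_from[of j 0] by (auto simp: q_def)
  have cong: "G - smul (eval (($) q) G) (l ^ m) \<in> K3" if "G \<in> homog m" for G m
    using that
  proof (induction rule: homog_induct)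
    case (const c)
    have eq: "single 0 c - smul (eval (($) q) (single 0 c)) (l ^ 0) = 0" by (simp add: smul_def)
    show ?case unfolding eq by (rule ideal.subspace_0[OF sub])
  next
    case (step m g)
    have "(\<Sum>j\<in>UNIV. var j * (g j - smul (eval (($) q) (g j)) (l ^ m)) +
        smul (eval (($) q) (g j)) (l ^ m * (var j - smul (q $ j) l))) \<in> K3"
      by (intro ideal.subspace_sum ideal.subspace_add ideal.subspace_scale smul_in_ideal sub step var)
    also have "(\<Sum>j\<in>UNIV. var j * (g j - smul (eval (($) q) (g j)) (l ^ m)) +
        smul (eval (($) q) (g j)) (l ^ m * (var j - smul (q $ j) l))) =
        (\<Sum>j\<in>UNIV. var j * g j) - smul (eval (($) q) (\<Sum>j\<in>UNIV. var j * g j)) (l ^ Suc m)"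
    proof -
      have "var j * (g j - smul (eval (($) q) (g j)) (l ^ m)) +
          smul (eval (($) q) (g j)) (l ^ m * (var j - smul (q $ j) l)) =
          var j * g j - smul (q $ j * eval (($) q) (g j)) (l ^ Suc m)" for j
        by (simp add: right_diff_distrib smul_mult_right mp.scale_right_diff_distrib mult_ac)
      then show ?thesis by (simp add: ev.subst_hom sum_subtractf mp.scale_sum_left del: power_Suc)
    qed
    finally show ?case .
  qed
  have zero: "c = 0" if "smul c (l ^ m) \<in> K3" for c m
  proof (rule ccontr)
    assume "c \<noteq> 0"
    with smul_in_ideal[OF sub that, of "1 / c"] proper show False by simp
  qed
  have "smul (1 - eval (($) q) l) (l ^ 1) \<in> K3"
    using cong[OF l] by (simp add: mp.scale_left_diff_distrib)
  then have "eval (($) q) l = 1" using zero by fastforce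
  moreover have "eval (($) q) G = 0" if G: "G \<in> homog m \<inter> K" for G m
  proof -
    have "G \<in> K3" using G K1 K2 K3 by blast
    from ideal.subspace_diff[OF sub this cong[of G m]] G
    have "smul (eval (($) q) G) (l ^ m) \<in> K3" by simp
    then show ?thesis by (rule zero)
  qed
  ultimately show ?thesis by blast
qed

context avoiding_line
begin

text \<open>The graded pieces of the Milnor algebra have bounded dimension, so in high degree the products
  of powers of two linear forms are dependent in it.\<close>

lemma binary_relation:
  assumes "\<theta> \<in> homog 1"
  shows "\<exists>p n. p \<noteq> 0 \<and> degree p \<le> n \<and> homogenize \<theta> l n p \<in> J"
proof -
  obtain k\<^sub>1 n where k\<^sub>1: "\<And>k. k \<ge> k\<^sub>1 \<Longrightarrow> milnor_dim k f = enat n"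
    using milnor_dim_eventually_const by blast
  \<comment> \<open>In this degree there are \<open>k + 1 > n\<close> products.\<close>
  define k where "k = max k\<^sub>1 n"
  have im: "(\<lambda>a. \<theta> ^ a * l ^ (k - a)) ` {..k} \<subseteq> homog k"
  proof clarify
    fix a assume "a \<le> k"
    then show "\<theta> ^ a * l ^ (k - a) \<in> homog k"
      by (intro homog_mult_eq[OF homog_power1[OF assms] homog_power1[OF line_form_homog]]) simp
  qed
  have le: "quot_dim smul (homog k) (homog k \<inter> J) \<le> enat n"
    using k\<^sub>1[of k] by (simp add: k_def milnor_dim_def)
  have "n < card {..k}" by (simp add: k_def)
  then obtain x where x: "\<exists>a\<in>{..k}. x a \<noteq> 0"
      "(\<Sum>a\<in>{..k}. smul (x a) (\<theta> ^ a * l ^ (k - a))) \<in> homog k \<inter> J"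
    by (rule mp.quot_dim_relation[OF subspace_jacobian_degree le finite_atMost im])
  define p where "p = (\<Sum>a\<le>k. monom (x a) a)"
  have p: "coeff p a = (if a \<le> k then x a else 0)" for a
    by (simp add: p_def coeff_sum)
  have "homogenize \<theta> l k p = (\<Sum>a\<in>{..k}. smul (x a) (\<theta> ^ a * l ^ (k - a)))"
    unfolding homogenize_def by (intro sum.cong) (auto simp: p)
  moreover have "p \<noteq> 0" using x(1) p by (metis atMost_iff coeff_0)
  moreover have "degree p \<le> k" by (rule degree_le) (simp add: p)
  ultimately show ?thesis using x(2) by (intro exI[of _ p] exI[of _ k]) simp
qed

text \<open>Split off the lowest power of \<open>\<theta>\<close> in a binary relation: the other factor does not vanish at the
  point. So \<open>\<theta>\<close> becomes nilpotent in the localisation of the Milnor algebra at the point.\<close>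

lemma locally_nilpotent:
  assumes \<theta>: "\<theta> \<in> homog 1" "eval x \<theta> = 0" and l: "eval x l \<noteq> 0"
  shows "\<exists>a m w. w \<in> homog m \<and> eval x w \<noteq> 0 \<and> \<theta> ^ a * w \<in> J"
proof -
  obtain p n where p: "p \<noteq> 0" "degree p \<le> n" "homogenize \<theta> l n p \<in> J"
    using binary_relation[OF \<theta>(1)] by blast
  define a where "a = (LEAST a. coeff p a \<noteq> 0)"
  have "coeff p (degree p) \<noteq> 0" using p(1) by simp
  then have a: "coeff p a \<noteq> 0" and a_least: "\<And>b. b < a \<Longrightarrow> coeff p b = 0"
    unfolding a_def by (rule LeastI, use not_less_Least in blast)
  have "a \<le> n" using le_degree[OF a] p(2) by simp
  define w where "w = (\<Sum>b\<in>{a..n}. smul (coeff p b) (\<theta> ^ (b - a) * l ^ (n - b)))"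
  have "homogenize \<theta> l n p = (\<Sum>b\<in>{a..n}. smul (coeff p b) (\<theta> ^ b * l ^ (n - b)))"
    unfolding homogenize_def using a_least by (intro sum.mono_neutral_right) (auto simp: not_le)
  also have "\<dots> = \<theta> ^ a * w" unfolding w_def sum_distrib_left
    by (intro sum.cong refl) (simp add: smul_mult_right mult.assoc[symmetric] flip: power_add)
  finally have "\<theta> ^ a * w \<in> J" using p(3) by simp
  moreover have "w \<in> homog (n - a)" unfolding w_def
  proof (intro homog_sum homog_smul)
    fix b assume "b \<in> {a..n}"
    then show "\<theta> ^ (b - a) * l ^ (n - b) \<in> homog (n - a)"
      by (intro homog_mult_eq[OF homog_power1[OF \<theta>(1)] homog_power1[OF line_form_homog]]) simp
  qed
  moreover have "eval x w = coeff p a * eval x l ^ (n - a)"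
  proof -
    have "eval x w = (\<Sum>b\<in>{a..n}. if b = a then coeff p b * eval x l ^ (n - b) else 0)"
      unfolding w_def ev.subst_hom by (intro sum.cong refl) (auto simp: \<theta>(2) power_0_left)
    then show ?thesis using \<open>a \<le> n\<close> by simp
  qed
  ultimately show ?thesis using a l by (metis no_zero_divisors power_not_zero)
qed

end

section \<open>Power series in two variables\<close>

text \<open>The coefficient of \<open>u\<^sup>a v\<^sup>b\<close>; the coefficients of the outer series are series in \<open>u\<close>.\<close>

definition coeff2 :: "complex fps fps \<Rightarrow> nat \<Rightarrow> nat \<Rightarrow> complex" where
  "coeff2 h a b = fps_nth (fps_nth h b) a"

abbreviation U :: "complex fps fps" where "U \<equiv> fps_const fps_X"
abbreviation V :: "complex fps fps" where "V \<equiv> fps_X"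

text \<open>Powers of \<open>U\<close> are kept as such, so that monomials in \<open>U\<close> and \<open>V\<close> have a single form.\<close>

declare fps_const_power [simp del]

text \<open>The \<open>N\<close>-th power of the maximal ideal \<open>(u, v)\<close>.\<close>

definition order_ge :: "nat \<Rightarrow> complex fps fps set" where
  "order_ge N = {h. \<forall>a b. a + b < N \<longrightarrow> coeff2 h a b = 0}"

interpretation fps2: coeff_hom fps2_const
  by unfold_locales (simp_all add: fps2_const_def)

interpretation fp: complex_vector_space "\<lambda>c h. fps2_const c * h"
  by unfold_locales (simp_all add: fps2.hom_add fps2.hom_mult fps2.hom_one algebra_simps)

lemma subspace_of_local_ideal: "ideal.subspace K \<Longrightarrow> fp.subspace K"
  unfolding fp.subspace_def by (auto simp: ideal.subspace_0 ideal.subspace_add ideal.subspace_scale)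

lemma coeff2_add: "coeff2 (g + h) a b = coeff2 g a b + coeff2 h a b"
  by (simp add: coeff2_def)

lemma coeff2_diff: "coeff2 (g - h) a b = coeff2 g a b - coeff2 h a b"
  by (simp add: coeff2_def)

lemma coeff2_sum: "coeff2 (sum g A) a b = (\<Sum>i\<in>A. coeff2 (g i) a b)"
  by (simp add: coeff2_def fps_sum_nth)

lemma coeff2_mult: "coeff2 (g * h) a b = (\<Sum>j\<le>b. \<Sum>i\<le>a. coeff2 g i j * coeff2 h (a - i) (b - j))"
  by (simp add: coeff2_def fps_mult_nth fps_sum_nth atLeast0AtMost)

lemma coeff2_monomial:
  "coeff2 (fps2_const c * (U ^ i * V ^ j)) a b = (if a = i \<and> b = j then c else 0)"
proof -
  have eq: "fps2_const c * (U ^ i * V ^ j) = fps_const (fps_const c * fps_X ^ i) * fps_X ^ j"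
    unfolding fps2_const_def fps_const_power by (simp add: mult.assoc[symmetric])
  show ?thesis unfolding coeff2_def eq by simp
qed

lemma order_ge_mult: "g \<in> order_ge M \<Longrightarrow> h \<in> order_ge N \<Longrightarrow> g * h \<in> order_ge (M + N)"
proof -
  assume gh: "g \<in> order_ge M" "h \<in> order_ge N"
  have zero: "coeff2 g i j * coeff2 h (a - i) (b - j) = 0" if "a + b < M + N" "i \<le> a" "j \<le> b" for a b i j
  proof (cases "i + j < M")
    case False
    then have "(a - i) + (b - j) < N" using that by simp
    then show ?thesis using gh(2) by (simp add: order_ge_def)
  qed (use gh(1) in \<open>simp add: order_ge_def\<close>)
  show "g * h \<in> order_ge (M + N)" unfolding order_ge_def mem_Collect_eq coeff2_mult
    by (intro allI impI sum.neutral ballI) (rule zero, auto)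
qed

lemma order_ge_0 [simp]: "h \<in> order_ge 0"
  by (simp add: order_ge_def)

lemma ideal_order_ge: "ideal.subspace (order_ge N)"
  unfolding ideal.subspace_def
  using order_ge_mult[OF order_ge_0, of _ N] by (auto simp: order_ge_def coeff2_add, simp add: coeff2_def)

lemma order_ge_antimono: "M \<le> N \<Longrightarrow> order_ge N \<subseteq> order_ge M"
  by (auto simp: order_ge_def)

lemma order_ge_power: "h \<in> order_ge 1 \<Longrightarrow> h ^ n \<in> order_ge n"
proof (induction n)
  case (Suc n)
  then show ?case using order_ge_mult[of h 1 "h ^ n" n] by simp
qed simp

lemma fps2_unit:
  assumes "coeff2 h 0 0 \<noteq> 0"
  shows "\<exists>h'. h * h' = 1"
proof -
  have "fps_nth h 0 * inverse (fps_nth h 0) = 1"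
    using assms by (simp add: coeff2_def inverse_mult_eq_1')
  then have "h * fps_right_inverse h (inverse (fps_nth h 0)) = 1" by (rule fps_right_inverse)
  then show ?thesis by blast
qed

text \<open>Modulo \<open>V ^ B\<close> the series is a polynomial in \<open>v\<close> of degree less than \<open>B\<close>, whose coefficients are divisible
  by \<open>u\<^sup>A\<close>.\<close>

lemma order_ge_in_ideal:
  assumes K: "ideal.subspace K" "U ^ A \<in> K" "V ^ B \<in> K"
  shows "order_ge (A + B) \<subseteq> K"
proof
  fix h assume h: "h \<in> order_ge (A + B)"
  have "h = (\<Sum>b<B. fps_const (fps_nth h b) * V ^ b) + fps_shift B h * V ^ B"
  proof (rule fps_ext)
    fix n
    have "fps_nth (\<Sum>b<B. fps_const (fps_nth h b) * V ^ b) n =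
        (\<Sum>b<B. if b = n then fps_nth h b else 0)"
      unfolding fps_sum_nth by (intro sum.cong refl) (simp add: fps_X_power_nth)
    then show "fps_nth h n =
        fps_nth ((\<Sum>b<B. fps_const (fps_nth h b) * V ^ b) + fps_shift B h * V ^ B) n"
      by (simp add: fps_X_power_mult_right_nth)
  qed
  also have "(\<Sum>b<B. fps_const (fps_nth h b) * V ^ b) =
      (\<Sum>b<B. (fps_const (fps_shift A (fps_nth h b)) * V ^ b) * U ^ A)"
  proof (intro sum.cong refl)
    fix b assume "b \<in> {..<B}"
    then have "fps_nth h b = fps_shift A (fps_nth h b) * fps_X ^ A"
      using h by (intro fps_ext) (auto simp: fps_X_power_mult_right_nth order_ge_def coeff2_def)
    then have "fps_const (fps_nth h b) = fps_const (fps_shift A (fps_nth h b)) * U ^ A"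
      by (metis fps_const_mult fps_const_power)
    then show "fps_const (fps_nth h b) * V ^ b = (fps_const (fps_shift A (fps_nth h b)) * V ^ b) * U ^ A"
      by (simp add: mult_ac)
  qed
  finally have h_eq: "h = (\<Sum>b<B. (fps_const (fps_shift A (fps_nth h b)) * V ^ b) * U ^ A) +
      fps_shift B h * V ^ B" .
  show "h \<in> K" by (subst h_eq) (intro ideal.subspace_add ideal.subspace_sum ideal.subspace_scale K)
qed

definition truncate2 :: "nat \<Rightarrow> complex fps fps \<Rightarrow> complex fps fps" where
  "truncate2 N h = (\<Sum>a<N. \<Sum>b<N. fps2_const (coeff2 h a b) * (U ^ a * V ^ b))"

lemma truncate2_order: "h - truncate2 N h \<in> order_ge N"
proof -
  have "coeff2 (truncate2 N h) a b = coeff2 h a b" if "a + b < N" for a b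
  proof -
    have "coeff2 (truncate2 N h) a b =
        (\<Sum>i<N. \<Sum>j<N. if a = i \<and> b = j then coeff2 h i j else 0)"
      by (simp add: truncate2_def coeff2_sum coeff2_monomial)
    also have "\<dots> = (\<Sum>i<N. if a = i then (\<Sum>j<N. if b = j then coeff2 h i j else 0) else 0)"
      by (intro sum.cong refl) auto
    also have "\<dots> = coeff2 h a b" using that by simp
    finally show ?thesis .
  qed
  then show ?thesis by (simp add: order_ge_def coeff2_diff)
qed

subsection \<open>Partial derivatives of power series\<close>

lemma fps_deriv_u_add: "fps_deriv_u (g + h) = fps_deriv_u g + fps_deriv_u h"
  by (rule fps_ext) (simp add: fps_deriv_u_def)

lemma fps_deriv_u_mult: "fps_deriv_u (g * h) = g * fps_deriv_u h + fps_deriv_u g * h"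
  by (rule fps_ext) (simp add: fps_deriv_u_def fps_mult_nth fps_deriv_sum sum.distrib)

lemma fps_deriv_v_add: "fps_deriv_v (g + h) = fps_deriv_v g + fps_deriv_v h"
  by (simp add: fps_deriv_v_def)

lemma fps_deriv_v_mult: "fps_deriv_v (g * h) = g * fps_deriv_v h + fps_deriv_v g * h"
  by (simp add: fps_deriv_v_def)

lemma fps_deriv_const2 [simp]: "fps_deriv_u (fps2_const c) = 0" "fps_deriv_v (fps2_const c) = 0"
  by (rule fps_ext, simp_all add: fps_deriv_u_def fps_deriv_v_def fps2_const_def)

lemma fps_deriv_UV [simp]: "fps_deriv_u U = 1" "fps_deriv_u V = 0" "fps_deriv_v U = 0" "fps_deriv_v V = 1"
  by (auto simp: fps_deriv_u_def fps_deriv_v_def fps_eq_iff)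

section \<open>Local equations\<close>

lemma local_eq_hom:
  "local_eq (F + G) i p = local_eq F i p + local_eq G i p"
  "local_eq (F - G) i p = local_eq F i p - local_eq G i p"
  "local_eq (F * G) i p = local_eq F i p * local_eq G i p"
  "local_eq (smul c F) i p = fps2_const c * local_eq F i p"
  "local_eq (sum g A) i p = (\<Sum>a\<in>A. local_eq (g a) i p)"
  "local_eq (prod g A) i p = (\<Prod>a\<in>A. local_eq (g a) i p)"
  "local_eq (F ^ n) i p = local_eq F i p ^ n"
  by (simp_all add: local_eq_def fps2.subst_hom)

lemma local_eq_const [simp]: "local_eq (single 0 c) i p = fps2_const c"
  by (simp add: local_eq_def)

lemma local_eq_var: "local_eq (var j) i p =
    fps2_const (p $ j) + (if j = i + 1 then U else if j = i + 2 then V else 0)"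
  by (simp add: local_eq_def)

lemma coeff2_local_eq_0: "coeff2 (local_eq F i p) 0 0 = eval (($) p) F"
proof -
  have "coeff2 (local_eq F i p) 0 0 = subst (\<lambda>c. coeff2 (fps2_const c) 0 0)
      (\<lambda>j. coeff2 (fps2_const (p $ j) + (if j = i + 1 then U else if j = i + 2 then V else 0)) 0 0) F"
    unfolding local_eq_def by (rule hom_subst) (simp_all add: coeff2_def)
  also have "(\<lambda>j. coeff2 (fps2_const (p $ j) +
      (if j = i + 1 then U else if j = i + 2 then V else 0)) 0 0) = ($) p"
    by (auto simp: coeff2_def fps2_const_def)
  finally show ?thesis by (simp add: coeff2_def fps2_const_def)
qed

lemma fps_deriv_local_eq:
  assumes "F \<in> homog m"
  shows "fps_deriv_u (local_eq F i p) = local_eq (pd (i + 1) F) i p"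
    and "fps_deriv_v (local_eq F i p) = local_eq (pd (i + 2) F) i p"
proof -
  have zero: "local_eq 0 i p = 0" by (simp add: local_eq_def)
  have deriv_zero: "fps_deriv_u 0 = 0" "fps_deriv_v 0 = 0"
    using fps_deriv_const2[of 0] by (simp_all add: fps2.hom_zero)
  have u_sum: "fps_deriv_u (sum g A) = (\<Sum>a\<in>A. fps_deriv_u (g a))" for g :: "'b \<Rightarrow> _" and A
    by (induction A rule: infinite_finite_induct) (simp_all add: fps_deriv_u_add deriv_zero)
  have v_sum: "fps_deriv_v (sum g A) = (\<Sum>a\<in>A. fps_deriv_v (g a))" for g :: "'b \<Rightarrow> _" and A
    by (induction A rule: infinite_finite_induct) (simp_all add: fps_deriv_v_add deriv_zero)
  have u_var: "fps_deriv_u (local_eq (var j) i p) = (if i + 1 = j then 1 else 0)" for j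
    by (auto simp: local_eq_var fps_deriv_u_add deriv_zero)
  have v_var: "fps_deriv_v (local_eq (var j) i p) = (if i + 2 = j then 1 else 0)" for j
    by (auto simp: local_eq_var fps_deriv_v_add deriv_zero)
  show "fps_deriv_u (local_eq F i p) = local_eq (pd (i + 1) F) i p" using assms
  proof (induction rule: homog_induct)
    case (step m g)
    then show ?case
      by (auto simp: pd_sum pd_var_mult local_eq_hom u_sum fps_deriv_u_mult u_var zero intro!: sum.cong)
  qed (simp add: zero)
  show "fps_deriv_v (local_eq F i p) = local_eq (pd (i + 2) F) i p" using assms
  proof (induction rule: homog_induct)
    case (step m g)
    then show ?case
      by (auto simp: pd_sum pd_var_mult local_eq_hom v_sum fps_deriv_v_mult v_var zero intro!: sum.cong)
  qed (simp add: zero)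
qed

text \<open>Linear forms that restrict to the local coordinates.\<close>

definition u_form :: "3 \<Rightarrow> complex^3 \<Rightarrow> ternary" where
  "u_form i p = var (i + 1) - smul (p $ (i + 1)) (var i)"

definition v_form :: "3 \<Rightarrow> complex^3 \<Rightarrow> ternary" where
  "v_form i p = var (i + 2) - smul (p $ (i + 2)) (var i)"

lemma coordinate_forms_homog: "u_form i p \<in> homog 1" "v_form i p \<in> homog 1"
  unfolding u_form_def v_form_def by (intro homog_diff homog_smul homog_var)+

lemma local_eq_coordinates:
  fixes p :: "complex^3"
  assumes "p $ i = 1"
  shows "local_eq (var i) i p = 1" "local_eq (u_form i p) i p = U" "local_eq (v_form i p) i p = V"
  using assms by (simp_all add: u_form_def v_form_def local_eq_hom local_eq_var fps2.hom_one)

lemma eval_coordinate_forms: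
  fixes p :: "complex^3"
  assumes "p $ i = 1"
  shows "eval (($) p) (u_form i p) = 0" "eval (($) p) (v_form i p) = 0"
  using assms by (simp_all add: u_form_def v_form_def ev.subst_hom)

text \<open>In the chart \<open>x\<^sub>i = 1\<close> the forms \<open>u_form\<close>, \<open>v_form\<close> and \<open>x\<^sub>i\<close> become \<open>u\<close>, \<open>v\<close> and 1, so a truncated
  series is homogenized by powers of \<open>x\<^sub>i\<close>.\<close>

lemma ex_form_with_jet:
  fixes p :: "complex^3"
  assumes "p $ i = 1" "2 * N \<le> n"
  shows "\<exists>F\<in>homog n. local_eq F i p - h \<in> order_ge N"
proof -
  define F where "F = (\<Sum>a<N. \<Sum>b<N. smul (coeff2 h a b)
      (u_form i p ^ a * v_form i p ^ b * var i ^ (n - a - b)))"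
  have "F \<in> homog n" unfolding F_def
  proof (intro homog_sum homog_smul)
    fix a b assume "a \<in> {..<N}" "b \<in> {..<N}"
    then have "a + b + (n - a - b) = n" using assms(2) by simp
    then show "u_form i p ^ a * v_form i p ^ b * var i ^ (n - a - b) \<in> homog n"
      by (intro homog_mult_eq[OF homog_mult[OF homog_power1 homog_power1] homog_power1[OF homog_var]]
          coordinate_forms_homog)
  qed
  moreover have "local_eq F i p = truncate2 N h"
    by (simp add: F_def truncate2_def local_eq_hom local_eq_coordinates[OF assms(1)])
  ultimately show ?thesis
    using ideal.subspace_neg[OF ideal_order_ge truncate2_order, of h N] by (intro bexI[of _ F]) simp_all
qed

text \<open>A form that vanishes to high order at the point is a combination of monomials of high order in
  the local coordinates, and these are killed by \<open>w\<^sub>1 w\<^sub>2\<close>.\<close>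

lemma high_order_in_ideal:
  fixes p :: "complex^3"
  assumes p: "p $ i = 1" and F: "F \<in> homog n" "local_eq F i p \<in> order_ge (A + B)"
    and K: "ideal.subspace K" "u_form i p ^ A * w\<^sub>1 \<in> K" "v_form i p ^ B * w\<^sub>2 \<in> K"
  shows "w\<^sub>1 * w\<^sub>2 * F \<in> K"
proof -
  let ?S = "mp.span {u_form i p, v_form i p, var i}"
  have "var (i + 1) = u_form i p + smul (p $ (i + 1)) (var i)"
    "var (i + 2) = v_form i p + smul (p $ (i + 2)) (var i)"
    by (simp_all add: u_form_def v_form_def)
  moreover have "u_form i p + smul (p $ (i + 1)) (var i) \<in> ?S"
    "v_form i p + smul (p $ (i + 2)) (var i) \<in> ?S" "var i \<in> ?S"
    by (intro mp.span_add mp.span_scale mp.span_base; simp)+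
  ultimately have "var j \<in> ?S" for j using exhaust_3_from[of j i] by auto
  then obtain h where h: "F = (\<Sum>(a, b)\<in>{(a, b). a + b \<le> n}.
      smul (h a b) (u_form i p ^ a * v_form i p ^ b * var i ^ (n - a - b)))"
    using homog_expand[OF coordinate_forms_homog(1)[of i p] coordinate_forms_homog(2)[of i p]
        homog_var[of i] _ F(1)] by blast
  have "local_eq F i p = (\<Sum>(a, b)\<in>{(a, b). a + b \<le> n}. fps2_const (h a b) * (U ^ a * V ^ b))"
    unfolding h by (simp add: local_eq_hom case_prod_unfold local_eq_coordinates[OF p])
  then have coeff: "coeff2 (local_eq F i p) a b =
      (\<Sum>q\<in>{(a, b). a + b \<le> n}. if q = (a, b) then h a b else 0)" for a b
    by (auto simp: coeff2_sum coeff2_monomial case_prod_unfold intro!: sum.cong)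
  have "h a b = 0" if "a + b \<le> n" "a + b < A + B" for a b
    using coeff[of a b] F(2) that finite_exponents[of n] by (simp add: order_ge_def)
  moreover have "w\<^sub>1 * w\<^sub>2 * (u_form i p ^ a * v_form i p ^ b * var i ^ c) \<in> K" if "A + B \<le> a + b" for a b c
  proof (cases "A \<le> a")
    case True
    then have "u_form i p ^ a = u_form i p ^ (a - A) * u_form i p ^ A" by (simp flip: power_add)
    then have eq: "w\<^sub>1 * w\<^sub>2 * (u_form i p ^ a * v_form i p ^ b * var i ^ c) =
        (w\<^sub>2 * u_form i p ^ (a - A) * v_form i p ^ b * var i ^ c) * (u_form i p ^ A * w\<^sub>1)"
      by (simp add: mult_ac)
    show ?thesis unfolding eq by (rule ideal.subspace_scale[OF K(1,2)])
  next
    case False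
    then have "v_form i p ^ b = v_form i p ^ (b - B) * v_form i p ^ B"
      using that by (simp flip: power_add)
    then have eq: "w\<^sub>1 * w\<^sub>2 * (u_form i p ^ a * v_form i p ^ b * var i ^ c) =
        (w\<^sub>1 * u_form i p ^ a * v_form i p ^ (b - B) * var i ^ c) * (v_form i p ^ B * w\<^sub>2)"
      by (simp add: mult_ac)
    show ?thesis unfolding eq by (rule ideal.subspace_scale[OF K(1,3)])
  qed
  ultimately have "smul (h a b) (w\<^sub>1 * w\<^sub>2 * (u_form i p ^ a * v_form i p ^ b * var i ^ (n - a - b))) \<in> K"
    if "a + b \<le> n" for a b
    using that by (cases "a + b < A + B") (auto simp: ideal.subspace_0[OF K(1)] smul_in_ideal[OF K(1)])
  then have "(\<Sum>(a, b)\<in>{(a, b). a + b \<le> n}.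
      smul (h a b) (w\<^sub>1 * w\<^sub>2 * (u_form i p ^ a * v_form i p ^ b * var i ^ (n - a - b)))) \<in> K"
    by (intro ideal.subspace_sum[OF K(1)]) auto
  then show ?thesis unfolding h by (simp add: sum_distrib_left smul_mult_right case_prod_unfold)
qed

definition local_ideal :: "ternary \<Rightarrow> 3 \<Rightarrow> complex^3 \<Rightarrow> complex fps fps set" where
  "local_ideal f i p =
    ideal.span {local_eq f i p, fps_deriv_u (local_eq f i p), fps_deriv_v (local_eq f i p)}"

lemma ideal_local_ideal: "ideal.subspace (local_ideal f i p)"
  by (simp add: local_ideal_def ideal.subspace_span)

text \<open>By Euler's formula the local Tjurina ideal is the extension of the jacobian ideal.\<close>

lemma local_ideal_eq:
  fixes p :: "complex^3"
  assumes f: "f \<in> homog d" "d \<ge> 1" and p: "p $ i = 1"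
  shows "local_ideal f i p = ideal.span (range (\<lambda>j. local_eq (pd j f) i p))"
proof (rule antisym)
  let ?R = "ideal.span (range (\<lambda>j. local_eq (pd j f) i p))"
  have base: "local_eq (pd j f) i p \<in> ?R" for j by (intro ideal.span_base) simp
  obtain a where a: "f = (\<Sum>j\<in>UNIV. a j * pd j f)"
    using in_jacobian_ideal_euler[OF f] by (rule jacobian_idealE)
  have "local_eq (\<Sum>j\<in>UNIV. a j * pd j f) i p \<in> ?R"
    unfolding local_eq_hom by (intro ideal.span_sum ideal.span_scale base)
  then show "local_ideal f i p \<subseteq> ?R"
    unfolding local_ideal_def fps_deriv_local_eq[OF f(1)] a[symmetric]
    by (intro ideal.span_minimal ideal.subspace_span) (simp add: base)
  have u: "local_eq (pd (i + 1) f) i p \<in> local_ideal f i p"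
    and v: "local_eq (pd (i + 2) f) i p \<in> local_ideal f i p"
    and g: "local_eq f i p \<in> local_ideal f i p"
    unfolding local_ideal_def fps_deriv_local_eq[OF f(1)] by (intro ideal.span_base; simp)+
  have "local_eq (smul (of_nat d) f) i p = (\<Sum>j\<in>UNIV. local_eq (var j) i p * local_eq (pd j f) i p)"
    unfolding euler_formula[OF f(1), symmetric] local_eq_hom ..
  then have "local_eq (pd i f) i p = fps2_const (of_nat d) * local_eq f i p -
      local_eq (var (i + 1)) i p * local_eq (pd (i + 1) f) i p -
      local_eq (var (i + 2)) i p * local_eq (pd (i + 2) f) i p"
    by (simp add: sum_UNIV_3_from[of _ i] local_eq_hom(4) local_eq_coordinates(1)[OF p] algebra_simps)
  also have "\<dots> \<in> local_ideal f i p"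
    by (intro ideal.subspace_diff ideal.subspace_scale ideal_local_ideal u v g)
  finally have "local_eq (pd j f) i p \<in> local_ideal f i p" for j
    using u v exhaust_3_from[of j i] by auto
  then show "?R \<subseteq> local_ideal f i p" by (intro ideal.span_minimal ideal_local_ideal) auto
qed

context avoiding_line
begin

lemma jacobian_in_local_ideal:
  fixes p :: "complex^3"
  assumes "p $ i = 1" "F \<in> J"
  shows "local_eq F i p \<in> local_ideal f i p"
proof -
  obtain a where F: "F = (\<Sum>j\<in>UNIV. a j * pd j f)" using assms(2) by (rule jacobian_idealE)
  show ?thesis unfolding local_ideal_eq[OF f d assms(1)] F local_eq_hom
    by (intro ideal.span_sum ideal.span_scale ideal.span_base) auto
qed

lemma order_ge_in_local_ideal:
  fixes p :: "complex^3"
  assumes p: "p $ i = 1" "eval (($) p) l \<noteq> 0"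
  shows "\<exists>N. order_ge N \<subseteq> local_ideal f i p"
proof -
  have "\<exists>A. local_eq \<theta> i p ^ A \<in> local_ideal f i p" if \<theta>: "\<theta> \<in> homog 1" "eval (($) p) \<theta> = 0" for \<theta>
  proof -
    obtain A w where w: "eval (($) p) w \<noteq> 0" "\<theta> ^ A * w \<in> J"
      using locally_nilpotent[OF \<theta> p(2)] by blast
    obtain w' where w': "local_eq w i p * w' = 1"
      using fps2_unit[of "local_eq w i p"] w(1) by (auto simp: coeff2_local_eq_0)
    have "local_eq \<theta> i p ^ A * local_eq w i p \<in> local_ideal f i p"
      using jacobian_in_local_ideal[OF p(1) w(2)] by (simp add: local_eq_hom)
    then have "local_eq \<theta> i p ^ A * local_eq w i p * w' \<in> local_ideal f i p"
      by (rule ideal_mult_right[OF ideal_local_ideal])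
    then show ?thesis using w' by (auto simp: mult.assoc)
  qed
  from this[OF coordinate_forms_homog(1) eval_coordinate_forms(1)[OF p(1)]]
    this[OF coordinate_forms_homog(2) eval_coordinate_forms(2)[OF p(1)]]
  obtain A B where "U ^ A \<in> local_ideal f i p" "V ^ B \<in> local_ideal f i p"
    unfolding local_eq_coordinates[OF p(1)] by blast
  then show ?thesis using order_ge_in_ideal[OF ideal_local_ideal] by blast
qed

text \<open>Local membership in the extended ideal is membership in \<open>J\<close> up to a form that does not vanish at
  the point: truncate the power series coefficients, and absorb the remainder of high order.\<close>

lemma clear_denominator:
  fixes p :: "complex^3"
  assumes p: "p $ i = 1" "eval (($) p) l \<noteq> 0"
    and F: "F \<in> homog k" "local_eq F i p \<in> local_ideal f i p"
  shows "\<exists>m. \<exists>e\<in>homog m. eval (($) p) e \<noteq> 0 \<and> e * F \<in> J"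
proof -
  obtain A m\<^sub>1 w\<^sub>1 where w\<^sub>1: "w\<^sub>1 \<in> homog m\<^sub>1" "eval (($) p) w\<^sub>1 \<noteq> 0" "u_form i p ^ A * w\<^sub>1 \<in> J"
    using locally_nilpotent[OF coordinate_forms_homog(1) eval_coordinate_forms(1)[OF p(1)] p(2)] by blast
  obtain B m\<^sub>2 w\<^sub>2 where w\<^sub>2: "w\<^sub>2 \<in> homog m\<^sub>2" "eval (($) p) w\<^sub>2 \<noteq> 0" "v_form i p ^ B * w\<^sub>2 \<in> J"
    using locally_nilpotent[OF coordinate_forms_homog(2) eval_coordinate_forms(2)[OF p(1)] p(2)] by blast
  obtain c where c: "local_eq F i p = (\<Sum>j\<in>UNIV. c j * local_eq (pd j f) i p)"
    using ideal.span_imageE[of UNIV "local_eq F i p" "\<lambda>j. local_eq (pd j f) i p"] F(2)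
    unfolding local_ideal_eq[OF f d p(1)] by auto
  \<comment> \<open>The factor \<open>x\<^sub>i\<close> to the \<open>M\<close> is 1 in the chart, and makes the degree \<open>n\<close> of the coefficients large
    enough for jets of order \<open>A + B\<close>.\<close>
  define M where "M = 2 * (A + B) + (d - 1)"
  define n where "n = M + k - (d - 1)"
  have "\<exists>C\<in>homog n. local_eq C i p - c j \<in> order_ge (A + B)" for j
    by (rule ex_form_with_jet[OF p(1)]) (simp add: n_def M_def)
  then obtain C where C: "\<And>j. C j \<in> homog n" "\<And>j. local_eq (C j) i p - c j \<in> order_ge (A + B)"
    by metis
  define H where "H = var i ^ M * F - (\<Sum>j\<in>UNIV. C j * pd j f)"
  have "n + (d - 1) = M + k" by (simp add: n_def M_def)
  then have "C j * pd j f \<in> homog (M + k)" for j by (rule homog_mult_eq[OF C(1) pd_homog[OF f]])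
  then have "H \<in> homog (M + k)" unfolding H_def
    by (intro homog_diff homog_sum homog_mult[OF homog_power1[OF homog_var] F(1)])
  moreover have "local_eq H i p \<in> order_ge (A + B)"
  proof -
    have "local_eq H i p = - (\<Sum>j\<in>UNIV. (local_eq (C j) i p - c j) * local_eq (pd j f) i p)"
      by (simp add: H_def local_eq_hom local_eq_coordinates[OF p(1)] c left_diff_distrib sum_subtractf)
    also have "\<dots> \<in> order_ge (A + B)"
      by (intro ideal.subspace_neg ideal.subspace_sum ideal_mult_right ideal_order_ge C(2))
    finally show ?thesis .
  qed
  ultimately have wH: "w\<^sub>1 * w\<^sub>2 * H \<in> J"
    by (rule high_order_in_ideal[OF p(1) _ _ ideal_jacobian w\<^sub>1(3) w\<^sub>2(3)])
  have "w\<^sub>1 * w\<^sub>2 * H + w\<^sub>1 * w\<^sub>2 * (\<Sum>j\<in>UNIV. C j * pd j f) \<in> J"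
    by (intro ideal.subspace_add[OF ideal_jacobian wH] ideal.subspace_scale ideal_jacobian
        jacobian_ideal_sum)
  then have "(w\<^sub>1 * w\<^sub>2 * var i ^ M) * F \<in> J" by (simp add: H_def algebra_simps)
  moreover have "w\<^sub>1 * w\<^sub>2 * var i ^ M \<in> homog (m\<^sub>1 + m\<^sub>2 + M)"
    by (intro homog_mult w\<^sub>1 w\<^sub>2 homog_power1 homog_var)
  moreover have "eval (($) p) (w\<^sub>1 * w\<^sub>2 * var i ^ M) \<noteq> 0"
    using w\<^sub>1(2) w\<^sub>2(2) p(1) by (simp add: ev.subst_hom)
  ultimately show ?thesis by blast
qed

end

subsection \<open>Affine charts at the points of the plane\<close>

definition chart :: "(complex^3) set \<Rightarrow> 3" where
  "chart P = (SOME i. (SOME p. p \<in> P) $ i \<noteq> 0)"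

definition chart_point :: "(complex^3) set \<Rightarrow> complex^3" where
  "chart_point P = (1 / (SOME p. p \<in> P) $ chart P) *s (SOME p. p \<in> P)"

lemma tjurina_eq: "tjurina f P =
    quot_dim (\<lambda>c h. fps2_const c * h) UNIV (local_ideal f (chart P) (chart_point P))"
  by (simp add: tjurina_def local_ideal_def chart_def chart_point_def Let_def)

lemma chart_point:
  assumes "P \<in> plane"
  shows "chart_point P \<in> P" "chart_point P $ chart P = 1" "P = pclass (*s) (chart_point P)"
proof -
  obtain q where q: "q \<noteq> 0" "P = pclass (*s) q" "q \<in> P" using assms by (rule planeE)
  define r where "r = (SOME p. p \<in> P)"
  have "r \<in> P" unfolding r_def using q(3) by (rule someI)
  then obtain c where c: "c \<noteq> 0" "r = c *s q" unfolding q(2) by (rule pclass_memE)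
  then have "r \<noteq> 0" using q(1) by simp
  then have "\<exists>i. r $ i \<noteq> 0" by (auto simp: vec_eq_iff)
  then have i: "r $ chart P \<noteq> 0" unfolding chart_def r_def[symmetric] by (rule someI_ex)
  have pt: "chart_point P = (1 / r $ chart P) *s r" by (simp add: chart_point_def r_def)
  then show "chart_point P $ chart P = 1" using i by simp
  let ?b = "c / r $ chart P"
  have b: "?b \<noteq> 0" "chart_point P = ?b *s q" using c i by (simp_all add: pt)
  then show "chart_point P \<in> P" unfolding q(2) pclass_def by blast
  show "P = pclass (*s) (chart_point P)"
    unfolding b(2) pclass_vector_scale[OF b(1)] by (rule q(2))
qed

text \<open>The linear forms \<open>x\<^sub>b - q\<^sub>b x\<^sub>i\<close>, where \<open>q\<^sub>i = 1\<close>, have the point \<open>q\<close> as their only common zero.\<close>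

lemma separating_linear_form:
  assumes PQ: "P \<in> plane" "Q \<in> plane" "P \<noteq> Q"
  shows "\<exists>\<theta>\<in>homog 1. eval (($) (chart_point Q)) \<theta> = 0 \<and> eval (($) (chart_point P)) \<theta> \<noteq> 0"
proof (rule ccontr)
  assume not: "\<not> ?thesis"
  let ?p = "chart_point P" and ?q = "chart_point Q"
  have p: "?p $ b = ?p $ chart Q * ?q $ b" for b
  proof -
    let ?\<theta> = "var b - smul (?q $ b) (var (chart Q)) :: ternary"
    have "?\<theta> \<in> homog 1" by (intro homog_diff homog_smul homog_var)
    moreover have "eval (($) ?q) ?\<theta> = 0" using chart_point(2)[OF PQ(2)] by (simp add: ev.subst_hom)
    ultimately have "eval (($) ?p) ?\<theta> = 0" using not by blast
    then show ?thesis by (simp add: ev.subst_hom mult.commute)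
  qed
  have "?p $ chart Q \<noteq> 0" using p[of "chart P"] chart_point(2)[OF PQ(1)] by auto
  moreover have "?p = (?p $ chart Q) *s ?q"
    unfolding vec_eq_iff vector_smult_component by (intro allI p)
  ultimately have "pclass (*s) ?p = pclass (*s) ?q" using pclass_vector_scale by metis
  then have "P = Q" using chart_point(3) PQ by metis
  then show False using PQ(3) by blast
qed

section \<open>The total Tjurina number\<close>

context avoiding_line
begin

abbreviation "Sing \<equiv> sing_points f"
abbreviation "local_at P F \<equiv> local_eq F (chart P) (chart_point P)"
abbreviation "ideal_at P \<equiv> local_ideal f (chart P) (chart_point P)"

lemma Sing_point:
  assumes "P \<in> Sing"
  shows "P \<in> plane" "chart_point P $ chart P = 1" "eval (($) (chart_point P)) l \<noteq> 0"
proof -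
  show P: "P \<in> plane" using assms by (simp add: sing_points_def)
  show "chart_point P $ chart P = 1" by (rule chart_point(2)[OF P])
  show "eval (($) (chart_point P)) l \<noteq> 0" by (rule avoids[OF assms chart_point(1)[OF P]])
qed

text \<open>If \<open>F\<close> lies in all the local ideals, then the forms \<open>h\<close> with \<open>h F \<in> J\<close> have no common zero: away from
  \<open>Sing\<close> a partial derivative does not vanish, and at its points a denominator can be cleared.\<close>

lemma locally_in_ideal:
  assumes F: "F \<in> homog k" "\<And>P. P \<in> Sing \<Longrightarrow> local_at P F \<in> ideal_at P"
  shows "\<exists>n. l ^ n * F \<in> J"
proof (rule ccontr)
  assume not: "\<not> ?thesis"
  define K where "K = {h. h * F \<in> J}"
  have K: "ideal.subspace K" unfolding ideal.subspace_def K_def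
    using ideal_jacobian[of f] by (auto simp: ideal.subspace_def distrib_right mult.assoc)
  have JK: "J \<subseteq> K" unfolding K_def using ideal_mult_right[OF ideal_jacobian] by auto
  have proper: "l ^ n \<notin> K" for n using not by (simp add: K_def)
  have "\<exists>p n. p \<noteq> 0 \<and> degree p \<le> n \<and> homogenize (var j) l n p \<in> K" for j
    using binary_relation[OF homog_var, of j] JK by blast
  then obtain q where q: "eval (($) q) l = 1" "\<forall>m. \<forall>G\<in>homog m \<inter> K. eval (($) q) G = 0"
    using nullstellensatz[OF K proper line_form_homog] by blast
  have "q \<noteq> 0" using q(1) by (auto simp: eval_line_form)
  moreover have "eval (($) q) (pd i f) = 0" for i
    using q(2) pd_homog[OF f, of i] pd_in_jacobian[of i f] JK by blast
  ultimately have P: "pclass (*s) q \<in> Sing" by (intro sing_pointsI[OF f d])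
  let ?P = "pclass (*s) q"
  obtain m e where e: "e \<in> homog m" "eval (($) (chart_point ?P)) e \<noteq> 0" "e * F \<in> J"
    using clear_denominator[OF Sing_point(2,3)[OF P] F(1) F(2)[OF P]] by blast
  obtain c where "chart_point ?P = c *s q"
    using chart_point(1)[OF Sing_point(1)[OF P]] by (rule pclass_memE)
  then have "eval (($) q) e \<noteq> 0" using e(2) eval_scale_point[OF e(1), of c q] by auto
  moreover have "e \<in> homog m \<inter> K" using e by (simp add: K_def)
  ultimately show False using q(2) by blast
qed

text \<open>The local ideals contain powers of the maximal ideals, so it is enough to prescribe jets. A form
  with a suitable jet at \<open>P\<close> is multiplied by powers of linear forms through the other points, which
  are units at \<open>P\<close>.\<close>

lemma ex_form_with_local_class:
  assumes fin: "finite Sing"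
  shows "\<exists>k\<^sub>2. \<forall>k\<ge>k\<^sub>2. \<forall>P\<in>Sing. \<forall>b. \<exists>F\<in>homog k. local_at P F - b \<in> ideal_at P \<and>
    (\<forall>Q\<in>Sing. Q \<noteq> P \<longrightarrow> local_at Q F \<in> ideal_at Q)"
proof -
  have "\<exists>N. order_ge N \<subseteq> ideal_at P" if "P \<in> Sing" for P
    using order_ge_in_local_ideal[OF Sing_point(2,3)[OF that]] .
  then obtain N\<^sub>0 where N\<^sub>0: "\<And>P. P \<in> Sing \<Longrightarrow> order_ge (N\<^sub>0 P) \<subseteq> ideal_at P" by metis
  define N where "N = (\<Sum>P\<in>Sing. N\<^sub>0 P)"
  have N: "order_ge N \<subseteq> ideal_at P" if P: "P \<in> Sing" for P
  proof -
    have "N\<^sub>0 P \<le> N" unfolding N_def using fin P by (intro member_le_sum) auto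
    then show ?thesis using order_ge_antimono N\<^sub>0[OF P] by blast
  qed
  have "\<exists>F\<in>homog k. local_at P F - b \<in> ideal_at P \<and> (\<forall>Q\<in>Sing. Q \<noteq> P \<longrightarrow> local_at Q F \<in> ideal_at Q)"
    \<comment> \<open>\<open>2 N\<close> is for the jet at \<open>P\<close>, and \<open>N\<close> for the linear form through each of the other points.\<close>
    if k: "2 * N + N * card Sing \<le> k" and P: "P \<in> Sing" for k P b
  proof -
    have "\<exists>\<theta>\<in>homog 1. eval (($) (chart_point Q)) \<theta> = 0 \<and> eval (($) (chart_point P)) \<theta> \<noteq> 0"
      if "Q \<in> Sing - {P}" for Q
      using separating_linear_form[of P Q] Sing_point(1) P that by blast
    then obtain \<theta> where \<theta>: "\<And>Q. Q \<in> Sing - {P} \<Longrightarrow> \<theta> Q \<in> homog 1 \<and>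
        eval (($) (chart_point Q)) (\<theta> Q) = 0 \<and> eval (($) (chart_point P)) (\<theta> Q) \<noteq> 0" by metis
    define E where "E = (\<Prod>Q\<in>Sing - {P}. \<theta> Q ^ N)"
    define D where "D = (\<Sum>Q\<in>Sing - {P}. N)"
    have E: "E \<in> homog D" unfolding E_def D_def
      by (intro homog_prod homog_power1) (use \<theta> in blast)
    have "D \<le> N * card Sing" using fin by (simp add: D_def card_Diff_subset_Int mult.commute card_Diff1_le)
    then have kD: "2 * N \<le> k - D" "k - D + D = k" using k by simp_all
    have "eval (($) (chart_point P)) E \<noteq> 0"
      using \<theta> fin by (auto simp: E_def ev.subst_hom prod_zero_iff)
    then obtain E' where E': "local_at P E * E' = 1"
      using fps2_unit[of "local_at P E"] by (auto simp: coeff2_local_eq_0)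
    obtain F\<^sub>0 where F\<^sub>0: "F\<^sub>0 \<in> homog (k - D)" "local_at P F\<^sub>0 - b * E' \<in> order_ge N"
      using ex_form_with_jet[OF Sing_point(2)[OF P] kD(1)] by blast
    have "local_at P F\<^sub>0 - b * E' \<in> ideal_at P" using F\<^sub>0(2) N[OF P] by blast
    then have "(local_at P F\<^sub>0 - b * E') * local_at P E \<in> ideal_at P"
      by (rule ideal_mult_right[OF ideal_local_ideal])
    moreover have "(local_at P F\<^sub>0 - b * E') * local_at P E = local_at P (F\<^sub>0 * E) - b"
    proof -
      have "b * E' * local_at P E = b" using E' by (simp add: mult.assoc mult.commute[of E'])
      then show ?thesis by (simp add: local_eq_hom left_diff_distrib)
    qed
    ultimately have "local_at P (F\<^sub>0 * E) - b \<in> ideal_at P" by simp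
    moreover have "local_at Q (F\<^sub>0 * E) \<in> ideal_at Q" if Q: "Q \<in> Sing" "Q \<noteq> P" for Q
    proof -
      have "local_at Q (\<theta> Q) \<in> order_ge 1"
        using \<theta>[of Q] Q by (simp add: order_ge_def coeff2_local_eq_0)
      then have "local_at Q (\<theta> Q) ^ N \<in> ideal_at Q" using order_ge_power N[OF Q(1)] by blast
      moreover have "E = (\<Prod>R\<in>Sing - {P} - {Q}. \<theta> R ^ N) * \<theta> Q ^ N"
        unfolding E_def using fin Q by (simp add: prod.remove[of _ Q] mult.commute)
      then have "local_at Q (F\<^sub>0 * E) =
          local_at Q (F\<^sub>0 * (\<Prod>R\<in>Sing - {P} - {Q}. \<theta> R ^ N)) * local_at Q (\<theta> Q) ^ N"
        by (simp add: local_eq_hom mult.assoc)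
      ultimately show ?thesis using ideal.subspace_scale[OF ideal_local_ideal] by simp
    qed
    moreover have "F\<^sub>0 * E \<in> homog k" by (rule homog_mult_eq[OF F\<^sub>0(1) E kD(2)])
    ultimately show ?thesis by blast
  qed
  then show ?thesis by (intro exI[of _ "2 * N + N * card Sing"]) blast
qed

text \<open>The monomials of bounded exponents span modulo a power of the maximal ideal.\<close>

lemma tjurina_finite:
  assumes "P \<in> Sing"
  shows "\<exists>m. tjurina f P \<le> enat m"
proof -
  obtain N where N: "order_ge N \<subseteq> ideal_at P"
    using order_ge_in_local_ideal[OF Sing_point(2,3)[OF assms]] by blast
  let ?B = "(\<lambda>(a, b). U ^ a * V ^ b) ` ({..<N} \<times> {..<N})"
  have "h \<in> fp.span (?B \<union> ideal_at P)" for h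
  proof -
    have "truncate2 N h \<in> fp.span (?B \<union> ideal_at P)"
      unfolding truncate2_def by (intro fp.span_sum fp.span_scale fp.span_base) auto
    moreover have "h - truncate2 N h \<in> fp.span (?B \<union> ideal_at P)"
      using truncate2_order N by (intro fp.span_base) blast
    ultimately have "truncate2 N h + (h - truncate2 N h) \<in> fp.span (?B \<union> ideal_at P)"
      by (rule fp.span_add)
    then show ?thesis by simp
  qed
  then have "\<exists>B. finite B \<and> B \<subseteq> UNIV \<and> card B \<le> card ?B \<and> UNIV \<subseteq> fp.span (B \<union> ideal_at P)"
    by (intro exI[of _ ?B]) auto
  then show ?thesis
    unfolding tjurina_eq fp.quot_dim_le_iff[OF subspace_of_local_ideal[OF ideal_local_ideal], symmetric]
    by blast
qed

lemma sum_enat: "finite A \<Longrightarrow> (\<Sum>a\<in>A. enat (g a)) = enat (\<Sum>a\<in>A. g a)"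
  by (induction A rule: finite_induct) (simp_all add: zero_enat_def)

text \<open>The map from \<open>S\<^sub>k\<close> to the product of the local Tjurina algebras is onto for large \<open>k\<close>, and kills the
  jacobian ideal.\<close>

lemma total_tjurina_le:
  assumes fin: "finite Sing"
  shows "\<exists>k\<^sub>2. \<forall>k\<ge>k\<^sub>2. total_tjurina f \<le> milnor_dim k f"
proof -
  obtain k\<^sub>2 where k\<^sub>2: "\<forall>k\<ge>k\<^sub>2. \<forall>P\<in>Sing. \<forall>b. \<exists>F\<in>homog k. local_at P F - b \<in> ideal_at P \<and>
      (\<forall>Q\<in>Sing. Q \<noteq> P \<longrightarrow> local_at Q F \<in> ideal_at Q)" using ex_form_with_local_class[OF fin] by blast
  define basis_at where "basis_at P B \<longleftrightarrow> finite B \<and>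
      (\<forall>c. (\<Sum>b\<in>B. fps2_const (c b) * b) \<in> ideal_at P \<longrightarrow> (\<forall>b\<in>B. c b = 0)) \<and>
      tjurina f P = enat (card B)" for P B
  have "\<exists>B. basis_at P B" if P: "P \<in> Sing" for P
  proof -
    obtain m where m: "quot_dim (\<lambda>c h. fps2_const c * h) UNIV (ideal_at P) \<le> enat m"
      using tjurina_finite[OF P] unfolding tjurina_eq by blast
    obtain B where "finite B" "B \<subseteq> UNIV"
      "\<And>c. (\<Sum>b\<in>B. fps2_const (c b) * b) \<in> ideal_at P \<Longrightarrow> \<forall>b\<in>B. c b = 0"
      "quot_dim (\<lambda>c h. fps2_const c * h) UNIV (ideal_at P) = enat (card B)"
      using fp.quot_dim_attained[OF m] by blast
    then show ?thesis unfolding basis_at_def tjurina_eq by blast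
  qed
  then obtain B where "\<And>P. P \<in> Sing \<Longrightarrow> basis_at P (B P)" by metis
  then have B: "\<And>P. P \<in> Sing \<Longrightarrow> finite (B P)"
    "\<And>P c. P \<in> Sing \<Longrightarrow> (\<Sum>b\<in>B P. fps2_const (c b) * b) \<in> ideal_at P \<Longrightarrow> \<forall>b\<in>B P. c b = 0"
    "\<And>P. P \<in> Sing \<Longrightarrow> tjurina f P = enat (card (B P))" unfolding basis_at_def by blast+
  let ?I = "Sigma Sing B"
  have finI: "finite ?I" using fin B(1) by (intro finite_SigmaI)
  have total: "total_tjurina f = enat (card ?I)"
    unfolding total_tjurina_def using fin B(1,3) by (simp add: sum_enat)
  have "total_tjurina f \<le> milnor_dim k f" if k: "k \<ge> k\<^sub>2" for k
  proof -
    obtain n where n: "milnor_dim k f = enat n" using milnor_dim_finite[of k f] enat_ile by blast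
    define lift where "lift P b F \<longleftrightarrow> F \<in> homog k \<and> local_at P F - b \<in> ideal_at P \<and>
      (\<forall>Q\<in>Sing. Q \<noteq> P \<longrightarrow> local_at Q F \<in> ideal_at Q)" for P b F
    have "\<exists>F. lift P b F" if "P \<in> Sing" for P b unfolding lift_def using k\<^sub>2 k that by blast
    then obtain F where "\<And>P b. P \<in> Sing \<Longrightarrow> lift P b (F P b)" by metis
    then have F: "\<And>P b. P \<in> Sing \<Longrightarrow> F P b \<in> homog k"
      "\<And>P b. P \<in> Sing \<Longrightarrow> local_at P (F P b) - b \<in> ideal_at P"
      "\<And>P b Q. P \<in> Sing \<Longrightarrow> Q \<in> Sing \<Longrightarrow> Q \<noteq> P \<Longrightarrow> local_at Q (F P b) \<in> ideal_at Q"
      unfolding lift_def by blast+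
    have "card ?I \<le> n"
    proof (rule ccontr)
      assume "\<not> card ?I \<le> n"
      then have card: "n < card ?I" by simp
      have le: "quot_dim smul (homog k) (homog k \<inter> J) \<le> enat n" using n by (simp add: milnor_dim_def)
      have im: "(\<lambda>(P, b). F P b) ` ?I \<subseteq> homog k" using F(1) by auto
      obtain x where x: "\<exists>i\<in>?I. x i \<noteq> 0"
          "(\<Sum>i\<in>?I. smul (x i) ((\<lambda>(P, b). F P b) i)) \<in> homog k \<inter> J"
        by (rule mp.quot_dim_relation[OF subspace_jacobian_degree le finI im card])
      define R where "R = (\<Sum>P\<in>Sing. \<Sum>b\<in>B P. smul (x (P, b)) (F P b))"
      have "R = (\<Sum>i\<in>?I. smul (x i) ((\<lambda>(P, b). F P b) i))"
        unfolding R_def using fin B(1) by (simp add: sum.Sigma case_prod_unfold)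
      then have "R \<in> J" using x(2) by simp
      have "x (P, b) = 0" if P: "P \<in> Sing" "b \<in> B P" for P b
      proof -
        note sub = ideal_local_ideal[of f "chart P" "chart_point P"]
        have "(\<Sum>Q\<in>Sing - {P}. \<Sum>b\<in>B Q. fps2_const (x (Q, b)) * local_at P (F Q b)) +
            (\<Sum>b\<in>B P. fps2_const (x (P, b)) * (local_at P (F P b) - b)) \<in> ideal_at P" (is "?r \<in> _")
          using F(2)[OF P(1)] F(3)[OF _ P(1)]
          by (intro ideal.subspace_add[OF sub] ideal.subspace_sum[OF sub] ideal.subspace_scale[OF sub]) auto
        moreover have "local_at P R \<in> ideal_at P"
          by (rule jacobian_in_local_ideal[OF Sing_point(2)[OF P(1)] \<open>R \<in> J\<close>])
        ultimately have "local_at P R - ?r \<in> ideal_at P" by (intro ideal.subspace_diff[OF sub])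
        also have "local_at P R - ?r = (\<Sum>b\<in>B P. fps2_const (x (P, b)) * b)"
          unfolding R_def local_eq_hom using fin P(1)
          by (simp add: sum.remove[of Sing P] right_diff_distrib sum_subtractf)
        finally show ?thesis using B(2)[OF P(1), of "\<lambda>b. x (P, b)"] P(2) by blast
      qed
      then show False using x(1) by auto
    qed
    then show ?thesis using total n by simp
  qed
  then show ?thesis by blast
qed

text \<open>For large \<open>k\<close> this map is injective modulo the jacobian ideal.\<close>

lemma milnor_dim_le_total_tjurina:
  assumes fin: "finite Sing"
  shows "\<exists>k\<^sub>1. \<forall>k\<ge>k\<^sub>1. milnor_dim k f \<le> total_tjurina f"
proof -
  obtain k\<^sub>1 n where k\<^sub>1: "k\<^sub>1 \<ge> 2 * d" "\<And>k. k \<ge> k\<^sub>1 \<Longrightarrow> milnor_dim k f = enat n"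
    using milnor_dim_eventually_const by blast
  define generates_at where "generates_at P B m \<longleftrightarrow> finite B \<and> card B \<le> m \<and>
      UNIV \<subseteq> fp.span (B \<union> ideal_at P) \<and> tjurina f P = enat m" for P B m
  have "\<exists>B m. generates_at P B m" if P: "P \<in> Sing" for P
  proof -
    obtain m where m: "tjurina f P = enat m" using tjurina_finite[OF P] enat_ile by blast
    then have "quot_dim (\<lambda>c h. fps2_const c * h) UNIV (ideal_at P) \<le> enat m" by (simp add: tjurina_eq)
    then show ?thesis
      unfolding fp.quot_dim_le_iff[OF subspace_of_local_ideal[OF ideal_local_ideal]] generates_at_def
      using m by blast
  qed
  then obtain B m where "\<And>P. P \<in> Sing \<Longrightarrow> generates_at P (B P) (m P)" by metis
  then have B: "\<And>P. P \<in> Sing \<Longrightarrow> finite (B P)" "\<And>P. P \<in> Sing \<Longrightarrow> card (B P) \<le> m P"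
    "\<And>P. P \<in> Sing \<Longrightarrow> UNIV \<subseteq> fp.span (B P \<union> ideal_at P)"
    "\<And>P. P \<in> Sing \<Longrightarrow> tjurina f P = enat (m P)" unfolding generates_at_def by blast+
  have total: "total_tjurina f = enat (\<Sum>P\<in>Sing. m P)"
    unfolding total_tjurina_def using fin B(4) by (simp add: sum_enat)
  let ?I = "Sigma Sing B"
  have finI: "finite ?I" using fin B(1) by (intro finite_SigmaI)
  have "card ?I \<le> (\<Sum>P\<in>Sing. m P)" using fin B(1,2) by (simp add: sum_mono)
  define split_at where "split_at P h c w \<longleftrightarrow>
      w \<in> ideal_at P \<and> h = (\<Sum>b\<in>B P. fps2_const (c b) * b) + w" for P h c w
  have "\<exists>c w. split_at P h c w" if P: "P \<in> Sing" for P h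
  proof -
    note sub = subspace_of_local_ideal[OF ideal_local_ideal[of f "chart P" "chart_point P"]]
    have "h \<in> fp.span (B P \<union> ideal_at P)" using B(3)[OF P] by blast
    then obtain y w where "h = y + w" "y \<in> fp.span (B P)" "w \<in> fp.span (ideal_at P)"
      unfolding fp.span_Un by blast
    moreover have "fp.span (ideal_at P) = ideal_at P" using sub by (simp add: fp.span_eq_iff)
    moreover obtain c where "y = (\<Sum>b\<in>B P. fps2_const (c b) * b)"
      using \<open>y \<in> fp.span (B P)\<close> fp.span_finite[OF B(1)[OF P]] by auto
    ultimately show ?thesis unfolding split_at_def by blast
  qed
  then obtain a w where "\<And>P h. P \<in> Sing \<Longrightarrow> split_at P h (a P h) (w P h)" by metis
  then have aw: "\<And>P h. P \<in> Sing \<Longrightarrow> w P h \<in> ideal_at P \<and>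
      h = (\<Sum>b\<in>B P. fps2_const (a P h b) * b) + w P h" unfolding split_at_def by blast
  have "milnor_dim k f \<le> total_tjurina f" if k: "k \<ge> k\<^sub>1" for k
  proof -
    have dim: "quot_dim smul (homog k) (homog k \<inter> J) = enat n"
      using k\<^sub>1(2)[OF k] by (simp add: milnor_dim_def)
    obtain C where C: "finite C" "C \<subseteq> homog k"
      "\<And>c. (\<Sum>b\<in>C. smul (c b) b) \<in> homog k \<inter> J \<Longrightarrow> \<forall>b\<in>C. c b = 0" "enat n = enat (card C)"
      using mp.quot_dim_attained[of "homog k" "homog k \<inter> J" n] unfolding dim by blast
    have "n \<le> card ?I"
    proof (rule ccontr)
      assume "\<not> n \<le> card ?I"
      then have "card ?I < card C" using C(4) by simp
      then obtain x where x: "\<exists>F\<in>C. x F \<noteq> 0"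
          "\<forall>i\<in>?I. (\<Sum>F\<in>C. x F * (case i of (P, b) \<Rightarrow> a P (local_at P F) b)) = 0"
        using linear_system_nontrivial[OF finI C(1), of "\<lambda>F i. case i of (P, b) \<Rightarrow> a P (local_at P F) b"]
        by blast
      define R where "R = (\<Sum>F\<in>C. smul (x F) F)"
      have "R \<in> homog k" unfolding R_def using C(2) by (intro homog_sum homog_smul) auto
      have "local_at P R \<in> ideal_at P" if P: "P \<in> Sing" for P
      proof -
        have "local_at P R = (\<Sum>F\<in>C. fps2_const (x F) * local_at P F)"
          by (simp add: R_def local_eq_hom)
        also have "\<dots> = (\<Sum>F\<in>C. fps2_const (x F) * ((\<Sum>b\<in>B P. fps2_const (a P (local_at P F) b) * b) +
            w P (local_at P F)))"
          using aw[OF P] by (intro sum.cong refl arg_cong2[of _ _ _ _ "(*)"]) blast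
        also have "\<dots> = (\<Sum>F\<in>C. \<Sum>b\<in>B P. fps2_const (x F * a P (local_at P F) b) * b) +
            (\<Sum>F\<in>C. fps2_const (x F) * w P (local_at P F))"
          by (simp add: distrib_left sum.distrib sum_distrib_left)
        also have "(\<Sum>F\<in>C. \<Sum>b\<in>B P. fps2_const (x F * a P (local_at P F) b) * b) = 0"
        proof -
          have "(\<Sum>F\<in>C. \<Sum>b\<in>B P. fps2_const (x F * a P (local_at P F) b) * b) =
              (\<Sum>b\<in>B P. fps2_const (\<Sum>F\<in>C. x F * a P (local_at P F) b) * b)"
            by (subst sum.swap) (rule sum.cong[OF refl], rule fp.scale_sum_left[symmetric])
          also have "\<dots> = 0" using x(2) P by (intro sum.neutral) (auto simp: fps2.hom_zero)
          finally show ?thesis .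
        qed
        also have "0 + (\<Sum>F\<in>C. fps2_const (x F) * w P (local_at P F)) \<in> ideal_at P"
          using aw[OF P] ideal_local_ideal
          by (intro ideal.subspace_add ideal.subspace_sum ideal.subspace_scale ideal.subspace_0) auto
        finally show ?thesis .
      qed
      then obtain j where "l ^ j * R \<in> J" using locally_in_ideal[OF \<open>R \<in> homog k\<close>] by blast
      then have "R \<in> J" using mult_line_form_power_inj[OF k\<^sub>1 k \<open>R \<in> homog k\<close>] by blast
      then have "\<forall>F\<in>C. x F = 0" using C(3)[of x] \<open>R \<in> homog k\<close> by (simp add: R_def)
      then show False using x(1) by blast
    qed
    then show ?thesis using total k\<^sub>1(2)[OF k] \<open>card ?I \<le> _\<close> by simp
  qed
  then show ?thesis by blast
qed

end

text \<open>From degree \<open>2 d\<close> on the numbers \<open>m\<^sub>k(f)\<close> do not increase, and their limit is the total Tjurina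
  number.\<close>

lemma total_tjurina_le_iff:
  assumes "d \<ge> 1" "f \<in> reduced_forms d"
  shows "total_tjurina f \<le> enat m \<longleftrightarrow> (\<exists>k\<ge>2 * d. milnor_dim k f \<le> enat m)"
proof -
  have homog: "f \<in> homog d" and fin: "finite (sing_points f)" using assms(2) by (auto simp: reduced_forms_def forms_def)
  obtain t where "\<forall>P\<in>sing_points f. \<forall>p\<in>P. eval (($) p) (line_form t) \<noteq> 0"
    using ex_line_avoiding[OF fin] by blast
  then interpret avoiding_line d f t using homog assms(1) by unfold_locales auto
  obtain k\<^sub>1 where k\<^sub>1: "\<And>k. k \<ge> k\<^sub>1 \<Longrightarrow> milnor_dim k f \<le> total_tjurina f"
    using milnor_dim_le_total_tjurina[OF fin] by blast
  obtain k\<^sub>2 where k\<^sub>2: "\<And>k. k \<ge> k\<^sub>2 \<Longrightarrow> total_tjurina f \<le> milnor_dim k f"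
    using total_tjurina_le[OF fin] by blast
  show ?thesis
  proof
    assume "total_tjurina f \<le> enat m"
    then show "\<exists>k\<ge>2 * d. milnor_dim k f \<le> enat m"
      using k\<^sub>1[of "max k\<^sub>1 (2 * d)"] by (intro exI[of _ "max k\<^sub>1 (2 * d)"]) auto
  next
    assume "\<exists>k\<ge>2 * d. milnor_dim k f \<le> enat m"
    then obtain k where k: "k \<ge> 2 * d" "milnor_dim k f \<le> enat m" by blast
    have "milnor_dim (max k k\<^sub>2) f \<le> enat m" by (rule milnor_dim_antimono[OF k(1) _ k(2)]) simp
    then show "total_tjurina f \<le> enat m" using k\<^sub>2[of "max k k\<^sub>2"] by auto
  qed
qed

section \<open>The loci of bounded invariants\<close>

text \<open>A smooth curve has no singular points to sum over.\<close>

lemma ex_total_tjurina_zero: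
  assumes "d \<ge> 1"
  shows "\<exists>f\<in>reduced_forms d. total_tjurina f \<le> enat m"
proof -
  obtain f where f: "f \<in> forms d" "milnor_dim (3 * d) f \<le> enat 0" using ex_smooth_form[OF assms] by blast
  then have "sing_points f = {}" using sing_points_empty assms by simp
  then show ?thesis using f(1) by (intro bexI[of _ f]) (simp_all add: reduced_forms_def total_tjurina_def)
qed

lemma open_tjurina:
  assumes "d \<ge> 1"
  shows "open_condition d (\<lambda>f. \<exists>k\<ge>2 * d. milnor_dim k f \<le> enat m)"
  unfolding open_condition_def
proof (intro ballI impI)
  fix f\<^sub>0 assume f\<^sub>0: "f\<^sub>0 \<in> forms d" "\<exists>k\<ge>2 * d. milnor_dim k f\<^sub>0 \<le> enat m"
  then obtain k where k: "k \<ge> 2 * d" "milnor_dim k f\<^sub>0 \<le> enat m" by blast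
  obtain e G where "G \<in> homog e" "eval (lookup f\<^sub>0) G \<noteq> 0"
      "\<And>f. f \<in> forms d \<Longrightarrow> eval (lookup f) G \<noteq> 0 \<Longrightarrow> milnor_dim k f \<le> enat m"
    using open_conditionE[OF open_milnor_dim_le f\<^sub>0(1) k(2)] by blast
  then show "\<exists>e. \<exists>G\<in>homog e. eval (lookup f\<^sub>0) G \<noteq> 0 \<and>
      (\<forall>f\<in>forms d. eval (lookup f) G \<noteq> 0 \<longrightarrow> (\<exists>k\<ge>2 * d. milnor_dim k f \<le> enat m))"
    using k(1) by blast
qed

lemma curve_image_Int:
  assumes "X \<subseteq> forms d" "\<And>f c. c \<noteq> 0 \<Longrightarrow> P (smul c f) = P f"
  shows "curve ` {f \<in> X. P f} = curve ` {f \<in> forms d. P f} \<inter> curve ` X"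
proof (intro equalityI subsetI)
  fix C assume "C \<in> curve ` {f \<in> forms d. P f} \<inter> curve ` X"
  then obtain f g where fg: "P f" "C = curve f" "g \<in> X" "C = curve g" by auto
  then obtain c where "c \<noteq> 0" "g = smul c f" by (metis curve_eqD)
  then show "C \<in> curve ` {f \<in> X. P f}" using fg assms(2) by auto
qed (use assms(1) in auto)

lemma openin_restricted:
  assumes "open_condition d P" "X \<subseteq> forms d" "\<And>f c. c \<noteq> 0 \<Longrightarrow> P (smul c f) = P f"
  shows "openin (subtopology (zariski d) (curve ` X)) (curve ` {f \<in> X. P f})"
  unfolding openin_subtopology
  by (rule exI, rule conjI[OF openin_open_condition[OF assms(1)] curve_image_Int[of X d P, OF assms(2,3)]])

lemma closedin_restricted:
  assumes "open_condition d (\<lambda>f. \<not> P f)" "X \<subseteq> forms d" "\<And>f c. c \<noteq> 0 \<Longrightarrow> P (smul c f) = P f"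
  shows "closedin (subtopology (zariski d) (curve ` X)) (curve ` {f \<in> X. P f})"
  unfolding closedin_subtopology
  by (rule exI, rule conjI[OF closedin_open_condition[OF assms(1)] curve_image_Int[of X d P, OF assms(2,3)]])

theorem proposition2p5:
  fixes d :: nat
  assumes "d \<ge> 1"
  shows
    "(\<forall>k m. openin (zariski d) (curve ` {f \<in> forms d. milnor_dim k f \<le> enat m}) \<and>
        ({f \<in> forms d. milnor_dim k f \<le> enat m} \<noteq> {} \<longrightarrow>
          zariski d closure_of (curve ` {f \<in> forms d. milnor_dim k f \<le> enat m}) = curves d)) \<and>
     (\<forall>m. openin (subtopology (zariski d) (reduced_curves d))
          (curve ` {f \<in> reduced_forms d. total_tjurina f \<le> enat m}) \<and>
        subtopology (zariski d) (reduced_curves d) closure_of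
          (curve ` {f \<in> reduced_forms d. total_tjurina f \<le> enat m}) = reduced_curves d) \<and>
     (\<forall>m. openin (subtopology (zariski d) (arrangements d))
          (curve ` {f \<in> arrangement_forms d. total_tjurina f \<le> enat m}) \<and>
        ({f \<in> arrangement_forms d. total_tjurina f \<le> enat m} \<noteq> {} \<longrightarrow>
          subtopology (zariski d) (arrangements d) closure_of
            (curve ` {f \<in> arrangement_forms d. total_tjurina f \<le> enat m}) = arrangements d)) \<and>
     (\<forall>m. closedin (zariski d) (curve ` {f \<in> forms d. mdr f \<le> m})) \<and>
     (\<forall>m. closedin (subtopology (zariski d) (reduced_curves d))
          (curve ` {f \<in> reduced_forms d. mdr f \<le> m})) \<and>
     (\<forall>m. closedin (subtopology (zariski d) (arrangements d))
          (curve ` {f \<in> arrangement_forms d. mdr f \<le> m}))"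
proof -
  let ?T = "\<lambda>m f. \<exists>k\<ge>2 * d. milnor_dim k f \<le> enat m"
  have red: "reduced_forms d \<subseteq> forms d" by (auto simp: reduced_forms_def)
  have arr: "arrangement_forms d \<subseteq> forms d" using arrangement_forms_reduced red by blast
  have T_red: "{f \<in> reduced_forms d. total_tjurina f \<le> enat m} = {f \<in> reduced_forms d. ?T m f}" for m
    using total_tjurina_le_iff[OF assms] by blast
  have T_arr: "{f \<in> arrangement_forms d. total_tjurina f \<le> enat m} = {f \<in> arrangement_forms d. ?T m f}"
    for m using total_tjurina_le_iff[OF assms] arrangement_forms_reduced by blast
  have T_smul: "?T m (smul c f) = ?T m f" if "c \<noteq> 0" for m f c
    using milnor_dim_smul[OF that] by simp
  have mdr_smul': "(mdr (smul c f) \<le> m) = (mdr f \<le> m)" if "c \<noteq> 0" for m f c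
    using mdr_smul[OF that] by simp
  have 1: "openin (zariski d) (curve ` {f \<in> forms d. milnor_dim k f \<le> enat m})" for k m
    by (rule openin_open_condition[OF open_milnor_dim_le])
  have 2: "zariski d closure_of (curve ` {f \<in> forms d. milnor_dim k f \<le> enat m}) = curves d"
    if ne: "{f \<in> forms d. milnor_dim k f \<le> enat m} \<noteq> {}" for k m
  proof -
    obtain g where "g \<in> forms d" "milnor_dim k g \<le> enat m" using ne by blast
    from dense_of_irreducible[OF irreducible_all_forms open_milnor_dim_le this]
    have "subtopology (zariski d) (topspace (zariski d)) closure_of
        (curve ` {f \<in> forms d. milnor_dim k f \<le> enat m}) = curves d" by (simp add: curves_def)
    then show ?thesis unfolding subtopology_topspace .
  qed
  have 3: "openin (subtopology (zariski d) (reduced_curves d))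
      (curve ` {f \<in> reduced_forms d. total_tjurina f \<le> enat m})" for m
    unfolding T_red reduced_curves_def by (rule openin_restricted[OF open_tjurina[OF assms] red T_smul])
  have 4: "subtopology (zariski d) (reduced_curves d) closure_of
      (curve ` {f \<in> reduced_forms d. total_tjurina f \<le> enat m}) = reduced_curves d" for m
  proof -
    obtain g where g: "g \<in> reduced_forms d" "total_tjurina g \<le> enat m"
      using ex_total_tjurina_zero[OF assms] by blast
    then have "?T m g" using total_tjurina_le_iff[OF assms] by blast
    with g(1) show ?thesis unfolding T_red reduced_curves_def
      by (rule dense_of_irreducible[OF irreducible_reduced_forms[OF assms] open_tjurina[OF assms]])
  qed
  have 5: "openin (subtopology (zariski d) (arrangements d))
      (curve ` {f \<in> arrangement_forms d. total_tjurina f \<le> enat m})" for m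
    unfolding T_arr arrangements_def by (rule openin_restricted[OF open_tjurina[OF assms] arr T_smul])
  have 6: "subtopology (zariski d) (arrangements d) closure_of
      (curve ` {f \<in> arrangement_forms d. total_tjurina f \<le> enat m}) = arrangements d"
    if ne: "{f \<in> arrangement_forms d. total_tjurina f \<le> enat m} \<noteq> {}" for m
  proof -
    obtain g where "g \<in> arrangement_forms d" "?T m g" using ne unfolding T_arr by blast
    then show ?thesis unfolding T_arr arrangements_def
      by (rule dense_of_irreducible[OF irreducible_arrangement_forms open_tjurina[OF assms]])
  qed
  have 7: "closedin (zariski d) (curve ` {f \<in> forms d. mdr f \<le> m})" for m
    by (rule closedin_open_condition[OF open_no_syzygy])
  have 8: "closedin (subtopology (zariski d) (reduced_curves d))
      (curve ` {f \<in> reduced_forms d. mdr f \<le> m})" for m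
    unfolding reduced_curves_def by (rule closedin_restricted[OF open_no_syzygy red mdr_smul'])
  have 9: "closedin (subtopology (zariski d) (arrangements d))
      (curve ` {f \<in> arrangement_forms d. mdr f \<le> m})" for m
    unfolding arrangements_def by (rule closedin_restricted[OF open_no_syzygy arr mdr_smul'])
  show ?thesis using 1 2 3 4 5 6 7 8 9 by blast
qed

end
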